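(* Assume $[\overline B\cup\overline{B'}]\cap\partial D=\emptyset$ and $$T>\min_{x\in\partial D,\,y\in\partial B,\,y'\in\partial B'}\phi(x;y,y').$$ Then there exists $\tau_0>0$ such that for all $\tau\ge\tau_0$ $$I(\tau)=\int_{B}v_g\,dx-\int_{B'}w_f\,dx>0,$$ and $$\lim_{\tau\to\infty}\frac1\tau\log I(\tau)=-\min_{x\in\partial D,\,y\in\partial B,\,y'\in\partial B'}\phi(x;y,y').$$
   Context: Let $D\subset\mathbb R^3$ be a nonempty bounded open set with $C^2$ boundary such that $\mathbb R^3\setminus\overline D$ is connected. Fix $T\in(0,\infty)$. For $f\in L^2(\mathbb R^3)$ with $\mathrm{supp}\,f\cap\overline D=\emptyset$, let $u_f$ be the weak solution of $\partial_t^2u-\Delta u=0$ in $(\mathbb R^3\setminus\overline D)\times(0,T)$, $u(\cdot,0)=0$ and $\partial_tu(\cdot,0)=f$ in $\mathbb R^3\setminus\overline D$, $u=0$ on $\partial D\times(0,T)$ (sound-soft obstacle). For $\tau>0$ set $w_f(x,\tau)=\int_0^Te^{-\tau t}u_f(x,t)\,dt$, $x\in\mathbb R^3\setminus\overline D$. For $h\in L^2(\mathbb R^3)$, $v_h=v_h(\cdot,\tau)\in H^1(\mathbb R^3)$ is the weak solution of $(\Delta-\tau^2)v+h=0$ in $\mathbb R^3$, i.e. $v_h(x)=\frac1{4\pi}\int_{\mathbb R^3}\frac{e^{-\tau|x-y|}}{|x-y|}h(y)\,dy$. $B,B'$ are open balls with centers $p,p'$ and radii $\eta,\eta'$, with $\overline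 B\cap\overline D=\overline{B'}\cap\overline D=\emptyset$; $f=\chi_B$, $g=\chi_{B'}$ (characteristic functions). $\phi(x;y,y')=|y-x|+|x-y'|$. $[F]$ denotes the convex hull of $F\subset\mathbb R^3$. *)

theory Defs
  imports "HOL-Analysis.Analysis"
begin

definition C2_fun :: "('a::euclidean_space \<Rightarrow> real) \<Rightarrow> bool" where
  "C2_fun \<psi> \<longleftrightarrow> (\<exists>(\<psi>' :: 'a \<Rightarrow> ('a \<Rightarrow>\<^sub>L real)) (\<psi>'' :: 'a \<Rightarrow> ('a \<Rightarrow>\<^sub>L ('a \<Rightarrow>\<^sub>L real))).
      (\<forall>z. (\<psi> has_derivative blinfun_apply (\<psi>' z)) (at z)) \<and>
      (\<forall>z. (\<psi>' has_derivative blinfun_apply (\<psi>'' z)) (at z)) \<and>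
      continuous_on UNIV \<psi>'')"

definition C2_boundary :: "(real^3) set \<Rightarrow> bool" where
  "C2_boundary D \<longleftrightarrow> (\<forall>p \<in> frontier D. \<exists>r>0. \<exists>R :: real^3 \<Rightarrow> real^3. \<exists>\<psi> :: real^2 \<Rightarrow> real.
      orthogonal_transformation R \<and> C2_fun \<psi> \<and>
      (\<forall>x \<in> ball p r. x \<in> D \<longleftrightarrow>
          (R (x - p)) $ 3 < \<psi> (vector [(R (x - p)) $ 1, (R (x - p)) $ 2])))"

definition C1c_on :: "((real^3) \<times> real) set \<Rightarrow> ((real^3) \<times> real \<Rightarrow> real)
                        \<Rightarrow> ((real^3) \<times> real \<Rightarrow> (real^3) \<times> real) \<Rightarrow> bool" where
  "C1c_on U \<eta> \<eta>' \<longleftrightarrow> (\<forall>z. (\<eta> has_derivative (\<lambda>h. \<eta>' z \<bullet> h)) (at z)) \<and>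
      continuous_on UNIV \<eta>' \<and>
      compact (closure {z. \<eta> z \<noteq> 0}) \<and> closure {z. \<eta> z \<noteq> 0} \<subseteq> U"

definition H1_on :: "((real^3) \<times> real) set \<Rightarrow> ((real^3) \<times> real \<Rightarrow> real)
                      \<Rightarrow> ((real^3) \<times> real \<Rightarrow> (real^3) \<times> real) \<Rightarrow> bool" where
  "H1_on U u G \<longleftrightarrow> u \<in> borel_measurable lborel \<and> G \<in> borel_measurable lborel \<and>
      set_integrable lborel U (\<lambda>z. (u z)\<^sup>2) \<and>
      set_integrable lborel U (\<lambda>z. (norm (G z))\<^sup>2) \<and>
      (\<forall>\<phi> \<phi>'. C1c_on U \<phi> \<phi>' \<longrightarrow>
         (\<forall>h. (LINT z:U|lborel. u z * (\<phi>' z \<bullet> h)) = - (LINT z:U|lborel. (G z \<bullet> h) * \<phi> z)))"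

text \<open>Weak (generalized, in the sense of Ladyzhenskaya) solution u of
  u_tt - \<Delta>u = 0 in (R^3 \ closure D) x (0,T), u(.,0) = 0, u_t(.,0) = f, u = 0 on \<partial>D x (0,T).
  u is represented as a function on R^3 x R extended by zero for x in closure D and
  for t \<le> 0; the zero boundary condition on \<partial>D x (0,T) and the initial condition u(.,0)=0
  are encoded by requiring this extension to lie in H^1(R^3 x (-\<infinity>,T)).
  The integral identity is required for all C^1 test functions with compact support
  in (R^3 \ closure D) x (-\<infinity>,T) (i.e. vanishing near \<partial>D x [0,T] and near t = T).
  The gradient G z = (\<nabla>_x u, \<partial>_t u).\<close>
definition wave_weak_sol :: "(real^3) set \<Rightarrow> real \<Rightarrow> (real^3 \<Rightarrow> real)
                              \<Rightarrow> ((real^3) \<times> real \<Rightarrow> real) \<Rightarrow> bool" where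
  "wave_weak_sol D T f u \<longleftrightarrow>
     (\<forall>x t. (x \<in> closure D \<or> t \<le> 0) \<longrightarrow> u (x, t) = 0) \<and>
     (\<exists>G. H1_on (UNIV \<times> {..<T}) u G \<and>
        (\<forall>\<eta> \<eta>'. C1c_on ((- closure D) \<times> {..<T}) \<eta> \<eta>' \<longrightarrow>
           (LINT z:((- closure D) \<times> {0<..<T})|lborel.
                 - (snd (G z) * snd (\<eta>' z)) + fst (G z) \<bullet> fst (\<eta>' z))
           = (LINT x:(- closure D)|lborel. f x * \<eta> (x, 0))))"

definition wlap :: "real \<Rightarrow> ((real^3) \<times> real \<Rightarrow> real) \<Rightarrow> real^3 \<Rightarrow> real \<Rightarrow> real" where
  "wlap T u x \<tau> = (LINT t:{0..T}|lborel. exp (- \<tau> * t) * u (x, t))"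

definition vsol :: "(real^3 \<Rightarrow> real) \<Rightarrow> real^3 \<Rightarrow> real \<Rightarrow> real" where
  "vsol h x \<tau> = (1 / (4 * pi)) * (LINT y|lborel. exp (- \<tau> * dist x y) / dist x y * h y)"

definition Ifun :: "real \<Rightarrow> ((real^3) \<times> real \<Rightarrow> real) \<Rightarrow> real^3 \<Rightarrow> real \<Rightarrow> real^3 \<Rightarrow> real \<Rightarrow> real \<Rightarrow> real" where
  "Ifun T u p r p' r' \<tau> = (LINT x:ball p r|lborel. vsol (indicator (ball p' r')) x \<tau>)
                           - (LINT x:ball p' r'|lborel. wlap T u x \<tau>)"

end

theory Submission
  imports Defs "HOL-Real_Asymp.Real_Asymp"
begin

text \<open>
  Let \<open>W\<close> be the Laplace transform of \<open>u\<close>, cut off smoothly in time shortly before \<open>T\<close>. It solves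
  \<open>(\<tau>\<^sup>2 - \<Delta>) W = \<chi>\<^sub>B + F\<close> outside \<open>D\<close> with zero Dirichlet data, where \<open>F\<close> is of order \<open>\<tau> exp (- \<tau> T1)\<close> for some
  \<open>T1\<close> between the minimal path length \<open>m\<close> and \<open>T\<close>, hence negligible. By symmetry of the Yukawa kernel,
  \<open>I(\<tau>)\<close> is the integral over \<open>B'\<close> of \<open>v - W\<close>, where \<open>v\<close> is the free solution with source \<open>\<chi>\<^sub>B\<close>, up to an error
  of order \<open>exp (- \<tau> T1)\<close>. The difference \<open>v - W\<close> is \<open>(\<tau>\<^sup>2 - \<Delta>)\<close>-harmonic outside \<open>D\<close> and equals \<open>v\<close> on the boundary,
  so it can be compared with barriers by the weak maximum principle. From below: one multiple of a Yukawa
  potential of slightly larger mass \<open>(1 + \<delta>) \<tau>\<close>, centred at a point of \<open>D\<close> near an optimal reflection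
  point. From above: a finite sum of Yukawa potentials centred at the points of a \<open>\<delta>\<close>-net of the
  closure of \<open>D\<close>. Both barriers give the exponent \<open>- m\<close> up to \<open>O(\<delta>)\<close>, which suffices for the logarithmic
  asymptotics.
\<close>

section \<open>Square integrable functions\<close>

definition square_integrable :: "'a measure \<Rightarrow> ('a \<Rightarrow> 'b::euclidean_space) \<Rightarrow> bool" where
  "square_integrable M f \<longleftrightarrow> f \<in> borel_measurable M \<and> integrable M (\<lambda>x. (norm (f x))\<^sup>2)"

definition L2_norm :: "'a measure \<Rightarrow> ('a \<Rightarrow> 'b::euclidean_space) \<Rightarrow> real" where
  "L2_norm M f = sqrt (\<integral>x. (norm (f x))\<^sup>2 \<partial>M)"

lemma square_integrable_measurable [measurable_dest]: "square_integrable M f \<Longrightarrow> f \<in> borel_measurable M"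
  by (simp add: square_integrable_def)

lemma square_integrableD: "square_integrable M f \<Longrightarrow> integrable M (\<lambda>x. (norm (f x))\<^sup>2)"
  by (simp add: square_integrable_def)

lemma square_integrable_bound:
  assumes "f \<in> borel_measurable M" "integrable M g" "\<And>x. (norm (f x))\<^sup>2 \<le> g x"
  shows "square_integrable M f"
  unfolding square_integrable_def
proof
  show "integrable M (\<lambda>x. (norm (f x))\<^sup>2)"
    using assms(1)
    by (intro Bochner_Integration.integrable_bound[OF assms(2)])
       (auto intro!: AE_I2 order_trans[OF assms(3)])
qed fact

lemma L2_norm_nonneg [simp]: "0 \<le> L2_norm M f"
  by (simp add: L2_norm_def)

lemma L2_norm_power2: "(L2_norm M f)\<^sup>2 = (\<integral>x. (norm (f x))\<^sup>2 \<partial>M)"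
  by (simp add: L2_norm_def)

lemma ennreal_L2_norm_power2:
  "square_integrable M f \<Longrightarrow> ennreal ((L2_norm M f)\<^sup>2) = (\<integral>\<^sup>+x. ennreal ((norm (f x))\<^sup>2) \<partial>M)"
  by (simp add: L2_norm_power2 nn_integral_eq_integral square_integrableD)

lemma square_integrable_L2_norm_le:
  assumes f: "f \<in> borel_measurable M" and "0 \<le> C"
    and nn_integral_le: "(\<integral>\<^sup>+x. ennreal ((norm (f x))\<^sup>2) \<partial>M) \<le> ennreal (C\<^sup>2)"
  shows "square_integrable M f" "L2_norm M f \<le> C"
proof -
  show sq: "square_integrable M f"
    unfolding square_integrable_def
  proof
    show "integrable M (\<lambda>x. (norm (f x))\<^sup>2)"
      using f nn_integral_le by (intro integrableI_nonneg) (auto simp: less_top[symmetric] top_unique)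
  qed fact
  have "(L2_norm M f)\<^sup>2 \<le> C\<^sup>2"
    using nn_integral_le by (simp flip: ennreal_L2_norm_power2[OF sq])
  then show "L2_norm M f \<le> C"
    by (rule power2_le_imp_le) fact
qed

lemma norm_integral_scaleR_power2_le:
  fixes g :: "'a \<Rightarrow> 'b::euclidean_space"
  assumes [measurable]: "c \<in> borel_measurable M" "g \<in> borel_measurable M"
  shows "ennreal ((norm (\<integral>x. c x *\<^sub>R g x \<partial>M))\<^sup>2)
    \<le> (\<integral>\<^sup>+x. ennreal ((c x)\<^sup>2) \<partial>M) * (\<integral>\<^sup>+x. ennreal ((norm (g x))\<^sup>2) \<partial>M)"
proof -
  have "ennreal (norm (\<integral>x. c x *\<^sub>R g x \<partial>M)) \<le> (\<integral>\<^sup>+x. ennreal (norm (c x *\<^sub>R g x)) \<partial>M)"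
  proof (cases "integrable M (\<lambda>x. c x *\<^sub>R g x)")
    case False
    then show ?thesis by (simp add: not_integrable_integral_eq)
  qed (rule integral_norm_bound_ennreal)
  also have "\<dots> = (\<integral>\<^sup>+x. ennreal \<bar>c x\<bar> * ennreal (norm (g x)) \<partial>M)"
    by (simp add: ennreal_mult)
  finally have "(ennreal (norm (\<integral>x. c x *\<^sub>R g x \<partial>M)))\<^sup>2 \<le> (\<integral>\<^sup>+x. ennreal \<bar>c x\<bar> * ennreal (norm (g x)) \<partial>M)\<^sup>2"
    by (intro power_mono) auto
  also have "\<dots> \<le> (\<integral>\<^sup>+x. (ennreal \<bar>c x\<bar>)\<^sup>2 \<partial>M) * (\<integral>\<^sup>+x. (ennreal (norm (g x)))\<^sup>2 \<partial>M)"
    by (rule Cauchy_Schwarz_nn_integral) auto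
  finally show ?thesis
    by (simp add: ennreal_power)
qed

lemma integrable_inner_square_integrable:
  assumes "square_integrable M f" "square_integrable M g"
  shows "integrable M (\<lambda>x. f x \<bullet> g x)"
proof (rule Bochner_Integration.integrable_bound)
  show "integrable M (\<lambda>x. (norm (f x))\<^sup>2 + (norm (g x))\<^sup>2)"
    using assms by (auto dest: square_integrableD)
  show "(\<lambda>x. f x \<bullet> g x) \<in> borel_measurable M"
    using assms by (auto dest!: square_integrable_measurable)
  have "\<bar>f x \<bullet> g x\<bar> \<le> (norm (f x))\<^sup>2 + (norm (g x))\<^sup>2" for x
    using Cauchy_Schwarz_ineq2[of "f x" "g x"] sum_squares_bound[of "norm (f x)" "norm (g x)"]
      mult_nonneg_nonneg[of "norm (f x)" "norm (g x)"] by (simp del: mult_nonneg_nonneg)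
  then show "AE x in M. norm (f x \<bullet> g x) \<le> norm ((norm (f x))\<^sup>2 + (norm (g x))\<^sup>2)"
    by simp
qed

lemma integrable_mult_square_integrable:
  fixes f g :: "'a \<Rightarrow> real"
  assumes "square_integrable M f" "square_integrable M g"
  shows "integrable M (\<lambda>x. f x * g x)"
  using integrable_inner_square_integrable[OF assms] by simp

lemma integrable_scaleR_square_integrable:
  fixes f :: "'a \<Rightarrow> real" and g :: "'a \<Rightarrow> 'b::euclidean_space"
  assumes "square_integrable M f" "square_integrable M g"
  shows "integrable M (\<lambda>x. f x *\<^sub>R g x)"
proof (rule Bochner_Integration.integrable_bound)
  show "integrable M (\<lambda>x. \<bar>f x\<bar> * norm (g x))"
    using assms by (intro integrable_mult_square_integrable) (auto simp: square_integrable_def)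
  show "(\<lambda>x. f x *\<^sub>R g x) \<in> borel_measurable M"
    using assms by (auto dest!: square_integrable_measurable)
qed auto

lemma L2_Cauchy_Schwarz:
  assumes f: "square_integrable M f" and g: "square_integrable M g"
  shows "\<bar>\<integral>x. f x \<bullet> g x \<partial>M\<bar> \<le> L2_norm M f * L2_norm M g"
proof -
  let ?F = "\<lambda>x. norm (f x)" and ?G = "\<lambda>x. norm (g x)"
  have [measurable]: "?F \<in> borel_measurable M" "?G \<in> borel_measurable M"
    using f g by (auto dest!: square_integrable_measurable)
  have product_integrable: "integrable M (\<lambda>x. ?F x * ?G x)"
    using f g by (intro integrable_mult_square_integrable) (auto simp: square_integrable_def)
  have "ennreal ((\<integral>x. ?F x * ?G x \<partial>M)\<^sup>2) \<le> ennreal ((L2_norm M f * L2_norm M g)\<^sup>2)"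
    using norm_integral_scaleR_power2_le[of ?F M ?G]
    by (simp add: power_mult_distrib ennreal_mult flip: ennreal_L2_norm_power2[OF f] ennreal_L2_norm_power2[OF g])
  then have "(\<integral>x. ?F x * ?G x \<partial>M)\<^sup>2 \<le> (L2_norm M f * L2_norm M g)\<^sup>2"
    by simp
  then have norm_product_le: "(\<integral>x. ?F x * ?G x \<partial>M) \<le> L2_norm M f * L2_norm M g"
    by (rule power2_le_imp_le) simp
  have "\<bar>\<integral>x. f x \<bullet> g x \<partial>M\<bar> \<le> (\<integral>x. \<bar>f x \<bullet> g x\<bar> \<partial>M)"
    by (rule integral_abs_bound)
  also have "\<dots> \<le> (\<integral>x. ?F x * ?G x \<partial>M)"
    using integrable_inner_square_integrable[OF f g] product_integrable by (intro integral_mono Cauchy_Schwarz_ineq2) auto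
  finally show ?thesis using norm_product_le by simp
qed

lemma square_integrable_add:
  assumes "square_integrable M f" "square_integrable M g"
  shows "square_integrable M (\<lambda>x. f x + g x)"
proof (rule square_integrable_bound)
  show "integrable M (\<lambda>x. (norm (f x))\<^sup>2 + 2 * (f x \<bullet> g x) + (norm (g x))\<^sup>2)"
    using assms[THEN square_integrableD] integrable_inner_square_integrable[OF assms] by simp
  show "(\<lambda>x. f x + g x) \<in> borel_measurable M"
    using assms by (auto dest!: square_integrable_measurable)
qed (simp add: power2_norm_eq_inner algebra_simps inner_commute)

lemma square_integrable_scaleR_bounded:
  assumes "square_integrable M f" "b \<in> borel_measurable M" "\<And>x. \<bar>b x\<bar> \<le> C"
  shows "square_integrable M (\<lambda>x. b x *\<^sub>R f x)"
proof (rule square_integrable_bound)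
  show "integrable M (\<lambda>x. C\<^sup>2 * (norm (f x))\<^sup>2)"
    using assms(1) by (auto dest: square_integrableD)
  show "(\<lambda>x. b x *\<^sub>R f x) \<in> borel_measurable M"
    using assms(1,2) by (auto dest!: square_integrable_measurable)
  show "(norm (b x *\<^sub>R f x))\<^sup>2 \<le> C\<^sup>2 * (norm (f x))\<^sup>2" for x
    using power_mono[OF assms(3)[of x], of 2] by (auto simp: power_mult_distrib intro!: mult_right_mono)
qed

lemma square_integrable_cmult: "square_integrable M f \<Longrightarrow> square_integrable M (\<lambda>x. c *\<^sub>R f x)"
  by (rule square_integrable_scaleR_bounded[of _ _ _ "\<bar>c\<bar>"]) auto

lemma square_integrable_bounded_linear:
  assumes "bounded_linear L" and f: "square_integrable M f"
  shows "square_integrable M (\<lambda>x. L (f x))"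
proof -
  interpret L: bounded_linear L by fact
  from L.bounded obtain K where "\<forall>x. norm (L x) \<le> norm x * K" ..
  then have K: "norm (L x) \<le> norm x * K" for x ..
  show ?thesis
  proof (rule square_integrable_bound)
    show "(\<lambda>x. L (f x)) \<in> borel_measurable M"
      by (rule borel_measurable_continuous_on[OF L.continuous_on[OF continuous_on_id] square_integrable_measurable[OF f]])
    show "integrable M (\<lambda>x. (norm (f x))\<^sup>2 * K\<^sup>2)"
      using square_integrableD[OF f] by simp
    show "(norm (L (f x)))\<^sup>2 \<le> (norm (f x))\<^sup>2 * K\<^sup>2" for x
      using power_mono[OF K norm_ge_zero, of "f x" 2] by (simp add: power_mult_distrib)
  qed
qed

lemma square_integrable_norm: "square_integrable M f \<Longrightarrow> square_integrable M (\<lambda>x. norm (f x))"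
  by (auto simp: square_integrable_def)

lemma square_integrable_uminus: "square_integrable M f \<Longrightarrow> square_integrable M (\<lambda>x. - f x)"
  using square_integrable_cmult[of M f "-1"] by simp

lemma square_integrable_diff:
  assumes "square_integrable M f" "square_integrable M g"
  shows "square_integrable M (\<lambda>x. f x - g x)"
  using square_integrable_add[OF assms(1) square_integrable_uminus[OF assms(2)]] by simp

lemma square_integrable_indicator:
  assumes "A \<in> sets M" "emeasure M A < \<infinity>"
  shows "square_integrable M (indicat_real A)"
  by (rule square_integrable_bound[of _ _ "indicator A"])
     (use assms in \<open>auto simp: indicator_def intro!: integrable_real_indicator\<close>)

lemma L2_norm_indicator:
  assumes "A \<in> sets M" "emeasure M A < \<infinity>"
  shows "L2_norm M (indicat_real A) = sqrt (measure M A)"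
proof -
  have "(\<integral>x. (norm (indicat_real A x))\<^sup>2 \<partial>M) = (\<integral>x. indicat_real A x \<partial>M)"
    by (intro Bochner_Integration.integral_cong) (auto simp: indicator_def)
  then show ?thesis using assms by (simp add: L2_norm_def less_top[symmetric])
qed

lemma
  assumes f: "f \<in> borel_measurable M" and A: "A \<in> sets M" "emeasure M A < \<infinity>"
    and "0 \<le> C" and le: "\<And>x. norm (f x) \<le> C * indicator A x"
  shows square_integrable_le_indicator: "square_integrable M f"
    and L2_norm_le_indicator: "L2_norm M f \<le> C * sqrt (measure M A)"
proof -
  have "ennreal ((norm (f x))\<^sup>2) \<le> ennreal (C\<^sup>2) * indicator A x" for x
    using power_mono[OF le[of x], of 2] by (auto simp: indicator_def ennreal_leI)
  then have "(\<integral>\<^sup>+x. ennreal ((norm (f x))\<^sup>2) \<partial>M) \<le> (\<integral>\<^sup>+x. ennreal (C\<^sup>2) * indicator A x \<partial>M)"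
    by (intro nn_integral_mono) auto
  also have "\<dots> = ennreal ((C * sqrt (measure M A))\<^sup>2)"
    using A by (simp add: nn_integral_cmult_indicator emeasure_eq_ennreal_measure ennreal_mult power_mult_distrib)
  finally have nn_integral_le: "(\<integral>\<^sup>+x. ennreal ((norm (f x))\<^sup>2) \<partial>M) \<le> ennreal ((C * sqrt (measure M A))\<^sup>2)" .
  show "square_integrable M f" "L2_norm M f \<le> C * sqrt (measure M A)"
    using square_integrable_L2_norm_le[OF f _ nn_integral_le] \<open>0 \<le> C\<close> by auto
qed

lemma set_integrable_square_integrable:
  fixes f :: "'a \<Rightarrow> real"
  assumes "square_integrable M f" "A \<in> sets M" "emeasure M A < \<infinity>"
  shows "set_integrable M A f"
  using integrable_mult_square_integrable[OF square_integrable_indicator[OF assms(2,3)] assms(1)]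
  by (simp add: set_integrable_def)

lemma abs_set_integral_le_L2_norm:
  fixes f :: "'a \<Rightarrow> real"
  assumes "square_integrable M f" "A \<in> sets M" "emeasure M A < \<infinity>"
  shows "\<bar>LINT x:A|M. f x\<bar> \<le> sqrt (measure M A) * L2_norm M f"
  using L2_Cauchy_Schwarz[OF square_integrable_indicator[OF assms(2,3)] assms(1)]
  by (simp add: set_lebesgue_integral_def L2_norm_indicator[OF assms(2,3)])

lemma L2_norm_cmult: "L2_norm M (\<lambda>x. c *\<^sub>R f x) = \<bar>c\<bar> * L2_norm M f"
  by (simp add: L2_norm_def power_mult_distrib real_sqrt_mult)

lemma L2_norm_uminus: "L2_norm M (\<lambda>x. - f x) = L2_norm M f"
  by (simp add: L2_norm_def)

lemma L2_norm_minus_commute: "L2_norm M (\<lambda>x. f x - g x) = L2_norm M (\<lambda>x. g x - f x)"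
  by (simp add: L2_norm_def norm_minus_commute)

lemma L2_norm_triangle_ineq:
  assumes f: "square_integrable M f" and g: "square_integrable M g"
  shows "L2_norm M (\<lambda>x. f x + g x) \<le> L2_norm M f + L2_norm M g"
proof (rule power2_le_imp_le)
  have "(L2_norm M (\<lambda>x. f x + g x))\<^sup>2 = (\<integral>x. (norm (f x))\<^sup>2 + 2 * (f x \<bullet> g x) + (norm (g x))\<^sup>2 \<partial>M)"
    unfolding L2_norm_power2
    by (intro Bochner_Integration.integral_cong) (auto simp: power2_norm_eq_inner algebra_simps inner_commute)
  also have "\<dots> = (L2_norm M f)\<^sup>2 + 2 * (\<integral>x. f x \<bullet> g x \<partial>M) + (L2_norm M g)\<^sup>2"
    using f g by (simp add: L2_norm_power2 square_integrableD integrable_inner_square_integrable)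
  also have "\<dots> \<le> (L2_norm M f)\<^sup>2 + 2 * (L2_norm M f * L2_norm M g) + (L2_norm M g)\<^sup>2"
    using L2_Cauchy_Schwarz[OF f g] by auto
  finally show "(L2_norm M (\<lambda>x. f x + g x))\<^sup>2 \<le> (L2_norm M f + L2_norm M g)\<^sup>2"
    by (simp add: power2_sum)
qed simp

lemma L2_norm_diff_triangle_ineq:
  assumes "square_integrable M f" "square_integrable M g" "square_integrable M h"
  shows "L2_norm M (\<lambda>x. f x - h x) \<le> L2_norm M (\<lambda>x. f x - g x) + L2_norm M (\<lambda>x. g x - h x)"
  using L2_norm_triangle_ineq[OF square_integrable_diff[OF assms(1,2)] square_integrable_diff[OF assms(2,3)]]
  by simp

lemma L2_norm_tendsto_0_dominated:
  assumes f: "\<And>n. f n \<in> borel_measurable M" and g: "square_integrable M g"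
    and le: "\<And>n x. norm (f n x) \<le> norm (g x)" and lim: "AE x in M. (\<lambda>n. f n x) \<longlonglongrightarrow> 0"
  shows "(\<lambda>n. L2_norm M (f n)) \<longlonglongrightarrow> 0"
proof -
  have "(\<lambda>n. \<integral>x. (norm (f n x))\<^sup>2 \<partial>M) \<longlonglongrightarrow> (\<integral>x. 0 \<partial>M)"
  proof (rule integral_dominated_convergence[OF _ _ square_integrableD[OF g]])
    show "AE x in M. (\<lambda>n. (norm (f n x))\<^sup>2) \<longlonglongrightarrow> 0"
      using lim by eventually_elim (auto intro!: tendsto_eq_intros)
    show "AE x in M. norm ((norm (f n x))\<^sup>2) \<le> (norm (g x))\<^sup>2" for n
      by (auto intro!: AE_I2 power_mono le)
  qed (use f in auto)
  then show ?thesis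
    unfolding L2_norm_def using tendsto_real_sqrt by fastforce
qed

lemma integrable_bounded_support:
  fixes f :: "'a::euclidean_space \<Rightarrow> 'b::{banach, second_countable_topology}"
  assumes "f \<in> borel_measurable borel" "\<And>x. norm (f x) \<le> C" "bounded S" "\<And>x. x \<notin> S \<Longrightarrow> f x = 0"
  shows "integrable lborel f"
proof (rule integrableI_bounded_set)
  show "emeasure lborel (closure S) < \<infinity>"
    using assms(3) by (intro emeasure_bounded_finite bounded_closure)
  show "AE x in lborel. x \<notin> closure S \<longrightarrow> f x = 0"
    using assms(4) closure_subset by blast
qed (use assms in auto)

lemma square_integrable_bounded_support:
  fixes f :: "'a::euclidean_space \<Rightarrow> 'b::euclidean_space"
  assumes f: "f \<in> borel_measurable borel" "\<And>x. norm (f x) \<le> C" and S: "bounded S" "\<And>x. x \<notin> S \<Longrightarrow> f x = 0"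
  shows "square_integrable lborel f"
  unfolding square_integrable_def
proof
  show "integrable lborel (\<lambda>x. (norm (f x))\<^sup>2)"
    by (rule integrable_bounded_support[of _ "C\<^sup>2" S]) (use assms in \<open>auto intro!: power_mono\<close>)
qed (use f in simp)

lemma square_integrable_imp_integrable:
  fixes f :: "'a::euclidean_space \<Rightarrow> real"
  assumes f: "square_integrable lborel f" and S: "bounded S" "\<And>x. x \<notin> S \<Longrightarrow> f x = 0"
  shows "integrable lborel f"
proof -
  have "set_integrable lborel (closure S) f"
    using S(1) by (intro set_integrable_square_integrable f emeasure_bounded_finite bounded_closure) auto
  moreover have "(\<lambda>x. indicat_real (closure S) x *\<^sub>R f x) = f"
    using S(2) closure_subset[of S] by (auto simp: indicator_def fun_eq_iff)
  ultimately show ?thesis by (simp only: set_integrable_def)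
qed

section \<open>Translations and convolutions in the space of square integrable functions\<close>

lemma nn_integral_affine:
  fixes f :: "'a::euclidean_space \<Rightarrow> ennreal"
  assumes [measurable]: "f \<in> borel_measurable borel" and c: "c \<noteq> 0"
  shows "(\<integral>\<^sup>+x. f x \<partial>lborel) = ennreal (\<bar>c\<bar> ^ DIM('a)) * (\<integral>\<^sup>+x. f (t + c *\<^sub>R x) \<partial>lborel)"
  by (subst lborel_affine[OF c, of t])
     (simp add: nn_integral_density nn_integral_distr nn_integral_cmult)

lemma integrable_affine:
  fixes f :: "'a::euclidean_space \<Rightarrow> 'b::{banach, second_countable_topology}"
  assumes f: "integrable lborel f" and c: "c \<noteq> 0"
  shows "integrable lborel (\<lambda>x. f (t + c *\<^sub>R x))"
proof -
  have [measurable]: "f \<in> borel_measurable borel"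
    using borel_measurable_integrable[OF f] by simp
  have "(\<integral>\<^sup>+x. norm (f x) \<partial>lborel) < \<infinity>"
    using f by (simp add: integrable_iff_bounded)
  then have "ennreal (\<bar>c\<bar> ^ DIM('a)) * (\<integral>\<^sup>+x. norm (f (t + c *\<^sub>R x)) \<partial>lborel) < \<infinity>"
    by (subst (asm) nn_integral_affine[OF _ c, of _ t]) auto
  then show ?thesis
    using c by (auto simp: integrable_iff_bounded ennreal_mult_less_top)
qed

lemma integral_affine:
  fixes f :: "'a::euclidean_space \<Rightarrow> 'b::{banach, second_countable_topology}"
  assumes [measurable]: "f \<in> borel_measurable borel" and c: "c \<noteq> 0"
  shows "(LBINT x. f x) = (\<bar>c\<bar> ^ DIM('a)) *\<^sub>R (LBINT x. f (t + c *\<^sub>R x))"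
  by (subst lborel_affine[OF c, of t])
     (simp add: integral_density integral_distr)

lemma integrable_translate:
  fixes f :: "'a::euclidean_space \<Rightarrow> 'b::{banach, second_countable_topology}"
  assumes "integrable lborel f"
  shows "integrable lborel (\<lambda>x. f (x - y))" "integrable lborel (\<lambda>x. f (x + y))"
    "integrable lborel (\<lambda>x. f (y - x))"
  using integrable_affine[OF assms, of 1 "-y"] integrable_affine[OF assms, of 1 "y"]
    integrable_affine[OF assms, of "-1" "y"]
  by (simp_all add: algebra_simps)

lemma integral_translate:
  fixes f :: "'a::euclidean_space \<Rightarrow> 'b::{banach, second_countable_topology}"
  assumes "f \<in> borel_measurable borel"
  shows "(LBINT x. f (x - y)) = (LBINT x. f x)" "(LBINT x. f (x + y)) = (LBINT x. f x)"
    "(LBINT x. f (y - x)) = (LBINT x. f x)"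
  using integral_affine[OF assms, of 1 "-y"] integral_affine[OF assms, of 1 "y"]
    integral_affine[OF assms, of "-1" "y"]
  by (simp_all add: algebra_simps)

lemma square_integrable_translate:
  fixes f :: "'a::euclidean_space \<Rightarrow> 'b::euclidean_space"
  assumes "square_integrable lborel f"
  shows "square_integrable lborel (\<lambda>x. f (x - y))" "square_integrable lborel (\<lambda>x. f (y - x))"
  using assms integrable_translate[of "\<lambda>x. (norm (f x))\<^sup>2" y]
  by (auto simp: square_integrable_def)

lemma L2_norm_translate:
  fixes f :: "'a::euclidean_space \<Rightarrow> 'b::euclidean_space"
  assumes "square_integrable lborel f"
  shows "L2_norm lborel (\<lambda>x. f (x - y)) = L2_norm lborel f"
  unfolding L2_norm_def
  using assms by (subst integral_translate(1)[of "\<lambda>x. (norm (f x))\<^sup>2"]) (auto dest!: square_integrable_measurable)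

definition L2_modulus :: "('a::euclidean_space \<Rightarrow> 'b::euclidean_space) \<Rightarrow> 'a \<Rightarrow> real" where
  "L2_modulus f y = L2_norm lborel (\<lambda>x. f (x - y) - f x)"

lemma L2_modulus_0 [simp]: "L2_modulus f 0 = 0"
  by (simp add: L2_modulus_def L2_norm_def)

lemma L2_modulus_nonneg [simp]: "0 \<le> L2_modulus f y"
  by (simp add: L2_modulus_def)

lemma L2_modulus_le:
  assumes f: "square_integrable lborel f"
  shows "L2_modulus f y \<le> 2 * L2_norm lborel f"
  using L2_norm_triangle_ineq[OF square_integrable_translate(1)[OF f] square_integrable_uminus[OF f], of y]
  by (simp add: L2_modulus_def L2_norm_uminus L2_norm_translate[OF f])

lemma L2_modulus_measurable:
  assumes f: "square_integrable lborel f"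
  shows "L2_modulus f \<in> borel_measurable borel"
proof -
  have [measurable]: "f \<in> borel_measurable borel" using f by (auto dest: square_integrable_measurable)
  have "(\<lambda>y. LBINT x. (\<lambda>(y,x). (norm (f (x - y) - f x))\<^sup>2) (y, x)) \<in> borel_measurable borel"
    by simp
  then show ?thesis
    unfolding L2_modulus_def[abs_def] L2_norm_def by simp
qed

lemma L2_modulus_le_approx:
  assumes f: "square_integrable lborel f" and g: "square_integrable lborel g"
  shows "L2_modulus f y \<le> 2 * L2_norm lborel (\<lambda>x. f x - g x) + L2_modulus g y"
proof -
  let ?d = "\<lambda>x. f x - g x"
  have d: "square_integrable lborel ?d" by (rule square_integrable_diff[OF f g])
  have "L2_modulus f y = L2_norm lborel (\<lambda>x. (?d (x - y) - ?d x) + (g (x - y) - g x))"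
    by (simp add: L2_modulus_def)
  also have "\<dots> \<le> L2_modulus ?d y + L2_modulus g y"
    unfolding L2_modulus_def
    by (intro L2_norm_triangle_ineq square_integrable_diff[OF square_integrable_translate(1)] d g)
  finally show ?thesis using L2_modulus_le[OF d, of y] by simp
qed

lemma square_integrable_approx_bounded:
  fixes f :: "'a::euclidean_space \<Rightarrow> 'b::euclidean_space"
  assumes f: "square_integrable lborel f" and e: "e > 0"
  obtains g C where "g \<in> borel_measurable borel" "\<And>x. norm (g x) \<le> C" "\<And>x. norm x > C \<Longrightarrow> g x = 0"
    "L2_norm lborel (\<lambda>x. f x - g x) < e"
proof -
  have [measurable]: "f \<in> borel_measurable borel" using f by (auto dest: square_integrable_measurable)
  define g where "g n x = (if norm x \<le> real n \<and> norm (f x) \<le> real n then f x else 0)" for n x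
  have [measurable]: "g n \<in> borel_measurable borel" for n
    unfolding g_def[abs_def] by measurable
  have "(\<lambda>n. L2_norm lborel (\<lambda>x. f x - g n x)) \<longlonglongrightarrow> 0"
  proof (rule L2_norm_tendsto_0_dominated[OF _ f])
    show "AE x in lborel. (\<lambda>n. f x - g n x) \<longlonglongrightarrow> 0"
    proof (rule AE_I2, rule tendsto_eventually)
      fix x
      obtain N where N: "norm x \<le> real N" "norm (f x) \<le> real N"
        using real_arch_simple[of "max (norm x) (norm (f x))"] by auto
      show "\<forall>\<^sub>F n in sequentially. f x - g n x = 0"
        using eventually_ge_at_top[of N] by eventually_elim (use N in \<open>auto simp: g_def\<close>)
    qed
  qed (auto simp: g_def)
  then have "\<forall>\<^sub>F n in sequentially. L2_norm lborel (\<lambda>x. f x - g n x) < e"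
    using e by (rule order_tendstoD(2))
  then obtain n where "L2_norm lborel (\<lambda>x. f x - g n x) < e"
    by (auto simp: eventually_sequentially)
  then show ?thesis
    by (intro that[of "g n" "real n"]) (auto simp: g_def)
qed

lemma bounded_support_AE_limit_continuous:
  fixes f :: "'a::euclidean_space \<Rightarrow> 'b::euclidean_space"
  assumes f: "f \<in> borel_measurable borel" "\<And>x. norm (f x) \<le> C" "\<And>x. norm x > C \<Longrightarrow> f x = 0"
  shows "\<exists>g :: nat \<Rightarrow> 'a \<Rightarrow> 'b. (\<forall>n. continuous_on UNIV (g n)) \<and> (\<forall>n x. norm (g n x) \<le> C) \<and>
    (\<forall>n x. x \<notin> cball 0 (C + 1) \<longrightarrow> g n x = 0) \<and> (AE x in lborel. (\<lambda>n. g n x) \<longlonglongrightarrow> f x)"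
proof -
  have C: "0 \<le> C" using f(2)[of 0] norm_ge_zero order_trans by blast
  have "f \<in> borel_measurable lebesgue" using f(1) by (intro measurable_completion) simp
  then obtain N h where N: "negligible N" and h: "\<And>n. continuous_on UNIV (h n)"
    and lim: "\<And>x. x \<notin> N \<Longrightarrow> (\<lambda>n. h n x) \<longlonglongrightarrow> f x"
    using lebesgue_measurable_imp_measurable_on[of f UNIV] by (auto simp: measurable_on_def)
  define P where "P = closest_point (cball (0::'b) C)"
  have P: "continuous_on UNIV P" "P y \<in> cball 0 C" for y
    unfolding P_def using C closest_point_in_set[of "cball 0 C" y] by (auto intro!: continuous_on_closest_point)
  have "cball (0::'a) C \<inter> - ball 0 (C + 1) = {}" by auto
  then obtain plateau :: "'a \<Rightarrow> real" where plateau: "continuous_on UNIV plateau" "\<And>x. plateau x \<in> closed_segment 1 0"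
    "\<And>x. x \<in> cball 0 C \<Longrightarrow> plateau x = 1" "\<And>x. x \<in> - ball 0 (C + 1) \<Longrightarrow> plateau x = 0"
    by (rule Urysohn[rotated 2]) auto
  have plateau_bounds: "0 \<le> plateau x" "plateau x \<le> 1" for x
    using plateau(2)[of x] by (auto simp: closed_segment_eq_real_ivl)
  show ?thesis
  proof (intro exI[of _ "\<lambda>n x. plateau x *\<^sub>R P (h n x)"] conjI allI impI)
    show "continuous_on UNIV (\<lambda>x. plateau x *\<^sub>R P (h n x))" for n
      by (intro continuous_intros plateau(1) continuous_on_compose2[OF P(1) h]) auto
    show "norm (plateau x *\<^sub>R P (h n x)) \<le> C" for n x
      using mult_mono[OF plateau_bounds(2)[of x], of "norm (P (h n x))" C] plateau_bounds(1)[of x] P(2)[of "h n x"] by simp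
    show "plateau x *\<^sub>R P (h n x) = 0" if "x \<notin> cball 0 (C + 1)" for n x
      using plateau(4)[of x] that by simp
    have "AE x in lebesgue. x \<notin> N" using N by (simp add: negligible_iff_null_sets AE_not_in)
    then have "AE x in lebesgue. (\<lambda>n. plateau x *\<^sub>R P (h n x)) \<longlonglongrightarrow> f x"
    proof eventually_elim
      case (elim x)
      have "isCont P (f x)" using P(1) by (simp add: continuous_on_eq_continuous_at)
      then have "(\<lambda>n. plateau x *\<^sub>R P (h n x)) \<longlonglongrightarrow> plateau x *\<^sub>R P (f x)"
        using lim[OF elim] by (intro tendsto_intros isCont_tendsto_compose[of _ P])
      moreover have "P (f x) = f x" unfolding P_def using f(2) by (intro closest_point_self) auto
      ultimately show ?case using f(3)[of x] plateau(3)[of x] by (cases "norm x \<le> C") auto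
    qed
    then show "AE x in lborel. (\<lambda>n. plateau x *\<^sub>R P (h n x)) \<longlonglongrightarrow> f x"
      by (simp add: AE_completion_iff)
  qed
qed

lemma square_integrable_bounded_approx_continuous:
  fixes f :: "'a::euclidean_space \<Rightarrow> 'b::euclidean_space"
  assumes f: "f \<in> borel_measurable borel" "\<And>x. norm (f x) \<le> C" "\<And>x. norm x > C \<Longrightarrow> f x = 0" and e: "e > 0"
  obtains g where "continuous_on UNIV g" "\<And>x. x \<notin> cball 0 (C + 1) \<Longrightarrow> g x = 0"
    "square_integrable lborel g" "L2_norm lborel (\<lambda>x. f x - g x) < e"
proof -
  note [measurable] = f(1)
  have C: "0 \<le> C" using f(2)[of 0] norm_ge_zero order_trans by blast
  obtain g where g: "\<And>n. continuous_on UNIV (g n)" "\<And>n x. norm (g n x) \<le> C" "\<And>n x. x \<notin> cball 0 (C + 1) \<Longrightarrow> g n x = 0"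
    and lim: "AE x in lborel. (\<lambda>n. g n x) \<longlonglongrightarrow> f x"
    using bounded_support_AE_limit_continuous[OF f] by blast
  have [measurable]: "g n \<in> borel_measurable borel" for n
    using g(1) by (rule borel_measurable_continuous_onI)
  have sq: "square_integrable lborel (g n)" for n
    using g(2,3) by (intro square_integrable_bounded_support[of _ C "cball 0 (C + 1)"]) auto
  have "(\<lambda>n. L2_norm lborel (\<lambda>x. f x - g n x)) \<longlonglongrightarrow> 0"
  proof (rule L2_norm_tendsto_0_dominated)
    show "square_integrable lborel (\<lambda>x. (2 * C) * indicat_real (cball (0::'a) (C + 1)) x)"
      using square_integrable_cmult[OF square_integrable_indicator[OF _ emeasure_lborel_cball_finite], of 0 "C + 1" "2 * C"]
      by simp
    show "norm (f x - g n x) \<le> norm ((2 * C) * indicat_real (cball 0 (C + 1)) x)" for n x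
      using norm_triangle_ineq4[of "f x" "g n x"] f(2)[of x] g(2)[of n x] f(3)[of x] g(3)[of x n] C
      by (auto simp: indicator_def abs_mult)
    show "AE x in lborel. (\<lambda>n. f x - g n x) \<longlonglongrightarrow> 0"
      using lim by eventually_elim (auto intro!: tendsto_eq_intros)
  qed measurable
  then have "\<forall>\<^sub>F n in sequentially. L2_norm lborel (\<lambda>x. f x - g n x) < e"
    using e by (rule order_tendstoD(2))
  then obtain n where "L2_norm lborel (\<lambda>x. f x - g n x) < e"
    by (auto simp: eventually_sequentially)
  then show ?thesis using g(1,3) sq by (intro that)
qed

lemma L2_modulus_tendsto_0_continuous:
  fixes g :: "'a::euclidean_space \<Rightarrow> 'b::euclidean_space"
  assumes g: "continuous_on UNIV g" and supp: "\<And>x. x \<notin> cball 0 R \<Longrightarrow> g x = 0"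
  shows "(L2_modulus g \<longlongrightarrow> 0) (at 0)"
proof (rule tendstoI)
  fix e :: real assume e: "e > 0"
  have [measurable]: "g \<in> borel_measurable borel" using g by (rule borel_measurable_continuous_onI)
  define K where "K = cball (0::'a) (R + 1)"
  have K: "K \<in> sets lborel" "emeasure lborel K < \<infinity>"
    unfolding K_def by (simp, rule emeasure_lborel_cball_finite)
  define \<epsilon> where "\<epsilon> = e / (2 * (sqrt (measure lborel K) + 1))"
  have \<epsilon>: "\<epsilon> > 0" using e by (simp add: \<epsilon>_def add_nonneg_pos)
  have "uniformly_continuous_on (cball 0 (R + 2)) g"
    using g by (intro compact_uniformly_continuous) (auto elim: continuous_on_subset)
  then obtain d where d: "d > 0"
    and uniform: "\<And>x y. x \<in> cball 0 (R + 2) \<Longrightarrow> y \<in> cball 0 (R + 2) \<Longrightarrow> dist y x < d \<Longrightarrow> dist (g y) (g x) < \<epsilon>"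
    unfolding uniformly_continuous_on_def using \<epsilon> by metis
  have "L2_modulus g y < e" if y: "norm y < min d 1" for y
  proof -
    have difference_le: "norm (g (x - y) - g x) \<le> \<epsilon> * indicat_real K x" for x
    proof (cases "x \<in> K")
      case True
      then have "dist (g (x - y)) (g x) < \<epsilon>"
        using y norm_triangle_ineq4[of x y] by (intro uniform) (auto simp: K_def dist_norm norm_minus_commute)
      then show ?thesis using True by (simp add: dist_norm)
    next
      case False
      then have "g x = 0" "g (x - y) = 0"
        using y norm_triangle_ineq2[of x y] by (auto intro!: supp simp: K_def)
      then show ?thesis using \<epsilon> by simp
    qed
    have "L2_modulus g y \<le> \<epsilon> * sqrt (measure lborel K)"
      unfolding L2_modulus_def using \<epsilon> by (intro L2_norm_le_indicator K difference_le) auto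
    also have "\<dots> \<le> \<epsilon> * (sqrt (measure lborel K) + 1)"
      using \<epsilon> by (intro mult_left_mono) auto
    also have "\<dots> = e / 2"
      using add_nonneg_pos[of "sqrt (measure lborel K)" 1] by (simp add: \<epsilon>_def field_simps)
    finally show ?thesis using e by simp
  qed
  then show "\<forall>\<^sub>F y in at 0. dist (L2_modulus g y) 0 < e"
    using d by (auto simp: eventually_at intro!: exI[of _ "min d 1"])
qed

lemma L2_modulus_tendsto_0:
  fixes f :: "'a::euclidean_space \<Rightarrow> 'b::euclidean_space"
  assumes f: "square_integrable lborel f"
  shows "(L2_modulus f \<longlongrightarrow> 0) (at 0)"
proof (rule tendstoI)
  fix e :: real assume "e > 0"
  then have eighth: "e / 8 > 0" by simp
  obtain h C where h: "h \<in> borel_measurable borel" "\<And>x. norm (h x) \<le> C" "\<And>x. norm x > C \<Longrightarrow> h x = 0"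
    and f_near_h: "L2_norm lborel (\<lambda>x. f x - h x) < e / 8"
    by (rule square_integrable_approx_bounded[OF f eighth]) blast
  obtain g where g: "continuous_on UNIV g" "\<And>x. x \<notin> cball 0 (C + 1) \<Longrightarrow> g x = 0" "square_integrable lborel g"
    and h_near_g: "L2_norm lborel (\<lambda>x. h x - g x) < e / 8"
    by (rule square_integrable_bounded_approx_continuous[OF h(1,2) _ eighth]) (use h(3) that in blast)+
  have "square_integrable lborel h"
    using h by (intro square_integrable_bounded_support[of _ C "cball 0 C"]) auto
  from L2_norm_diff_triangle_ineq[OF f this g(3)] f_near_h h_near_g
  have f_near_g: "L2_norm lborel (\<lambda>x. f x - g x) < e / 4" by linarith
  have "\<forall>\<^sub>F y in at 0. L2_modulus g y < e / 2"
    using L2_modulus_tendsto_0_continuous[OF g(1,2)] \<open>e > 0\<close> by (intro order_tendstoD(2)) auto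
  then show "\<forall>\<^sub>F y in at 0. dist (L2_modulus f y) 0 < e"
  proof eventually_elim
    case (elim y)
    then show ?case using L2_modulus_le_approx[OF f g(3), of y] f_near_g by simp
  qed
qed

text \<open>Cauchy--Schwarz with weight \<open>k\<close>, followed by Tonelli.\<close>

lemma L2_norm_averaged_difference_le:
  fixes f :: "'a::euclidean_space \<Rightarrow> 'b::euclidean_space" and k :: "'a \<Rightarrow> real"
  assumes f: "square_integrable lborel f" and k: "integrable lborel k" "\<And>y. 0 \<le> k y"
  defines "g x \<equiv> (LBINT y. k y *\<^sub>R (f (x - y) - f x))"
  shows "square_integrable lborel g"
    and "(L2_norm lborel g)\<^sup>2 \<le> (LBINT y. k y) * (LBINT y. k y * (L2_modulus f y)\<^sup>2)"
proof -
  have [measurable]: "f \<in> borel_measurable borel" "k \<in> borel_measurable borel" "L2_modulus f \<in> borel_measurable borel"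
    using f k by (auto dest: square_integrable_measurable borel_measurable_integrable intro: L2_modulus_measurable)
  let ?B = "(LBINT y. k y) * (LBINT y. k y * (L2_modulus f y)\<^sup>2)"
  have B: "0 \<le> ?B" using k by (intro mult_nonneg_nonneg integral_nonneg_AE) auto
  have "(L2_modulus f y)\<^sup>2 \<le> (2 * L2_norm lborel f)\<^sup>2" for y
    by (intro power_mono L2_modulus_le[OF f]) simp
  then have weighted_le: "k y * (L2_modulus f y)\<^sup>2 \<le> k y * (2 * L2_norm lborel f)\<^sup>2" for y
    by (intro mult_left_mono k)
  have weighted_integrable: "integrable lborel (\<lambda>y. k y * (L2_modulus f y)\<^sup>2)"
    by (rule Bochner_Integration.integrable_bound[OF integrable_mult_left[OF k(1), of "(2 * L2_norm lborel f)\<^sup>2"]])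
       (use k(2) weighted_le in \<open>auto intro!: AE_I2 order_trans[OF weighted_le] simp del: power_mult_distrib\<close>)
  have pointwise: "ennreal ((norm (g x))\<^sup>2) \<le> (\<integral>\<^sup>+y. ennreal (k y) \<partial>lborel) *
      (\<integral>\<^sup>+y. ennreal (k y) * ennreal ((norm (f (x - y) - f x))\<^sup>2) \<partial>lborel)" for x
    using norm_integral_scaleR_power2_le[of "\<lambda>y. sqrt (k y)" lborel "\<lambda>y. sqrt (k y) *\<^sub>R (f (x - y) - f x)"]
    by (simp add: g_def k power_mult_distrib ennreal_mult)
  have mass: "(\<integral>\<^sup>+x. ennreal (k y) * ennreal ((norm (f (x - y) - f x))\<^sup>2) \<partial>lborel) = ennreal (k y * (L2_modulus f y)\<^sup>2)" for y
    unfolding L2_modulus_def using f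
    by (subst nn_integral_cmult, measurable)
       (auto simp: ennreal_mult k ennreal_L2_norm_power2 square_integrable_diff square_integrable_translate(1))
  have "(\<integral>\<^sup>+x. ennreal ((norm (g x))\<^sup>2) \<partial>lborel) \<le>
      (\<integral>\<^sup>+x. (\<integral>\<^sup>+y. ennreal (k y) \<partial>lborel) * (\<integral>\<^sup>+y. ennreal (k y) * ennreal ((norm (f (x - y) - f x))\<^sup>2) \<partial>lborel) \<partial>lborel)"
    by (intro nn_integral_mono pointwise)
  also have "\<dots> = (\<integral>\<^sup>+y. ennreal (k y) \<partial>lborel) * (\<integral>\<^sup>+x. \<integral>\<^sup>+y. ennreal (k y) * ennreal ((norm (f (x - y) - f x))\<^sup>2) \<partial>lborel \<partial>lborel)"
    by (rule nn_integral_cmult) measurable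
  also have "(\<integral>\<^sup>+x. \<integral>\<^sup>+y. ennreal (k y) * ennreal ((norm (f (x - y) - f x))\<^sup>2) \<partial>lborel \<partial>lborel)
      = (\<integral>\<^sup>+y. ennreal (k y * (L2_modulus f y)\<^sup>2) \<partial>lborel)"
    by (subst lborel_pair.Fubini'[symmetric]) (measurable, simp add: mass)
  also have "(\<integral>\<^sup>+y. ennreal (k y) \<partial>lborel) * \<dots> = ennreal ((sqrt ?B)\<^sup>2)"
    using k weighted_integrable B by (subst (1 2) nn_integral_eq_integral) (auto simp: ennreal_mult integral_nonneg_AE)
  finally have bound: "(\<integral>\<^sup>+x. ennreal ((norm (g x))\<^sup>2) \<partial>lborel) \<le> ennreal ((sqrt ?B)\<^sup>2)" .
  have g: "g \<in> borel_measurable lborel" unfolding g_def by measurable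
  note L2 = square_integrable_L2_norm_le[OF g real_sqrt_ge_zero[OF B] bound]
  show "square_integrable lborel g" by (rule L2(1))
  show "(L2_norm lborel g)\<^sup>2 \<le> ?B"
    using power_mono[OF L2(2), of 2] B by simp
qed

section \<open>Continuously differentiable functions and test functions\<close>

definition C1_grad :: "('a::euclidean_space \<Rightarrow> real) \<Rightarrow> ('a \<Rightarrow> 'a) \<Rightarrow> bool" where
  "C1_grad \<phi> \<phi>' \<longleftrightarrow> (\<forall>x. (\<phi> has_derivative (\<lambda>h. \<phi>' x \<bullet> h)) (at x)) \<and> continuous_on UNIV \<phi>'"

lemma C1_grad_deriv: "C1_grad \<phi> \<phi>' \<Longrightarrow> (\<phi> has_derivative (\<lambda>h. \<phi>' x \<bullet> h)) (at x)"
  by (simp add: C1_grad_def)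

lemma C1_grad_cont: "C1_grad \<phi> \<phi>' \<Longrightarrow> continuous_on UNIV \<phi>" "C1_grad \<phi> \<phi>' \<Longrightarrow> continuous_on UNIV \<phi>'"
  by (auto simp: C1_grad_def intro!: continuous_at_imp_continuous_on has_derivative_continuous)

lemma C1_grad_measurable:
  "C1_grad \<phi> \<phi>' \<Longrightarrow> \<phi> \<in> borel_measurable borel" "C1_grad \<phi> \<phi>' \<Longrightarrow> \<phi>' \<in> borel_measurable borel"
  by (auto dest: C1_grad_cont intro: borel_measurable_continuous_onI)

lemma C1_grad_real_iff:
  fixes a a' :: "real \<Rightarrow> real"
  shows "C1_grad a a' \<longleftrightarrow> (\<forall>t. (a has_real_derivative a' t) (at t)) \<and> continuous_on UNIV a'"
proof -
  have "(\<lambda>h. a' t \<bullet> h) = (*) (a' t)" for t by auto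
  then show ?thesis by (simp add: C1_grad_def has_field_derivative_def)
qed

lemma C1_grad_const: "C1_grad (\<lambda>x. c) (\<lambda>x. 0)"
  by (simp add: C1_grad_def)

lemma C1_grad_inner: "C1_grad (\<lambda>x. x \<bullet> b) (\<lambda>x. b)"
  unfolding C1_grad_def by (auto intro!: derivative_eq_intros simp: inner_commute)

lemma C1_grad_add:
  assumes "C1_grad \<phi> \<phi>'" "C1_grad \<psi> \<psi>'"
  shows "C1_grad (\<lambda>x. \<phi> x + \<psi> x) (\<lambda>x. \<phi>' x + \<psi>' x)"
  unfolding C1_grad_def
proof (intro conjI allI)
  show "((\<lambda>x. \<phi> x + \<psi> x) has_derivative (\<bullet>) (\<phi>' x + \<psi>' x)) (at x)" for x
    by (rule has_derivative_eq_rhs[OF has_derivative_add[OF assms[THEN C1_grad_deriv]]])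
       (auto simp: inner_add_left)
qed (use assms in \<open>auto simp: C1_grad_def intro!: continuous_intros\<close>)

lemma C1_grad_cmult:
  assumes "C1_grad \<phi> \<phi>'"
  shows "C1_grad (\<lambda>x. c * \<phi> x) (\<lambda>x. c *\<^sub>R \<phi>' x)"
  unfolding C1_grad_def
proof (intro conjI allI)
  show "((\<lambda>x. c * \<phi> x) has_derivative (\<bullet>) (c *\<^sub>R \<phi>' x)) (at x)" for x
    by (rule has_derivative_eq_rhs[OF has_derivative_mult_right[OF C1_grad_deriv[OF assms]]]) auto
qed (use assms in \<open>auto simp: C1_grad_def intro!: continuous_intros\<close>)

lemma C1_grad_diff:
  assumes "C1_grad \<phi> \<phi>'" "C1_grad \<psi> \<psi>'"
  shows "C1_grad (\<lambda>x. \<phi> x - \<psi> x) (\<lambda>x. \<phi>' x - \<psi>' x)"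
  using C1_grad_add[OF assms(1) C1_grad_cmult[OF assms(2), of "-1"]] by simp

lemma C1_grad_sum:
  "(\<And>i. i \<in> I \<Longrightarrow> C1_grad (\<phi> i) (\<phi>' i)) \<Longrightarrow> C1_grad (\<lambda>x. \<Sum>i\<in>I. \<phi> i x) (\<lambda>x. \<Sum>i\<in>I. \<phi>' i x)"
  by (induction I rule: infinite_finite_induct) (auto intro: C1_grad_add C1_grad_const)

lemma C1_grad_mult:
  assumes "C1_grad \<phi> \<phi>'" "C1_grad \<psi> \<psi>'"
  shows "C1_grad (\<lambda>x. \<phi> x * \<psi> x) (\<lambda>x. \<phi> x *\<^sub>R \<psi>' x + \<psi> x *\<^sub>R \<phi>' x)"
  unfolding C1_grad_def
proof (intro conjI allI)
  show "((\<lambda>x. \<phi> x * \<psi> x) has_derivative (\<bullet>) (\<phi> x *\<^sub>R \<psi>' x + \<psi> x *\<^sub>R \<phi>' x)) (at x)" for x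
    by (rule has_derivative_eq_rhs[OF has_derivative_mult[OF assms[THEN C1_grad_deriv]]])
       (auto simp: inner_add_left algebra_simps)
  show "continuous_on UNIV (\<lambda>x. \<phi> x *\<^sub>R \<psi>' x + \<psi> x *\<^sub>R \<phi>' x)"
    using assms by (auto intro!: continuous_intros dest: C1_grad_cont)
qed

lemma C1_grad_compose:
  assumes g: "\<And>x. (g has_real_derivative g' (\<phi> x)) (at (\<phi> x))" "continuous_on (range \<phi>) g'"
    and \<phi>: "C1_grad \<phi> \<phi>'"
  shows "C1_grad (\<lambda>x. g (\<phi> x)) (\<lambda>x. g' (\<phi> x) *\<^sub>R \<phi>' x)"
  unfolding C1_grad_def
proof (intro conjI allI)
  fix x
  have "(g has_derivative (*) (g' (\<phi> x))) (at (\<phi> x))"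
    using g(1) by (simp add: has_field_derivative_def)
  from has_derivative_compose[OF C1_grad_deriv[OF \<phi>] this]
  show "((\<lambda>x. g (\<phi> x)) has_derivative (\<bullet>) (g' (\<phi> x) *\<^sub>R \<phi>' x)) (at x)"
    by (rule has_derivative_eq_rhs) auto
  show "continuous_on UNIV (\<lambda>x. g' (\<phi> x) *\<^sub>R \<phi>' x)"
    using C1_grad_cont[OF \<phi>] by (auto intro!: continuous_intros continuous_on_compose2[OF g(2)])
qed

lemma C1_grad_compose_real:
  assumes g: "C1_grad g g'" and \<phi>: "C1_grad \<phi> \<phi>'"
  shows "C1_grad (\<lambda>x. g (\<phi> x)) (\<lambda>x. g' (\<phi> x) *\<^sub>R \<phi>' x)"
  using g by (intro C1_grad_compose \<phi>) (auto simp: C1_grad_real_iff elim: continuous_on_subset)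

lemma C1_grad_affine:
  assumes "C1_grad \<phi> \<phi>'"
  shows "C1_grad (\<lambda>x. \<phi> (t + c *\<^sub>R x)) (\<lambda>x. c *\<^sub>R \<phi>' (t + c *\<^sub>R x))"
  unfolding C1_grad_def
proof (intro conjI allI)
  fix x
  have "((\<lambda>x. t + c *\<^sub>R x) has_derivative (\<lambda>h. c *\<^sub>R h)) (at x)"
    by (auto intro!: derivative_eq_intros)
  from has_derivative_compose[OF this C1_grad_deriv[OF assms]]
  show "((\<lambda>x. \<phi> (t + c *\<^sub>R x)) has_derivative (\<bullet>) (c *\<^sub>R \<phi>' (t + c *\<^sub>R x))) (at x)"
    by (rule has_derivative_eq_rhs) auto
  show "continuous_on UNIV (\<lambda>x. c *\<^sub>R \<phi>' (t + c *\<^sub>R x))"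
    using C1_grad_cont(2)[OF assms] by (auto intro!: continuous_intros elim: continuous_on_compose2)
qed

lemma C1_grad_shift: "C1_grad \<phi> \<phi>' \<Longrightarrow> C1_grad (\<lambda>x. \<phi> (x - y)) (\<lambda>x. \<phi>' (x - y))"
  using C1_grad_affine[of \<phi> \<phi>' "-y" 1] by simp

lemma C1_grad_reflect: "C1_grad \<phi> \<phi>' \<Longrightarrow> C1_grad (\<lambda>x. \<phi> (y - x)) (\<lambda>x. - \<phi>' (y - x))"
  using C1_grad_affine[of \<phi> \<phi>' "y" "-1"] by simp

lemma C1_grad_norm_sq: "C1_grad (\<lambda>x. (norm (x - p))\<^sup>2) (\<lambda>x. 2 *\<^sub>R (x - p))"
  unfolding C1_grad_def power2_norm_eq_inner
  by (auto intro!: derivative_eq_intros continuous_intros simp: inner_commute algebra_simps)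

lemma C1_grad_tensor:
  fixes \<phi> :: "'a::euclidean_space \<Rightarrow> real" and \<psi> :: "'b::euclidean_space \<Rightarrow> real"
  assumes \<phi>: "C1_grad \<phi> \<phi>'" and \<psi>: "C1_grad \<psi> \<psi>'"
  shows "C1_grad (\<lambda>z. \<phi> (fst z) * \<psi> (snd z)) (\<lambda>z. (\<psi> (snd z) *\<^sub>R \<phi>' (fst z), \<phi> (fst z) *\<^sub>R \<psi>' (snd z)))"
  unfolding C1_grad_def
proof (intro conjI allI)
  fix z :: "'a \<times> 'b"
  have "((\<lambda>z. \<phi> (fst z)) has_derivative (\<lambda>h. \<phi>' (fst z) \<bullet> fst h)) (at z)"
    by (rule has_derivative_compose[OF has_derivative_fst[OF has_derivative_ident] C1_grad_deriv[OF \<phi>]])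
  moreover have "((\<lambda>z. \<psi> (snd z)) has_derivative (\<lambda>h. \<psi>' (snd z) \<bullet> snd h)) (at z)"
    by (rule has_derivative_compose[OF has_derivative_snd[OF has_derivative_ident] C1_grad_deriv[OF \<psi>]])
  ultimately show "((\<lambda>z. \<phi> (fst z) * \<psi> (snd z)) has_derivative
      (\<bullet>) (\<psi> (snd z) *\<^sub>R \<phi>' (fst z), \<phi> (fst z) *\<^sub>R \<psi>' (snd z))) (at z)"
    by (rule has_derivative_eq_rhs[OF has_derivative_mult]) (auto simp: inner_prod_def algebra_simps)
  show "continuous_on UNIV (\<lambda>z. (\<psi> (snd z) *\<^sub>R \<phi>' (fst z), \<phi> (fst z) *\<^sub>R \<psi>' (snd z)))"
    by (intro continuous_intros continuous_on_compose2[OF C1_grad_cont(1)[OF \<phi>]] continuous_on_compose2[OF C1_grad_cont(2)[OF \<phi>]]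
        continuous_on_compose2[OF C1_grad_cont(1)[OF \<psi>]] continuous_on_compose2[OF C1_grad_cont(2)[OF \<psi>]]) auto
qed

lemma C1_grad_lipschitz:
  assumes \<phi>: "C1_grad \<phi> \<phi>'" and M: "\<And>x. norm (\<phi>' x) \<le> M"
  shows "\<bar>\<phi> y - \<phi> x\<bar> \<le> M * norm (y - x)"
proof -
  have "norm (\<phi>' z \<bullet> h) \<le> M * norm h" for z h
    using order_trans[OF Cauchy_Schwarz_ineq2 mult_right_mono[OF M norm_ge_zero]] by simp
  then have "norm (\<phi> y - \<phi> x) \<le> M * norm (y - x)"
    by (intro differentiable_bound[of UNIV]) (auto intro: has_derivative_at_withinI C1_grad_deriv[OF \<phi>] onorm_le)
  then show ?thesis by simp
qed

lemma C1_grad_remainder_le: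
  assumes "C1_grad \<phi> \<phi>'" and M: "\<And>x. norm (\<phi>' x) \<le> M"
  shows "\<bar>\<phi> y - \<phi> x - \<phi>' x \<bullet> (y - x)\<bar> \<le> 2 * M * norm (y - x)"
proof -
  have "\<bar>\<phi>' x \<bullet> (y - x)\<bar> \<le> M * norm (y - x)"
    by (rule order_trans[OF Cauchy_Schwarz_ineq2]) (intro mult_right_mono M, simp)
  then show ?thesis using C1_grad_lipschitz[OF assms, of y x] by linarith
qed

lemma C1_grad_remainder_tendsto:
  assumes \<phi>: "C1_grad \<phi> \<phi>'" and X: "X \<longlonglongrightarrow> x" "\<And>n. X n \<noteq> x"
  shows "(\<lambda>n. (\<phi> (X n) - \<phi> x - \<phi>' x \<bullet> (X n - x)) / norm (X n - x)) \<longlonglongrightarrow> 0"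
proof (rule tendsto_rabs_zero_cancel)
  have "((\<lambda>y. norm (\<phi> y - \<phi> x - \<phi>' x \<bullet> (y - x)) / norm (y - x)) \<longlongrightarrow> 0) (at x)"
    using C1_grad_deriv[OF \<phi>, of x] unfolding has_derivative_iff_norm by auto
  then show "(\<lambda>n. \<bar>(\<phi> (X n) - \<phi> x - \<phi>' x \<bullet> (X n - x)) / norm (X n - x)\<bar>) \<longlonglongrightarrow> 0"
    using X unfolding tendsto_at_iff_sequentially by (auto simp: comp_def)
qed

lemma continuous_on_convolution:
  fixes W :: "'a::euclidean_space \<Rightarrow> real" and \<psi> :: "'a \<Rightarrow> 'b::euclidean_space"
  assumes W: "integrable lborel W" and \<psi>: "continuous_on UNIV \<psi>" "\<And>x. norm (\<psi> x) \<le> M"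
  shows "continuous_on UNIV (\<lambda>x. LBINT z. W z *\<^sub>R \<psi> (x - z))"
  unfolding continuous_on_sequentially
proof (intro allI ballI impI)
  have [measurable]: "W \<in> borel_measurable borel" "\<psi> \<in> borel_measurable borel"
    using borel_measurable_integrable[OF W] \<psi>(1) by (auto intro: borel_measurable_continuous_onI)
  fix X :: "nat \<Rightarrow> 'a" and x assume "(\<forall>n. X n \<in> UNIV) \<and> X \<longlonglongrightarrow> x"
  then have X: "X \<longlonglongrightarrow> x" by simp
  have cont: "isCont \<psi> y" for y
    using \<psi>(1) by (simp add: continuous_on_eq_continuous_at)
  have "(\<lambda>n. LBINT z. W z *\<^sub>R \<psi> (X n - z)) \<longlonglongrightarrow> (LBINT z. W z *\<^sub>R \<psi> (x - z))"
  proof (rule integral_dominated_convergence)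
    show "integrable lborel (\<lambda>z. \<bar>W z\<bar> * M)" using W by auto
    show "AE z in lborel. (\<lambda>n. W z *\<^sub>R \<psi> (X n - z)) \<longlonglongrightarrow> W z *\<^sub>R \<psi> (x - z)"
      by (intro AE_I2 tendsto_intros isCont_tendsto_compose[OF cont] X)
  qed (auto intro!: AE_I2 mult_left_mono \<psi>(2))
  then show "((\<lambda>x. LBINT z. W z *\<^sub>R \<psi> (x - z)) \<circ> X) \<longlonglongrightarrow> (LBINT z. W z *\<^sub>R \<psi> (x - z))"
    by (simp add: comp_def)
qed

lemma convolution_has_derivative:
  fixes W :: "'a::euclidean_space \<Rightarrow> real"
  assumes W: "integrable lborel W" and \<gamma>: "C1_grad \<gamma> \<gamma>'"
    and M: "\<And>x. \<bar>\<gamma> x\<bar> \<le> M" "\<And>x. norm (\<gamma>' x) \<le> M"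
  shows "((\<lambda>x. LBINT z. W z * \<gamma> (x - z)) has_derivative (\<lambda>h. (LBINT z. W z *\<^sub>R \<gamma>' (x - z)) \<bullet> h)) (at x)"
    (is "(?F has_derivative (\<lambda>h. ?G x \<bullet> h)) (at x)")
  unfolding has_derivative_iff_norm tendsto_at_iff_sequentially
proof (intro conjI allI impI)
  have [measurable]: "W \<in> borel_measurable borel" "\<gamma> \<in> borel_measurable borel" "\<gamma>' \<in> borel_measurable borel"
    using borel_measurable_integrable[OF W] C1_grad_measurable[OF \<gamma>] by auto
  have F_integrable: "integrable lborel (\<lambda>z. W z * \<gamma> (x - z))" and G_integrable: "integrable lborel (\<lambda>z. W z *\<^sub>R \<gamma>' (x - z))" for x
    by (rule Bochner_Integration.integrable_bound[OF integrable_mult_right[OF W, of M]],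
        auto intro!: AE_I2 mult_mono order_trans[OF M(1)] order_trans[OF M(2)] simp: abs_mult mult.commute[of M])+
  fix X assume "\<forall>i. X i \<in> UNIV - {x}" "X \<longlonglongrightarrow> x"
  then have X: "X \<longlonglongrightarrow> x" "\<And>n. X n \<noteq> x" by auto
  define rem where "rem n z = (\<gamma> (X n - z) - \<gamma> (x - z) - \<gamma>' (x - z) \<bullet> (X n - x)) / norm (X n - x)" for n z
  have [measurable]: "rem n \<in> borel_measurable borel" for n
    unfolding rem_def by measurable
  have norm_rem: "norm (X n - x) * rem n z = \<gamma> (X n - z) - \<gamma> (x - z) - \<gamma>' (x - z) \<bullet> (X n - x)" for n z
    using X(2) by (simp add: rem_def)
  have rem_le: "\<bar>rem n z\<bar> \<le> 2 * M" for n z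
    using C1_grad_remainder_le[OF \<gamma> M(2), of "X n - z" "x - z"] X(2)
    by (simp add: rem_def pos_divide_le_eq)
  have "(?F (X n) - ?F x - ?G x \<bullet> (X n - x)) / norm (X n - x) = (LBINT z. W z * rem n z)" for n
  proof -
    have "?F (X n) - ?F x - ?G x \<bullet> (X n - x)
        = (LBINT z. W z * \<gamma> (X n - z) - W z * \<gamma> (x - z) - (W z *\<^sub>R \<gamma>' (x - z)) \<bullet> (X n - x))"
      using F_integrable G_integrable integrable_inner_left[OF G_integrable] by (simp flip: integral_inner_left)
    also have "\<dots> = (LBINT z. norm (X n - x) * (W z * rem n z))"
      by (simp add: mult.left_commute[of "norm (X n - x)"] norm_rem right_diff_distrib)
    finally show ?thesis using X(2) by simp
  qed
  moreover have "(\<lambda>n. LBINT z. W z * rem n z) \<longlonglongrightarrow> (\<integral>z. 0 \<partial>(lborel::'a measure))"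
  proof (rule integral_dominated_convergence)
    show "integrable lborel (\<lambda>z. \<bar>W z\<bar> * (2 * M))" using W by auto
    show "AE z in lborel. (\<lambda>n. W z * rem n z) \<longlonglongrightarrow> 0"
      unfolding rem_def using C1_grad_remainder_tendsto[OF C1_grad_shift[OF \<gamma>] X]
      by (intro AE_I2 tendsto_mult_right_zero)
  qed (auto intro!: AE_I2 mult_left_mono rem_le simp: abs_mult)
  ultimately have "(\<lambda>n. norm ((?F (X n) - ?F x - ?G x \<bullet> (X n - x)) / norm (X n - x))) \<longlonglongrightarrow> 0"
    by (simp add: tendsto_rabs_zero)
  then show "((\<lambda>y. norm (?F y - ?F x - ?G x \<bullet> (y - x)) / norm (y - x)) \<circ> X) \<longlonglongrightarrow> 0"
    by (simp add: comp_def)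
qed (rule bounded_linear_inner_right)

lemma C1_grad_convolution:
  fixes W :: "'a::euclidean_space \<Rightarrow> real"
  assumes "integrable lborel W" "C1_grad \<gamma> \<gamma>'" "\<And>x. \<bar>\<gamma> x\<bar> \<le> M" "\<And>x. norm (\<gamma>' x) \<le> M"
  shows "C1_grad (\<lambda>x. LBINT z. W z * \<gamma> (x - z)) (\<lambda>x. LBINT z. W z *\<^sub>R \<gamma>' (x - z))"
  unfolding C1_grad_def
  using convolution_has_derivative[OF assms] continuous_on_convolution[OF assms(1) C1_grad_cont(2)[OF assms(2)] assms(4)]
  by blast

definition C1c :: "'a::euclidean_space set \<Rightarrow> ('a \<Rightarrow> real) \<Rightarrow> ('a \<Rightarrow> 'a) \<Rightarrow> bool" where
  "C1c U \<phi> \<phi>' \<longleftrightarrow> C1_grad \<phi> \<phi>' \<and> compact (closure {x. \<phi> x \<noteq> 0}) \<and> closure {x. \<phi> x \<noteq> 0} \<subseteq> U"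

lemma C1c_on_iff_C1c: "C1c_on U \<phi> \<phi>' \<longleftrightarrow> C1c U \<phi> \<phi>'"
  by (auto simp: C1c_on_def C1c_def C1_grad_def)

lemma C1c_imp_C1_grad: "C1c U \<phi> \<phi>' \<Longrightarrow> C1_grad \<phi> \<phi>'"
  by (simp add: C1c_def)

lemma C1c_mono: "C1c U \<phi> \<phi>' \<Longrightarrow> U \<subseteq> V \<Longrightarrow> C1c V \<phi> \<phi>'"
  by (auto simp: C1c_def)

lemma C1cI:
  assumes "C1_grad \<phi> \<phi>'" "compact S" "S \<subseteq> U" "\<And>x. x \<notin> S \<Longrightarrow> \<phi> x = 0"
  shows "C1c U \<phi> \<phi>'"
proof -
  have "closure {x. \<phi> x \<noteq> 0} \<subseteq> S"
    using assms(2,4) by (intro closure_minimal) (auto intro: compact_imp_closed)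
  then show ?thesis
    using assms(1-3) unfolding C1c_def
    by (meson closed_closure closed_subset compact_eq_bounded_closed bounded_subset order_trans)
qed

lemma C1c_support:
  assumes "C1c U \<phi> \<phi>'"
  obtains S where "compact S" "S \<subseteq> U" "\<And>x. x \<notin> S \<Longrightarrow> \<phi> x = 0" "\<And>x. x \<notin> S \<Longrightarrow> \<phi>' x = 0"
proof
  let ?S = "closure {x. \<phi> x \<noteq> 0}"
  show "compact ?S" "?S \<subseteq> U" using assms by (auto simp: C1c_def)
  show zero: "\<phi> x = 0" if "x \<notin> ?S" for x
    using that closure_subset[of "{x. \<phi> x \<noteq> 0}"] by auto
  show "\<phi>' x = 0" if x: "x \<notin> ?S" for x
  proof -
    have S: "open (- ?S)" "x \<in> - ?S" using x by auto
    have "((\<lambda>_. 0) has_derivative (\<lambda>h. \<phi>' x \<bullet> h)) (at x)"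
      by (rule has_derivative_transform_within_open[OF C1_grad_deriv[OF C1c_imp_C1_grad[OF assms], of x] S])
         (blast intro: zero)
    then have "(\<lambda>h. \<phi>' x \<bullet> h) = (\<lambda>h. 0)"
      by (rule has_derivative_unique[OF _ has_derivative_const])
    then have "\<phi>' x \<bullet> \<phi>' x = 0" by (rule fun_cong)
    then show ?thesis by simp
  qed
qed

lemma C1c_bounded:
  assumes "C1c U \<phi> \<phi>'"
  obtains M where "M > 0" "\<And>x. \<bar>\<phi> x\<bar> \<le> M" "\<And>x. norm (\<phi>' x) \<le> M"
proof -
  obtain S where S: "compact S" "\<And>x. x \<notin> S \<Longrightarrow> \<phi> x = 0" "\<And>x. x \<notin> S \<Longrightarrow> \<phi>' x = 0"
    using C1c_support[OF assms] by metis
  have "compact (\<phi> ` S)" "compact (\<phi>' ` S)"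
    using S(1) C1_grad_cont[OF C1c_imp_C1_grad[OF assms]]
    by (auto intro!: compact_continuous_image elim: continuous_on_subset)
  then have "bounded (\<phi> ` S)" "bounded (\<phi>' ` S)"
    by (auto intro: compact_imp_bounded)
  then obtain A B where A: "\<And>x. x \<in> S \<Longrightarrow> \<bar>\<phi> x\<bar> \<le> A" and B: "\<And>x. x \<in> S \<Longrightarrow> norm (\<phi>' x) \<le> B"
    by (auto simp: bounded_iff)
  show ?thesis
  proof
    show "0 < \<bar>A\<bar> + \<bar>B\<bar> + 1" by simp
    fix x
    show "\<bar>\<phi> x\<bar> \<le> \<bar>A\<bar> + \<bar>B\<bar> + 1" using A[of x] S(2)[of x] by (cases "x \<in> S") auto
    show "norm (\<phi>' x) \<le> \<bar>A\<bar> + \<bar>B\<bar> + 1" using B[of x] S(3)[of x] by (cases "x \<in> S") auto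
  qed
qed

lemma C1c_integrable:
  assumes "C1c U \<phi> \<phi>'"
  shows "integrable lborel \<phi>" "integrable lborel \<phi>'"
    and "square_integrable lborel \<phi>" "square_integrable lborel \<phi>'"
proof -
  obtain M where M: "\<And>x. norm (\<phi> x) \<le> M" "\<And>x. norm (\<phi>' x) \<le> M"
    using C1c_bounded[OF assms] unfolding real_norm_def by metis
  obtain S where S: "compact S" "\<And>x. x \<notin> S \<Longrightarrow> \<phi> x = 0" "\<And>x. x \<notin> S \<Longrightarrow> \<phi>' x = 0"
    using C1c_support[OF assms] by metis
  note meas = C1_grad_measurable[OF C1c_imp_C1_grad[OF assms]]
  note bounded = compact_imp_bounded[OF S(1)]
  show "integrable lborel \<phi>" "square_integrable lborel \<phi>"
    by (rule integrable_bounded_support square_integrable_bounded_support; fact)+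
  show "integrable lborel \<phi>'" "square_integrable lborel \<phi>'"
    by (rule integrable_bounded_support square_integrable_bounded_support; fact)+
qed

lemma C1c_add:
  assumes "C1c U \<phi> \<phi>'" "C1c U \<psi> \<psi>'"
  shows "C1c U (\<lambda>x. \<phi> x + \<psi> x) (\<lambda>x. \<phi>' x + \<psi>' x)"
proof -
  obtain S where S: "compact S" "S \<subseteq> U" "\<And>x. x \<notin> S \<Longrightarrow> \<phi> x = 0"
    using C1c_support[OF assms(1)] by metis
  obtain S' where S': "compact S'" "S' \<subseteq> U" "\<And>x. x \<notin> S' \<Longrightarrow> \<psi> x = 0"
    using C1c_support[OF assms(2)] by metis
  show ?thesis
    using C1_grad_add[OF assms[THEN C1c_imp_C1_grad]] S S' by (intro C1cI[of _ _ "S \<union> S'"]) auto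
qed

lemma C1c_mult:
  assumes "C1c U \<phi> \<phi>'" "C1_grad \<psi> \<psi>'"
  shows "C1c U (\<lambda>x. \<phi> x * \<psi> x) (\<lambda>x. \<phi> x *\<^sub>R \<psi>' x + \<psi> x *\<^sub>R \<phi>' x)"
proof -
  obtain S where "compact S" "S \<subseteq> U" "\<And>x. x \<notin> S \<Longrightarrow> \<phi> x = 0"
    using C1c_support[OF assms(1)] by metis
  then show ?thesis
    using C1_grad_mult[OF C1c_imp_C1_grad[OF assms(1)] assms(2)] by (intro C1cI) auto
qed

lemma C1c_reflect:
  assumes "C1c UNIV \<phi> \<phi>'"
  shows "C1c UNIV (\<lambda>x. \<phi> (y - x)) (\<lambda>x. - \<phi>' (y - x))"
proof -
  obtain S where S: "compact S" "\<And>x. x \<notin> S \<Longrightarrow> \<phi> x = 0"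
    using C1c_support[OF assms] by metis
  show ?thesis
  proof (rule C1cI[OF C1_grad_reflect[OF C1c_imp_C1_grad[OF assms]]])
    show "compact ((\<lambda>x. y - x) ` S)"
      using S(1) by (intro compact_continuous_image continuous_intros)
    show "\<phi> (y - x) = 0" if "x \<notin> (\<lambda>x. y - x) ` S" for x
      using that S(2)[of "y - x"] by force
  qed simp
qed

text \<open>Near the origin the convolution of \<open>\<phi>\<close> with the indicator function of a large ball is constant.\<close>

lemma integral_C1c_grad:
  fixes \<phi> :: "'a::euclidean_space \<Rightarrow> real"
  assumes \<phi>: "C1c U \<phi> \<phi>'"
  shows "(LBINT x. \<phi>' x) = 0"
proof -
  obtain M where M: "\<And>x. \<bar>\<phi> x\<bar> \<le> M" "\<And>x. norm (\<phi>' x) \<le> M"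
    using C1c_bounded[OF \<phi>] by metis
  obtain S where S: "compact S" "\<And>x. x \<notin> S \<Longrightarrow> \<phi> x = 0" "\<And>x. x \<notin> S \<Longrightarrow> \<phi>' x = 0"
    using C1c_support[OF \<phi>] by metis
  obtain r where r: "\<And>x. x \<in> S \<Longrightarrow> norm x \<le> r"
    using compact_imp_bounded[OF S(1)] unfolding bounded_iff by blast
  let ?B = "ball 0 (r + 1) :: 'a set"
  let ?F = "\<lambda>x. LBINT z. indicat_real ?B z * \<phi> (x - z)"
  let ?G = "\<lambda>x. LBINT z. indicat_real ?B z *\<^sub>R \<phi>' (x - z)"
  have meas: "\<phi> \<in> borel_measurable borel" "\<phi>' \<in> borel_measurable borel"
    using C1_grad_measurable[OF C1c_imp_C1_grad[OF \<phi>]] by auto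
  have "integrable lborel (indicat_real ?B)"
    by (intro integrable_real_indicator emeasure_lborel_ball_finite) simp
  from C1_grad_deriv[OF C1_grad_convolution[OF this C1c_imp_C1_grad[OF \<phi>] M]]
  have deriv: "(?F has_derivative (\<lambda>h. ?G 0 \<bullet> h)) (at 0)" .
  have S_in_ball: "z \<in> ?B" if "norm x < 1" "x - z \<in> S" for x z
    using r[OF that(2)] that(1) norm_triangle_ineq3[of x z] by (simp add: norm_minus_commute)
  have "?F x = (LBINT z. \<phi> z)" if "norm x < 1" for x
  proof -
    have "?F x = (LBINT z. \<phi> (x - z))"
      using S(2) S_in_ball[OF that] by (intro Bochner_Integration.integral_cong) (auto simp: indicator_def)
    then show ?thesis by (simp add: integral_translate(3)[OF meas(1)])
  qed
  then have "((\<lambda>_. LBINT z. \<phi> z) has_derivative (\<lambda>h. ?G 0 \<bullet> h)) (at 0)"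
    by (intro has_derivative_transform_within_open[OF deriv, of "ball 0 1"]) auto
  then have "(\<lambda>h. ?G 0 \<bullet> h) = (\<lambda>h. 0)"
    by (rule has_derivative_unique[OF _ has_derivative_const])
  then have "?G 0 \<bullet> ?G 0 = 0" by (rule fun_cong)
  moreover have "?G 0 = (LBINT z. \<phi>' (0 - z))"
    using S(3) S_in_ball[of 0] by (intro Bochner_Integration.integral_cong) (auto simp: indicator_def)
  ultimately show ?thesis by (simp only: integral_translate(3)[OF meas(2)] inner_eq_zero_iff)
qed

lemma integrable_continuous_compact_support:
  fixes f :: "'a::euclidean_space \<Rightarrow> real"
  assumes f: "continuous_on UNIV f" and S: "compact S" "\<And>x. x \<notin> S \<Longrightarrow> f x = 0"
  shows "integrable lborel f"
proof -
  have "integrable lborel (\<lambda>x. indicator S x *\<^sub>R f x)"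
    using f S(1) by (intro borel_integrable_compact) (auto elim: continuous_on_subset)
  moreover have "(\<lambda>x. indicator S x *\<^sub>R f x) = f"
    using S(2) by (auto simp: indicator_def fun_eq_iff)
  ultimately show ?thesis by (simp only:)
qed

lemma integrable_continuous_mult_C1c:
  assumes \<psi>: "continuous_on UNIV \<psi>" "continuous_on UNIV \<psi>'" and \<phi>: "C1c U \<phi> \<phi>'"
  shows "integrable lborel (\<lambda>x. \<psi> x * \<phi> x)" "integrable lborel (\<lambda>x. \<psi> x * (\<phi>' x \<bullet> h))"
    "integrable lborel (\<lambda>x. \<psi>' x \<bullet> \<phi>' x)"
proof -
  obtain S where S: "compact S" "\<And>x. x \<notin> S \<Longrightarrow> \<phi> x = 0" "\<And>x. x \<notin> S \<Longrightarrow> \<phi>' x = 0"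
    using C1c_support[OF \<phi>] by metis
  show "integrable lborel (\<lambda>x. \<psi> x * \<phi> x)" "integrable lborel (\<lambda>x. \<psi> x * (\<phi>' x \<bullet> h))"
    "integrable lborel (\<lambda>x. \<psi>' x \<bullet> \<phi>' x)"
    using C1_grad_cont[OF C1c_imp_C1_grad[OF \<phi>]] \<psi> S
    by (auto intro!: integrable_continuous_compact_support[OF _ S(1)] continuous_intros)
qed

lemma C1c_integral_by_parts:
  assumes \<phi>: "C1c U \<phi> \<phi>'" and \<psi>: "C1_grad \<psi> \<psi>'"
  shows "(LBINT x. \<psi> x * (\<phi>' x \<bullet> h)) = - (LBINT x. (\<psi>' x \<bullet> h) * \<phi> x)"
proof -
  note parts = C1c_mult[OF \<phi> \<psi>]
  have integrable: "integrable lborel (\<lambda>x. (\<psi>' x \<bullet> h) * \<phi> x)" "integrable lborel (\<lambda>x. \<psi> x * (\<phi>' x \<bullet> h))"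
    using C1_grad_cont[OF \<psi>]
    by (auto intro!: integrable_continuous_mult_C1c[OF _ _ \<phi>, where \<psi>' = \<psi>'] continuous_intros)
  have "0 = (LBINT x. (\<phi> x *\<^sub>R \<psi>' x + \<psi> x *\<^sub>R \<phi>' x) \<bullet> h)"
    by (subst integral_inner_left) (simp_all add: C1c_integrable(2)[OF parts] integral_C1c_grad[OF parts])
  also have "\<dots> = (LBINT x. (\<psi>' x \<bullet> h) * \<phi> x + \<psi> x * (\<phi>' x \<bullet> h))"
    by (simp add: inner_add_left mult.commute)
  also have "\<dots> = (LBINT x. (\<psi>' x \<bullet> h) * \<phi> x) + (LBINT x. \<psi> x * (\<phi>' x \<bullet> h))"
    using integrable by (rule Bochner_Integration.integral_add)
  finally show ?thesis by simp
qed

lemma C1c_integral_divergence: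
  fixes F :: "'a::euclidean_space \<Rightarrow> 'a"
  assumes \<phi>: "C1c U \<phi> \<phi>'" and F: "\<And>b. b \<in> Basis \<Longrightarrow> C1_grad (\<lambda>x. F x \<bullet> b) (F' b)"
  shows "(LBINT x. F x \<bullet> \<phi>' x) = - (LBINT x. (\<Sum>b\<in>Basis. F' b x \<bullet> b) * \<phi> x)"
proof -
  have integrable: "integrable lborel (\<lambda>x. (F x \<bullet> b) * (\<phi>' x \<bullet> b))" "integrable lborel (\<lambda>x. (F' b x \<bullet> b) * \<phi> x)"
    if "b \<in> Basis" for b
    using C1_grad_cont[OF F[OF that]]
    by (auto intro!: integrable_continuous_mult_C1c[OF _ _ \<phi>, where \<psi>' = "F' b"] continuous_intros)
  have "(LBINT x. F x \<bullet> \<phi>' x) = (LBINT x. \<Sum>b\<in>Basis. (F x \<bullet> b) * (\<phi>' x \<bullet> b))"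
    by (intro Bochner_Integration.integral_cong refl) (rule euclidean_inner)
  also have "\<dots> = (\<Sum>b\<in>Basis. LBINT x. (F x \<bullet> b) * (\<phi>' x \<bullet> b))"
    using integrable by (intro Bochner_Integration.integral_sum)
  also have "\<dots> = (\<Sum>b\<in>Basis. - (LBINT x. (F' b x \<bullet> b) * \<phi> x))"
    by (intro sum.cong refl C1c_integral_by_parts[OF \<phi> F])
  also have "\<dots> = - (LBINT x. \<Sum>b\<in>Basis. (F' b x \<bullet> b) * \<phi> x)"
    using integrable by (simp add: sum_negf Bochner_Integration.integral_sum)
  finally show ?thesis by (simp add: sum_distrib_right)
qed

subsection \<open>Cutoff functions\<close>

definition pos_sq :: "real \<Rightarrow> real" where "pos_sq t = (max 0 t)\<^sup>2"

lemma pos_sq_nonneg [simp]: "0 \<le> pos_sq t"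
  by (simp add: pos_sq_def)

lemma C1_grad_pos_sq: "C1_grad pos_sq (\<lambda>t. 2 * max 0 t)"
  unfolding C1_grad_real_iff
proof (intro conjI allI)
  fix t :: real
  consider (pos) "t > 0" | (neg) "t < 0" | (zero) "t = 0" by linarith
  then show "(pos_sq has_real_derivative 2 * max 0 t) (at t)"
  proof cases
    case pos
    then have "((\<lambda>t. t\<^sup>2) has_real_derivative 2 * max 0 t) (at t)"
      by (auto intro!: derivative_eq_intros)
    then show ?thesis
      by (rule has_field_derivative_transform_within_open[of _ _ _ "{0<..}"]) (use pos in \<open>auto simp: pos_sq_def\<close>)
  next
    case neg
    then have "((\<lambda>t. 0) has_real_derivative 2 * max 0 t) (at t)"
      by (auto intro!: derivative_eq_intros)
    then show ?thesis
      by (rule has_field_derivative_transform_within_open[of _ _ _ "{..<0}"]) (use neg in \<open>auto simp: pos_sq_def\<close>)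
  next
    case zero
    have "((\<lambda>h. pos_sq h / h) \<longlongrightarrow> 0) (at 0)"
    proof (rule Lim_null_comparison)
      show "\<forall>\<^sub>F h in at 0. norm (pos_sq h / h) \<le> \<bar>h\<bar>"
        by (auto intro!: always_eventually simp: pos_sq_def max_def power2_eq_square abs_mult)
    qed (auto intro!: tendsto_eq_intros)
    then show ?thesis
      using zero by (simp add: DERIV_def pos_sq_def)
  qed
qed (intro continuous_intros)

definition cutoff :: "real \<Rightarrow> real \<Rightarrow> real \<Rightarrow> real" where
  "cutoff a b t = pos_sq (1 - pos_sq ((t - a) / (b - a)))"

definition cutoff_deriv :: "real \<Rightarrow> real \<Rightarrow> real \<Rightarrow> real" where
  "cutoff_deriv a b t = - (4 / (b - a)) * (max 0 (1 - pos_sq ((t - a) / (b - a))) * max 0 ((t - a) / (b - a)))"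

lemma C1_grad_cutoff:
  assumes "a < b"
  shows "C1_grad (cutoff a b) (cutoff_deriv a b)"
proof -
  have "C1_grad (\<lambda>t. (t - a) / (b - a)) (\<lambda>t. 1 / (b - a))"
    unfolding C1_grad_real_iff using assms by (auto intro!: derivative_eq_intros)
  from C1_grad_compose_real[OF C1_grad_pos_sq C1_grad_diff[OF C1_grad_const C1_grad_compose_real[OF C1_grad_pos_sq this]], of 1]
  show ?thesis
    by (simp add: cutoff_def[abs_def] cutoff_deriv_def[abs_def] algebra_simps)
qed

lemma cutoff_eq_1: "a < b \<Longrightarrow> t \<le> a \<Longrightarrow> cutoff a b t = 1"
  and cutoff_deriv_eq_0: "a < b \<Longrightarrow> t \<le> a \<Longrightarrow> cutoff_deriv a b t = 0"
  by (simp_all add: cutoff_def cutoff_deriv_def pos_sq_def max_absorb1 divide_nonpos_pos)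

lemma cutoff_eq_0:
  assumes "a < b" "b \<le> t"
  shows "cutoff a b t = 0" "cutoff_deriv a b t = 0"
proof -
  have "1 \<le> pos_sq ((t - a) / (b - a))"
    unfolding pos_sq_def using assms by (intro one_le_power) auto
  then show "cutoff a b t = 0" "cutoff_deriv a b t = 0"
    by (auto simp: cutoff_def cutoff_deriv_def pos_sq_def[of "1 - _"])
qed

lemma cutoff_bounds: "0 \<le> cutoff a b t" "cutoff a b t \<le> 1"
  unfolding cutoff_def pos_sq_def[of "1 - _"] by (auto intro!: power_le_one simp: max_def)

lemma abs_cutoff_deriv_le:
  assumes "a < b"
  shows "\<bar>cutoff_deriv a b t\<bar> \<le> 4 / (b - a)"
proof -
  define s where "s = (t - a) / (b - a)"
  have "max 0 (1 - pos_sq s) * max 0 s \<le> 1"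
  proof (cases "s \<le> 1")
    case True
    then show ?thesis by (intro mult_le_one) auto
  next
    case False
    then have "1 \<le> pos_sq s" by (simp add: pos_sq_def)
    then show ?thesis by simp
  qed
  then have "4 / (b - a) * (max 0 (1 - pos_sq s) * max 0 s) \<le> 4 / (b - a) * 1"
    using assms by (intro mult_left_mono) auto
  then show ?thesis
    using assms by (simp add: cutoff_deriv_def abs_mult flip: s_def)
qed

definition bump :: "'a::euclidean_space \<Rightarrow> real \<Rightarrow> 'a \<Rightarrow> real" where
  "bump p r x = cutoff (r\<^sup>2) ((2 * r)\<^sup>2) ((norm (x - p))\<^sup>2)"

definition bump_grad :: "'a::euclidean_space \<Rightarrow> real \<Rightarrow> 'a \<Rightarrow> 'a" where
  "bump_grad p r x = cutoff_deriv (r\<^sup>2) ((2 * r)\<^sup>2) ((norm (x - p))\<^sup>2) *\<^sub>R 2 *\<^sub>R (x - p)"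

lemma bump_bounds: "0 \<le> bump p r x" "bump p r x \<le> 1"
  by (simp_all add: bump_def cutoff_bounds)

lemma
  assumes r: "r > 0"
  shows C1_grad_bump: "C1_grad (bump p r) (bump_grad p r)"
    and bump_eq_1: "norm (x - p) \<le> r \<Longrightarrow> bump p r x = 1"
    and bump_eq_0: "2 * r \<le> norm (x - p) \<Longrightarrow> bump p r x = 0"
    and norm_bump_grad_le: "norm (bump_grad p r x) \<le> 16 / r"
proof -
  have radii: "r\<^sup>2 < (2 * r)\<^sup>2" using r by (simp add: power_mult_distrib)
  show "C1_grad (bump p r) (bump_grad p r)"
    unfolding bump_def[abs_def] bump_grad_def[abs_def]
    by (rule C1_grad_compose_real[OF C1_grad_cutoff[OF radii] C1_grad_norm_sq])
  show "norm (x - p) \<le> r \<Longrightarrow> bump p r x = 1"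
    unfolding bump_def by (intro cutoff_eq_1[OF radii] power_mono) auto
  show "2 * r \<le> norm (x - p) \<Longrightarrow> bump p r x = 0"
    unfolding bump_def using r by (intro cutoff_eq_0(1)[OF radii] power_mono) auto
  show "norm (bump_grad p r x) \<le> 16 / r"
  proof (cases "2 * r \<le> norm (x - p)")
    case True
    then have "(2 * r)\<^sup>2 \<le> (norm (x - p))\<^sup>2" using r by (intro power_mono) auto
    from cutoff_eq_0(2)[OF radii this] show ?thesis using r by (simp add: bump_grad_def)
  next
    case False
    have "norm (bump_grad p r x) \<le> 4 / ((2 * r)\<^sup>2 - r\<^sup>2) * (2 * (2 * r))"
      using False abs_cutoff_deriv_le[OF radii, of "(norm (x - p))\<^sup>2"] radii
      unfolding bump_grad_def norm_scaleR by (intro mult_mono) auto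
    also have "\<dots> \<le> 16 / r"
      using r by (simp add: power2_eq_square field_simps)
    finally show ?thesis .
  qed
qed

lemma C1c_bump:
  assumes "r > 0"
  shows "C1c UNIV (bump p r) (bump_grad p r)"
proof (rule C1cI[OF C1_grad_bump[OF assms] compact_cball])
  show "x \<notin> cball p (2 * r) \<Longrightarrow> bump p r x = 0" for x
    using assms by (intro bump_eq_0) (auto simp: dist_norm norm_minus_commute)
qed simp

lemma mollifier_exists:
  fixes p :: "'a::euclidean_space"
  assumes r: "r > 0"
  obtains \<gamma> \<gamma>' where "C1c UNIV \<gamma> \<gamma>'" "\<And>x. 0 \<le> \<gamma> x" "(LBINT x. \<gamma> x) = 1" "\<And>x. x \<notin> cball p r \<Longrightarrow> \<gamma> x = 0"
proof -
  have half_r: "r / 2 > 0" using r by simp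
  note C1c = C1c_bump[OF half_r, of p]
  define mass where "mass = (LBINT x. bump p (r / 2) x)"
  have "0 < measure lborel (cball p (r / 2))"
    using r by (simp add: content_cball)
  also have "\<dots> = (LBINT x. indicator (cball p (r / 2)) x)"
    by simp
  also have "\<dots> \<le> mass"
    unfolding mass_def
  proof (rule integral_mono[OF _ C1c_integrable(1)[OF C1c]])
    show "integrable lborel (indicat_real (cball p (r / 2)))"
      by (intro integrable_real_indicator emeasure_lborel_cball_finite) simp
    show "indicat_real (cball p (r / 2)) x \<le> bump p (r / 2) x" for x
      using bump_eq_1[OF half_r, of x p] by (auto simp: indicator_def dist_norm norm_minus_commute bump_bounds)
  qed
  finally have mass: "mass > 0" .
  have support: "bump p (r / 2) x = 0" if "x \<notin> cball p r" for x
    using bump_eq_0[OF half_r, of x p] that by (auto simp: dist_norm norm_minus_commute)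
  show ?thesis
  proof
    show "C1c UNIV (\<lambda>x. (1 / mass) * bump p (r / 2) x) (\<lambda>x. (1 / mass) *\<^sub>R bump_grad p (r / 2) x)"
      using support by (intro C1cI[OF C1_grad_cmult[OF C1_grad_bump[OF half_r]] compact_cball[of p r]]) auto
    show "0 \<le> (1 / mass) * bump p (r / 2) x" for x using mass bump_bounds[of p] by simp
    show "(LBINT x. (1 / mass) * bump p (r / 2) x) = 1" using mass by (simp add: mass_def)
  qed (use support in simp)
qed

section \<open>Weak gradients and zero boundary values\<close>

definition weak_grad :: "('a::euclidean_space \<Rightarrow> real) \<Rightarrow> ('a \<Rightarrow> 'a) \<Rightarrow> bool" where
  "weak_grad W H \<longleftrightarrow> square_integrable lborel W \<and> square_integrable lborel H \<and>
     (\<forall>\<phi> \<phi>'. C1c UNIV \<phi> \<phi>' \<longrightarrow>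
        (\<forall>h. (LBINT x. W x * (\<phi>' x \<bullet> h)) = - (LBINT x. (H x \<bullet> h) * \<phi> x)))"

definition H1_0 :: "'a::euclidean_space set \<Rightarrow> ('a \<Rightarrow> real) \<Rightarrow> ('a \<Rightarrow> 'a) \<Rightarrow> bool" where
  "H1_0 U W H \<longleftrightarrow> square_integrable lborel W \<and> square_integrable lborel H \<and>
     (\<forall>e>0. \<exists>\<phi> \<phi>'. C1c U \<phi> \<phi>' \<and>
        L2_norm lborel (\<lambda>x. W x - \<phi> x) < e \<and> L2_norm lborel (\<lambda>x. H x - \<phi>' x) < e)"

lemma weak_gradD:
  assumes "weak_grad W H"
  shows "square_integrable lborel W" "square_integrable lborel H"
    and "C1c UNIV \<phi> \<phi>' \<Longrightarrow> (LBINT x. W x * (\<phi>' x \<bullet> h)) = - (LBINT x. (H x \<bullet> h) * \<phi> x)"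
  using assms unfolding weak_grad_def by blast+

lemma H1_0_approx:
  assumes "H1_0 U W H" "e > 0"
  obtains \<phi> \<phi>' where "C1c U \<phi> \<phi>'" "L2_norm lborel (\<lambda>x. W x - \<phi> x) < e" "L2_norm lborel (\<lambda>x. H x - \<phi>' x) < e"
  using assms unfolding H1_0_def by blast

lemma integrable_mult_C1c:
  assumes \<phi>: "C1c U \<phi> \<phi>'"
  shows "square_integrable lborel W \<Longrightarrow> integrable lborel (\<lambda>x. W x * (\<phi>' x \<bullet> h))"
    and "square_integrable lborel H \<Longrightarrow> integrable lborel (\<lambda>x. (H x \<bullet> h) * \<phi> x)"
proof -
  assume "square_integrable lborel W"
  from integrable_inner_left[OF integrable_scaleR_square_integrable[OF this C1c_integrable(4)[OF \<phi>]], of h]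
  show "integrable lborel (\<lambda>x. W x * (\<phi>' x \<bullet> h))" by simp
next
  assume "square_integrable lborel H"
  from integrable_inner_left[OF integrable_scaleR_square_integrable[OF C1c_integrable(3)[OF \<phi>] this], of h]
  show "integrable lborel (\<lambda>x. (H x \<bullet> h) * \<phi> x)" by (simp add: mult.commute)
qed

lemma weak_grad_mult:
  fixes W :: "'a::euclidean_space \<Rightarrow> real"
  assumes W: "weak_grad W H" and \<zeta>: "C1_grad \<zeta> \<zeta>'"
    and M: "\<And>x. \<bar>\<zeta> x\<bar> \<le> M" "\<And>x. norm (\<zeta>' x) \<le> M"
  shows "weak_grad (\<lambda>x. \<zeta> x * W x) (\<lambda>x. \<zeta> x *\<^sub>R H x + W x *\<^sub>R \<zeta>' x)" (is "weak_grad ?W ?H")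
  unfolding weak_grad_def
proof (intro conjI allI impI)
  note sq = weak_gradD(1,2)[OF W]
  note [measurable] = C1_grad_measurable[OF \<zeta>] square_integrable_measurable[OF sq(1)]
  show W': "square_integrable lborel ?W"
    using square_integrable_scaleR_bounded[OF sq(1) _ M(1)] by simp
  have "square_integrable lborel (\<lambda>x. W x *\<^sub>R \<zeta>' x)"
  proof (rule square_integrable_bound)
    show "integrable lborel (\<lambda>x. (norm (W x))\<^sup>2 * M\<^sup>2)" using square_integrableD[OF sq(1)] by simp
    show "(norm (W x *\<^sub>R \<zeta>' x))\<^sup>2 \<le> (norm (W x))\<^sup>2 * M\<^sup>2" for x
      using power_mono[OF M(2)[of x], of 2] by (auto simp: power_mult_distrib intro!: mult_left_mono)
  qed measurable
  then show H': "square_integrable lborel ?H"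
    using square_integrable_scaleR_bounded[OF sq(2) _ M(1)] by (intro square_integrable_add) auto
  fix \<phi> :: "'a \<Rightarrow> real" and \<phi>' h assume \<phi>: "C1c UNIV \<phi> \<phi>'"
  note \<phi>\<zeta> = C1c_mult[OF \<phi> \<zeta>]
  have "(LBINT x. ?W x * (\<phi>' x \<bullet> h)) + (LBINT x. (?H x \<bullet> h) * \<phi> x)
      = (LBINT x. ?W x * (\<phi>' x \<bullet> h) + (?H x \<bullet> h) * \<phi> x)"
    using integrable_mult_C1c[OF \<phi>] W' H' by (intro Bochner_Integration.integral_add[symmetric])
  also have "\<dots> = (LBINT x. W x * ((\<phi> x *\<^sub>R \<zeta>' x + \<zeta> x *\<^sub>R \<phi>' x) \<bullet> h) + (H x \<bullet> h) * (\<phi> x * \<zeta> x))"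
    by (intro Bochner_Integration.integral_cong) (auto simp: inner_add_left algebra_simps)
  also have "\<dots> = (LBINT x. W x * ((\<phi> x *\<^sub>R \<zeta>' x + \<zeta> x *\<^sub>R \<phi>' x) \<bullet> h)) + (LBINT x. (H x \<bullet> h) * (\<phi> x * \<zeta> x))"
    using integrable_mult_C1c[OF \<phi>\<zeta>] sq by (intro Bochner_Integration.integral_add)
  also have "\<dots> = 0" using weak_gradD(3)[OF W \<phi>\<zeta>] by simp
  finally show "(LBINT x. ?W x * (\<phi>' x \<bullet> h)) = - (LBINT x. (?H x \<bullet> h) * \<phi> x)" by simp
qed

lemma
  fixes V :: "'a::euclidean_space \<Rightarrow> real"
  assumes V: "weak_grad V K" and r: "r > 0"
  shows weak_grad_bump: "weak_grad (\<lambda>x. bump p r x * V x) (\<lambda>x. bump p r x *\<^sub>R K x + V x *\<^sub>R bump_grad p r x)"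
    and weak_grad_bump_compl:
      "weak_grad (\<lambda>x. (1 - bump p r x) * V x) (\<lambda>x. (1 - bump p r x) *\<^sub>R K x + V x *\<^sub>R (0 - bump_grad p r x))"
proof -
  have "0 \<le> 16 / r" using r by simp
  then have bound: "\<bar>bump p r x\<bar> \<le> 16 / r + 1" "\<bar>1 - bump p r x\<bar> \<le> 16 / r + 1" for x
    using bump_bounds[of p r x] by linarith+
  have grad_bound: "norm (bump_grad p r x) \<le> 16 / r + 1" "norm (0 - bump_grad p r x) \<le> 16 / r + 1" for x
    using norm_bump_grad_le[OF r, of p x] by simp_all
  show "weak_grad (\<lambda>x. bump p r x * V x) (\<lambda>x. bump p r x *\<^sub>R K x + V x *\<^sub>R bump_grad p r x)"
    by (rule weak_grad_mult[OF V C1_grad_bump[OF r] bound(1) grad_bound(1)])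
  show "weak_grad (\<lambda>x. (1 - bump p r x) * V x) (\<lambda>x. (1 - bump p r x) *\<^sub>R K x + V x *\<^sub>R (0 - bump_grad p r x))"
    by (rule weak_grad_mult[OF V C1_grad_diff[OF C1_grad_const C1_grad_bump[OF r]] bound(2) grad_bound(2)])
qed

lemma H1_0_closed:
  assumes sq: "square_integrable lborel W" "square_integrable lborel H"
    and approx: "\<And>e. e > 0 \<Longrightarrow> \<exists>V K. H1_0 U V K \<and>
        L2_norm lborel (\<lambda>x. W x - V x) < e \<and> L2_norm lborel (\<lambda>x. H x - K x) < e"
  shows "H1_0 U W H"
  unfolding H1_0_def
proof (intro conjI sq allI impI)
  fix e :: real assume "e > 0"
  then have half: "e / 2 > 0" by simp
  obtain V K where VK: "H1_0 U V K"
      and W_near_V: "L2_norm lborel (\<lambda>x. W x - V x) < e / 2" "L2_norm lborel (\<lambda>x. H x - K x) < e / 2"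
    using approx[OF half] by blast
  obtain \<phi> \<phi>' where \<phi>: "C1c U \<phi> \<phi>'"
      and V\<phi>: "L2_norm lborel (\<lambda>x. V x - \<phi> x) < e / 2" "L2_norm lborel (\<lambda>x. K x - \<phi>' x) < e / 2"
    by (rule H1_0_approx[OF VK half])
  have "square_integrable lborel V" "square_integrable lborel K" using VK by (auto simp: H1_0_def)
  then have "L2_norm lborel (\<lambda>x. W x - \<phi> x) < e" "L2_norm lborel (\<lambda>x. H x - \<phi>' x) < e"
    using L2_norm_diff_triangle_ineq[OF sq(1) _ C1c_integrable(3)[OF \<phi>], of V]
      L2_norm_diff_triangle_ineq[OF sq(2) _ C1c_integrable(4)[OF \<phi>], of K] W_near_V V\<phi> by linarith+
  then show "\<exists>\<phi> \<phi>'. C1c U \<phi> \<phi>' \<and> L2_norm lborel (\<lambda>x. W x - \<phi> x) < e \<and> L2_norm lborel (\<lambda>x. H x - \<phi>' x) < e"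
    using \<phi> by blast
qed

lemma H1_0_add:
  assumes V: "H1_0 U V K" and V': "H1_0 U V' K'"
  shows "H1_0 U (\<lambda>x. V x + V' x) (\<lambda>x. K x + K' x)"
  unfolding H1_0_def
proof (intro conjI allI impI)
  have sq: "square_integrable lborel V" "square_integrable lborel K" "square_integrable lborel V'" "square_integrable lborel K'"
    using V V' by (auto simp: H1_0_def)
  then show "square_integrable lborel (\<lambda>x. V x + V' x)" "square_integrable lborel (\<lambda>x. K x + K' x)"
    by (auto intro: square_integrable_add)
  fix e :: real assume "e > 0"
  then have half: "e / 2 > 0" by simp
  obtain \<phi> \<phi>' where \<phi>: "C1c U \<phi> \<phi>'" "L2_norm lborel (\<lambda>x. V x - \<phi> x) < e / 2" "L2_norm lborel (\<lambda>x. K x - \<phi>' x) < e / 2"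
    by (rule H1_0_approx[OF V half])
  obtain \<psi> \<psi>' where \<psi>: "C1c U \<psi> \<psi>'" "L2_norm lborel (\<lambda>x. V' x - \<psi> x) < e / 2" "L2_norm lborel (\<lambda>x. K' x - \<psi>' x) < e / 2"
    by (rule H1_0_approx[OF V' half])
  note sq\<phi> = C1c_integrable(3,4)[OF \<phi>(1)] C1c_integrable(3,4)[OF \<psi>(1)]
  have "L2_norm lborel (\<lambda>x. (V x - \<phi> x) + (V' x - \<psi> x)) < e" "L2_norm lborel (\<lambda>x. (K x - \<phi>' x) + (K' x - \<psi>' x)) < e"
    using L2_norm_triangle_ineq[OF square_integrable_diff[OF sq(1) sq\<phi>(1)] square_integrable_diff[OF sq(3) sq\<phi>(3)]]
      L2_norm_triangle_ineq[OF square_integrable_diff[OF sq(2) sq\<phi>(2)] square_integrable_diff[OF sq(4) sq\<phi>(4)]] \<phi> \<psi>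
    by linarith+
  then show "\<exists>\<phi> \<phi>'. C1c U \<phi> \<phi>' \<and> L2_norm lborel (\<lambda>x. V x + V' x - \<phi> x) < e \<and> L2_norm lborel (\<lambda>x. K x + K' x - \<phi>' x) < e"
    by (intro exI[of _ "\<lambda>x. \<phi> x + \<psi> x"] exI[of _ "\<lambda>x. \<phi>' x + \<psi>' x"] conjI C1c_add[OF \<phi>(1) \<psi>(1)])
       (simp_all add: add_diff_add)
qed

subsection \<open>Mollification\<close>

lemma convolution_diff_eq:
  fixes f :: "'a::euclidean_space \<Rightarrow> 'b::euclidean_space"
  assumes \<gamma>: "integrable lborel \<gamma>" "\<And>x. integrable lborel (\<lambda>y. \<gamma> (x - y) *\<^sub>R f y)"
    and [measurable]: "f \<in> borel_measurable borel"
  shows "(LBINT y. \<gamma> (x - y) *\<^sub>R f y) - (LBINT y. \<gamma> y) *\<^sub>R f x = (LBINT y. \<gamma> y *\<^sub>R (f (x - y) - f x))"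
proof -
  have [measurable]: "\<gamma> \<in> borel_measurable borel" using \<gamma>(1) by (auto dest: borel_measurable_integrable)
  have "(LBINT y. \<gamma> (x - y) *\<^sub>R f y) = (LBINT y. \<gamma> y *\<^sub>R f (x - y))"
    by (subst integral_translate(3)[symmetric, where y=x]) auto
  moreover have "integrable lborel (\<lambda>y. \<gamma> y *\<^sub>R f (x - y))"
    using integrable_translate(3)[OF \<gamma>(2)[of x], of x] by simp
  ultimately show ?thesis
    using \<gamma>(1) by (simp add: scaleR_diff_right)
qed

lemma L2_norm_convolution_diff_le:
  fixes f :: "'a::euclidean_space \<Rightarrow> 'b::euclidean_space"
  assumes f: "square_integrable lborel f" and \<gamma>: "C1c UNIV \<gamma> \<gamma>'" "\<And>x. 0 \<le> \<gamma> x" "(LBINT x. \<gamma> x) = 1"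
    and e: "0 \<le> e" "\<And>y. \<gamma> y \<noteq> 0 \<Longrightarrow> L2_modulus f y \<le> e"
  shows "L2_norm lborel (\<lambda>x. (LBINT y. \<gamma> (x - y) *\<^sub>R f y) - f x) \<le> e"
proof -
  note [measurable] = square_integrable_measurable[OF f] L2_modulus_measurable[OF f]
  note i\<gamma> = C1c_integrable(1)[OF \<gamma>(1)]
  have "integrable lborel (\<lambda>y. \<gamma> (x - y) *\<^sub>R f y)" for x
    by (rule integrable_scaleR_square_integrable[OF C1c_integrable(3)[OF C1c_reflect[OF \<gamma>(1)]] f])
  from convolution_diff_eq[OF i\<gamma> this] f
  have convolution_eq: "(\<lambda>x. (LBINT y. \<gamma> (x - y) *\<^sub>R f y) - f x) = (\<lambda>x. LBINT y. \<gamma> y *\<^sub>R (f (x - y) - f x))"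
    by (simp add: \<gamma>(3) fun_eq_iff)
  have weighted_le: "\<gamma> y * (L2_modulus f y)\<^sup>2 \<le> \<gamma> y * e\<^sup>2" for y
    using e(2)[of y] \<gamma>(2)[of y] by (cases "\<gamma> y = 0") (auto intro!: mult_left_mono power_mono)
  have "(L2_norm lborel (\<lambda>x. (LBINT y. \<gamma> (x - y) *\<^sub>R f y) - f x))\<^sup>2 \<le> (LBINT y. \<gamma> y * (L2_modulus f y)\<^sup>2)"
    unfolding convolution_eq using L2_norm_averaged_difference_le(2)[OF f i\<gamma> \<gamma>(2)] by (simp add: \<gamma>(3))
  also have "\<dots> \<le> (LBINT y. \<gamma> y * e\<^sup>2)"
  proof (rule integral_mono[OF _ _ weighted_le])
    have [measurable]: "\<gamma> \<in> borel_measurable borel" using i\<gamma> by (auto dest: borel_measurable_integrable)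
    show "integrable lborel (\<lambda>y. \<gamma> y * (L2_modulus f y)\<^sup>2)"
      by (rule Bochner_Integration.integrable_bound[OF integrable_mult_left[OF i\<gamma>, of "e\<^sup>2"]])
         (use weighted_le \<gamma>(2) in auto)
  qed (use i\<gamma> in auto)
  also have "\<dots> = e\<^sup>2" using \<gamma>(3) by simp
  finally show ?thesis using e(1) by (rule power2_le_imp_le)
qed

lemma C1_grad_mollify:
  fixes V :: "'a::euclidean_space \<Rightarrow> real"
  assumes V: "weak_grad V K" "integrable lborel V" and \<gamma>: "C1c UNIV \<gamma> \<gamma>'"
  shows "C1_grad (\<lambda>x. LBINT y. \<gamma> (x - y) * V y) (\<lambda>x. LBINT y. \<gamma> (x - y) *\<^sub>R K y)"
proof -
  obtain M where M: "\<And>x. \<bar>\<gamma> x\<bar> \<le> M" "\<And>x. norm (\<gamma>' x) \<le> M"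
    using C1c_bounded[OF \<gamma>] by metis
  have "(LBINT y. V y *\<^sub>R \<gamma>' (x - y)) = (LBINT y. \<gamma> (x - y) *\<^sub>R K y)" for x
  proof (rule euclidean_eqI)
    fix h :: 'a assume "h \<in> Basis"
    note reflected = C1c_reflect[OF \<gamma>, of x]
    have "integrable lborel (\<lambda>y. V y *\<^sub>R \<gamma>' (x - y))"
      using integrable_scaleR_square_integrable[OF weak_gradD(1)[OF V(1)] C1c_integrable(4)[OF reflected]] by simp
    then have "(LBINT y. V y *\<^sub>R \<gamma>' (x - y)) \<bullet> h = - (LBINT y. V y * ((- \<gamma>' (x - y)) \<bullet> h))"
      by (simp flip: integral_inner_left)
    also have "\<dots> = (LBINT y. (K y \<bullet> h) * \<gamma> (x - y))"
      using weak_gradD(3)[OF V(1) reflected, of h] by simp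
    also have "\<dots> = (LBINT y. \<gamma> (x - y) *\<^sub>R K y) \<bullet> h"
      using integrable_scaleR_square_integrable[OF C1c_integrable(3)[OF reflected] weak_gradD(2)[OF V(1)]]
      by (simp add: mult.commute flip: integral_inner_left)
    finally show "(LBINT y. V y *\<^sub>R \<gamma>' (x - y)) \<bullet> h = (LBINT y. \<gamma> (x - y) *\<^sub>R K y) \<bullet> h" .
  qed
  with C1_grad_convolution[OF V(2) C1c_imp_C1_grad[OF \<gamma>] M] show ?thesis
    by (simp add: mult.commute)
qed

lemma convolution_eq_0:
  fixes V \<gamma> :: "'a::euclidean_space \<Rightarrow> real"
  assumes "\<And>y. y \<notin> S \<Longrightarrow> V y = 0" "\<And>y. y \<notin> T \<Longrightarrow> \<gamma> y = 0" "x \<notin> {y + z | y z. y \<in> S \<and> z \<in> T}"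
  shows "(LBINT y. \<gamma> (x - y) * V y) = 0"
proof -
  have "\<gamma> (x - y) * V y = 0" for y
  proof (cases "y \<in> S")
    case True
    then have "x - y \<notin> T" using assms(3) by (force simp: algebra_simps)
    then show ?thesis using assms(2) by simp
  qed (simp add: assms(1))
  then show ?thesis by (simp only: Bochner_Integration.integral_zero)
qed

lemma shifted_mollifier_exists:
  fixes b :: "'a::euclidean_space"
  assumes "s0 > 0" "d > 0"
  obtains s \<gamma> \<gamma>' where "0 < s" "s < s0" "C1c UNIV \<gamma> \<gamma>'" "\<And>x. 0 \<le> \<gamma> x" "(LBINT x. \<gamma> x) = 1"
    "\<And>x. x \<notin> cball (s *\<^sub>R b) (s / 2) \<Longrightarrow> \<gamma> x = 0" "\<And>x. \<gamma> x \<noteq> 0 \<Longrightarrow> norm x < d"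
proof -
  define s where "s = min (s0 / 2) (d / (2 * (norm b + 1)))"
  have norm_b: "norm b + 1 > 0" by (simp add: add_nonneg_pos)
  then have s: "s > 0" "s < s0" using assms by (auto simp: s_def min_less_iff_disj)
  have "s * (norm b + 1) \<le> d / (2 * (norm b + 1)) * (norm b + 1)"
    using norm_b by (intro mult_right_mono) (auto simp: s_def)
  also have "\<dots> = d / 2" using norm_b by (simp add: field_simps)
  also have "\<dots> < d" using assms by simp
  finally have support_radius: "s * norm b + s < d" by (simp add: algebra_simps)
  obtain \<gamma> \<gamma>' where \<gamma>: "C1c UNIV \<gamma> \<gamma>'" "\<And>x. 0 \<le> \<gamma> x" "(LBINT x. \<gamma> x) = 1"
    and support: "\<And>x. x \<notin> cball (s *\<^sub>R b) (s / 2) \<Longrightarrow> \<gamma> x = 0"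
    using mollifier_exists[of "s / 2" "s *\<^sub>R b"] s(1) by (metis half_gt_zero)
  have "norm x < d" if "\<gamma> x \<noteq> 0" for x
  proof -
    have "norm (x - s *\<^sub>R b) \<le> s / 2" using support[of x] that by (auto simp: dist_norm norm_minus_commute)
    then show ?thesis using norm_triangle_ineq[of "s *\<^sub>R b" "x - s *\<^sub>R b"] s support_radius by simp
  qed
  then show ?thesis using s \<gamma> support by (intro that)
qed

lemma shifted_sums_subset_exterior:
  fixes D :: "'a::euclidean_space set"
  assumes s: "s > 0" and shift: "\<And>x y. x \<in> S \<Longrightarrow> y \<in> cball b 1 \<Longrightarrow> x + s *\<^sub>R y \<notin> D"
  shows "{x + y | x y. x \<in> S \<and> y \<in> cball (s *\<^sub>R b) (s / 2)} \<subseteq> - closure D"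
proof clarify
  fix x y assume x: "x \<in> S" and y: "y \<in> cball (s *\<^sub>R b) (s / 2)" and "x + y \<in> closure D"
  then obtain z where z: "z \<in> D" "dist z (x + y) < s / 2"
    using s unfolding closure_approachable by (metis half_gt_zero)
  define y' where "y' = (1 / s) *\<^sub>R (z - x)"
  have "s * norm (y' - b) = norm (s *\<^sub>R (y' - b))" using s by simp
  also have "s *\<^sub>R (y' - b) = (z - (x + y)) + (y - s *\<^sub>R b)"
    using s by (simp add: y'_def algebra_simps)
  also have "norm \<dots> \<le> s / 2 + s / 2"
    using z(2) y by (intro norm_triangle_le add_mono) (auto simp: dist_norm norm_minus_commute)
  finally have "norm (y' - b) \<le> 1" using s by simp
  then have "x + s *\<^sub>R y' \<notin> D" using x by (intro shift) (auto simp: dist_norm norm_minus_commute)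
  then show False using z(1) s by (simp add: y'_def)
qed

text \<open>The mollifying kernel is supported near \<open>s *\<^sub>R b\<close> instead of the origin: it shifts the support off \<open>D\<close>
  while smoothing.\<close>

lemma H1_0_mollify:
  fixes D :: "'a::euclidean_space set"
  assumes V: "weak_grad V K" and S: "compact S" "\<And>x. x \<notin> S \<Longrightarrow> V x = 0"
    and "s0 > 0" and shift: "\<And>x y s. x \<in> S \<Longrightarrow> y \<in> cball b 1 \<Longrightarrow> 0 < s \<Longrightarrow> s < s0 \<Longrightarrow> x + s *\<^sub>R y \<notin> D"
  shows "H1_0 (- closure D) V K"
  unfolding H1_0_def
proof (intro conjI allI impI)
  note sq = weak_gradD(1,2)[OF V]
  show "square_integrable lborel V" "square_integrable lborel K" by fact+
  have V_integrable: "integrable lborel V"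
    using S by (intro square_integrable_imp_integrable[OF sq(1), of S]) (auto intro: compact_imp_bounded)
  fix e :: real assume e: "e > 0"
  then have "\<forall>\<^sub>F y in at 0. L2_modulus V y < e / 2 \<and> L2_modulus K y < e / 2"
    by (intro eventually_conj order_tendstoD(2)[OF L2_modulus_tendsto_0] sq) auto
  then obtain d where d: "d > 0" "\<And>y. y \<noteq> 0 \<Longrightarrow> norm y < d \<Longrightarrow> L2_modulus V y < e / 2 \<and> L2_modulus K y < e / 2"
    by (auto simp: eventually_at)
  have modulus: "L2_modulus V y \<le> e / 2" "L2_modulus K y \<le> e / 2" if "norm y < d" for y
    using d(2)[OF _ that] e by (cases "y = 0"; force)+
  obtain s \<gamma> \<gamma>' where s: "0 < s" "s < s0" and \<gamma>: "C1c UNIV \<gamma> \<gamma>'" "\<And>x. 0 \<le> \<gamma> x" "(LBINT x. \<gamma> x) = 1"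
    and support: "\<And>x. x \<notin> cball (s *\<^sub>R b) (s / 2) \<Longrightarrow> \<gamma> x = 0" "\<And>x. \<gamma> x \<noteq> 0 \<Longrightarrow> norm x < d"
    using shifted_mollifier_exists[OF \<open>s0 > 0\<close> d(1), of b] by metis
  define \<phi> where "\<phi> x = (LBINT y. \<gamma> (x - y) * V y)" for x
  define \<phi>' where "\<phi>' x = (LBINT y. \<gamma> (x - y) *\<^sub>R K y)" for x
  have "L2_norm lborel (\<lambda>x. \<phi> x - V x) \<le> e / 2" "L2_norm lborel (\<lambda>x. \<phi>' x - K x) \<le> e / 2"
    using L2_norm_convolution_diff_le[OF sq(1) \<gamma>, of "e / 2"] L2_norm_convolution_diff_le[OF sq(2) \<gamma>, of "e / 2"]
      modulus support(2) e by (simp_all add: \<phi>_def \<phi>'_def)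
  then have "L2_norm lborel (\<lambda>x. V x - \<phi> x) < e" "L2_norm lborel (\<lambda>x. K x - \<phi>' x) < e"
    using e L2_norm_minus_commute[of lborel V \<phi>] L2_norm_minus_commute[of lborel K \<phi>'] by simp_all
  moreover have "C1c (- closure D) \<phi> \<phi>'"
  proof (rule C1cI[OF _ compact_sums[OF S(1) compact_cball]])
    show "{x + y | x y. x \<in> S \<and> y \<in> cball (s *\<^sub>R b) (s / 2)} \<subseteq> - closure D"
      using s by (intro shifted_sums_subset_exterior shift)
    show "C1_grad \<phi> \<phi>'"
      unfolding \<phi>_def[abs_def] \<phi>'_def[abs_def] by (rule C1_grad_mollify[OF V V_integrable \<gamma>(1)])
    show "\<phi> x = 0" if "x \<notin> {x + y | x y. x \<in> S \<and> y \<in> cball (s *\<^sub>R b) (s / 2)}" for x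
      unfolding \<phi>_def using S(2) support(1) that by (rule convolution_eq_0)
  qed
  ultimately show "\<exists>\<phi> \<phi>'. C1c (- closure D) \<phi> \<phi>' \<and>
      L2_norm lborel (\<lambda>x. V x - \<phi> x) < e \<and> L2_norm lborel (\<lambda>x. K x - \<phi>' x) < e"
    by blast
qed

lemma weak_grad_compact_support_H1_0:
  fixes D :: "'a::euclidean_space set"
  assumes V: "weak_grad V K" and S: "compact S" "\<And>x. x \<notin> S \<Longrightarrow> V x = 0" "S \<inter> closure D = {}"
  shows "H1_0 (- closure D) V K"
proof -
  obtain d where d: "d > 0" "\<And>x y. x \<in> S \<Longrightarrow> y \<in> closure D \<Longrightarrow> d \<le> dist x y"
    using separate_compact_closed[OF S(1) closed_closure S(3)] by metis
  show ?thesis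
  proof (rule H1_0_mollify[OF V S(1,2) d(1), of 0])
    fix x y :: 'a and s assume x: "x \<in> S" and y: "y \<in> cball 0 1" and s: "0 < s" "s < d"
    show "x + s *\<^sub>R y \<notin> D"
    proof
      assume "x + s *\<^sub>R y \<in> D"
      then have "d \<le> dist x (x + s *\<^sub>R y)" using d(2) x closure_subset by blast
      also have "\<dots> = s * norm y" using s by (simp add: dist_norm)
      also have "\<dots> \<le> s * 1" using s y by (intro mult_left_mono) auto
      finally show False using s by simp
    qed
  qed
qed

subsection \<open>The exterior cone condition\<close>

definition exterior_cone :: "'a::euclidean_space set \<Rightarrow> 'a \<Rightarrow> real \<Rightarrow> bool" where
  "exterior_cone D p r \<longleftrightarrow>
     (\<exists>b. \<exists>s0>0. \<forall>x\<in>cball p r - D. \<forall>y\<in>cball b 1. \<forall>s. 0 < s \<longrightarrow> s < s0 \<longrightarrow> x + s *\<^sub>R y \<notin> D)"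

lemma C2_fun_lipschitz_on_cball:
  assumes "C2_fun \<psi>"
  obtains B where "0 \<le> B" "\<And>y z. y \<in> cball 0 r \<Longrightarrow> z \<in> cball 0 r \<Longrightarrow> \<bar>\<psi> y - \<psi> z\<bar> \<le> B * norm (y - z)"
proof -
  obtain \<psi>' \<psi>'' where d1: "\<And>z. (\<psi> has_derivative blinfun_apply (\<psi>' z)) (at z)"
    and d2: "\<And>z. (\<psi>' has_derivative blinfun_apply (\<psi>'' z)) (at z)"
    using assms unfolding C2_fun_def by blast
  have "continuous_on (cball 0 r) \<psi>'"
    using d2 by (auto intro!: continuous_at_imp_continuous_on has_derivative_continuous)
  then have "bounded (\<psi>' ` cball 0 r)"
    by (intro compact_imp_bounded compact_continuous_image) auto
  then obtain B where B: "\<And>z. z \<in> cball 0 r \<Longrightarrow> norm (\<psi>' z) \<le> B"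
    unfolding bounded_iff by blast
  have lipschitz: "\<bar>\<psi> y - \<psi> z\<bar> \<le> \<bar>B\<bar> * norm (y - z)" if "y \<in> cball 0 r" "z \<in> cball 0 r" for y z
  proof -
    have "norm (\<psi> y - \<psi> z) \<le> \<bar>B\<bar> * norm (y - z)"
      using that d1 order_trans[OF B abs_ge_self]
      by (intro differentiable_bound[of "cball 0 r" \<psi> "\<lambda>z. blinfun_apply (\<psi>' z)"])
         (auto intro: has_derivative_at_withinI simp: norm_blinfun.rep_eq[symmetric])
    then show ?thesis by simp
  qed
  show ?thesis by (rule that[OF abs_ge_zero lipschitz])
qed

lemma lipschitz_supergraph_add:
  fixes \<psi> :: "'b::real_normed_vector \<Rightarrow> real" and P :: "real^3 \<Rightarrow> 'b"
  assumes lipschitz: "\<And>y z. y \<in> cball 0 r \<Longrightarrow> z \<in> cball 0 r \<Longrightarrow> \<bar>\<psi> y - \<psi> z\<bar> \<le> B * norm (y - z)" and "0 \<le> B"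
    and P: "linear P" "\<And>w. norm (P w) \<le> norm w"
    and v: "\<psi> (P v) \<le> v $ 3" and "0 \<le> s" and w: "norm (P w) \<le> 1" "B \<le> w $ 3"
    and small: "norm v \<le> r" "norm (v + s *\<^sub>R w) \<le> r"
  shows "\<psi> (P (v + s *\<^sub>R w)) \<le> (v + s *\<^sub>R w) $ 3"
proof -
  have "\<psi> (P (v + s *\<^sub>R w)) \<le> \<psi> (P v) + B * norm (P (v + s *\<^sub>R w) - P v)"
    using lipschitz[of "P (v + s *\<^sub>R w)" "P v"] P(2)[of v] P(2)[of "v + s *\<^sub>R w"] small by simp
  also have "B * norm (P (v + s *\<^sub>R w) - P v) = s * (B * norm (P w))"
    using P(1) \<open>0 \<le> s\<close> by (simp add: linear_add linear_cmul)
  also have "\<dots> \<le> s * (B * 1)"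
    using \<open>0 \<le> s\<close> \<open>0 \<le> B\<close> w(1) by (intro mult_left_mono) auto
  also have "\<dots> \<le> s * w $ 3"
    using \<open>0 \<le> s\<close> w(2) by (intro mult_left_mono) auto
  finally show ?thesis using v by simp
qed

lemma norm_add_scaleR_less:
  fixes x y :: "'a::real_normed_vector"
  assumes "norm x \<le> r / 2" "norm y \<le> c" "0 < s" "s < r / (2 * c)" "0 < c"
  shows "norm (x + s *\<^sub>R y) < r"
proof -
  have "norm (s *\<^sub>R y) \<le> s * c" using assms by (simp add: mult_left_mono)
  also have "\<dots> < r / 2" using assms by (simp add: field_simps)
  finally show ?thesis using norm_triangle_ineq[of x "s *\<^sub>R y"] assms(1) by simp
qed

lemma C2_boundary_exterior_cone:
  assumes "C2_boundary D" "p \<in> frontier D"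
  obtains r where "r > 0" "exterior_cone D p r"
proof -
  obtain r and R :: "real^3 \<Rightarrow> real^3" and \<psi> :: "real^2 \<Rightarrow> real"
    where r: "r > 0" and R: "orthogonal_transformation R" and \<psi>: "C2_fun \<psi>"
    and graph: "\<And>x. x \<in> ball p r \<Longrightarrow> x \<in> D \<longleftrightarrow> (R (x - p)) $ 3 < \<psi> (vector [(R (x - p)) $ 1, (R (x - p)) $ 2])"
    using assms unfolding C2_boundary_def by blast
  define P :: "real^3 \<Rightarrow> real^2" where "P w = vector [w $ 1, w $ 2]" for w
  have P: "linear P" "norm (P w) \<le> norm w" for w
    by (auto simp: P_def vec_eq_iff forall_2 norm_eq_sqrt_inner inner_vec_def sum_2 sum_3 intro!: linearI)
  have linear_R: "linear R" and norm_R: "norm (R w) = norm w" for w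
    using R by (auto simp: orthogonal_transformation_linear orthogonal_transformation_norm)
  obtain B where B: "0 \<le> B" "\<And>y z. y \<in> cball 0 r \<Longrightarrow> z \<in> cball 0 r \<Longrightarrow> \<bar>\<psi> y - \<psi> z\<bar> \<le> B * norm (y - z)"
    using C2_fun_lipschitz_on_cball[OF \<psi>] by metis
  obtain b where Rb: "R b = (B + 1) *\<^sub>R axis 3 1"
    using orthogonal_transformation_surj[OF R] by (metis surjD)
  define s0 where "s0 = r / (2 * (norm b + 1))"
  have norm_b: "norm b + 1 > 0" by (simp add: add_nonneg_pos)
  have "x + s *\<^sub>R y \<notin> D"
    if x: "x \<in> cball p (r / 2)" "x \<notin> D" and y: "y \<in> cball b 1" and s: "0 < s" "s < s0" for x y s
  proof -
    define v where "v = R (x - p)"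
    define w where "w = R y"
    have coordinates: "R (x + s *\<^sub>R y - p) = v + s *\<^sub>R w"
      using linear_R by (simp add: v_def w_def linear_diff linear_add linear_cmul algebra_simps)
    have x_near: "norm (x - p) \<le> r / 2" using x by (simp add: dist_norm norm_minus_commute)
    have "norm y \<le> norm b + 1"
      using y norm_triangle_ineq[of b "y - b"] by (simp add: dist_norm norm_minus_commute)
    then have shifted_near: "norm (x + s *\<^sub>R y - p) < r"
      using norm_add_scaleR_less[OF x_near _ s(1) _ norm_b] s(2) by (simp add: s0_def algebra_simps)
    have "norm (w - R b) \<le> 1"
      using y norm_R[of "y - b"] linear_R by (simp add: w_def linear_diff dist_norm norm_minus_commute)
    moreover have "P (R b) = 0" by (simp add: Rb P_def axis_def vec_eq_iff forall_2)
    ultimately have w: "norm (P w) \<le> 1" "B \<le> w $ 3"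
      using P(2)[of "w - R b"] P(1) component_le_norm_cart[of "w - R b" 3] by (auto simp: linear_diff Rb)
    have "\<psi> (P v) \<le> v $ 3"
      using graph[of x] x x_near r by (auto simp: v_def P_def dist_norm norm_minus_commute)
    then have "\<psi> (P (v + s *\<^sub>R w)) \<le> (v + s *\<^sub>R w) $ 3"
      using x_near shifted_near r s w norm_R[of "x - p"] norm_R[of "x + s *\<^sub>R y - p"]
      by (intro lipschitz_supergraph_add[OF B(2,1) P]) (auto simp: coordinates v_def)
    then show ?thesis
      using graph[of "x + s *\<^sub>R y"] shifted_near by (simp add: coordinates P_def dist_norm norm_minus_commute)
  qed
  moreover have "s0 > 0" using r norm_b by (simp add: s0_def)
  ultimately have "exterior_cone D p (r / 2)"
    unfolding exterior_cone_def by blast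
  then show ?thesis using r that[of "r / 2"] by simp
qed

text \<open>Induction on the number of balls: the bump function at \<open>p\<close> splits off a part that can be shifted along the cone
  at \<open>p\<close>.\<close>

lemma H1_0_of_finite_cover:
  fixes D :: "'a::euclidean_space set"
  assumes "finite P" and D: "open D"
    and "\<And>p. p \<in> P \<Longrightarrow> r p > 0 \<and> exterior_cone D p (2 * r p)"
    and "frontier D \<subseteq> Z \<union> (\<Union>p\<in>P. ball p (r p))" and "open Z"
    and "weak_grad V K" "\<And>x. x \<in> closure D \<union> Z \<Longrightarrow> V x = 0" "\<And>x. x \<notin> cball 0 \<rho> \<Longrightarrow> V x = 0"
  shows "H1_0 (- closure D) V K"
  using assms
proof (induction P arbitrary: Z V K rule: finite_induct)
  case empty
  show ?case
  proof (rule weak_grad_compact_support_H1_0[OF empty.prems(5)])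
    show "compact (cball 0 \<rho> - (D \<union> Z))"
      using D empty.prems(4) by (intro compact_diff) auto
    show "(cball 0 \<rho> - (D \<union> Z)) \<inter> closure D = {}"
      using empty.prems(3) closure_Un_frontier[of D] by auto
    show "V x = 0" if "x \<notin> cball 0 \<rho> - (D \<union> Z)" for x
      using that empty.prems(6,7)[of x] closure_subset[of D] by auto
  qed
next
  case (insert p P)
  note V = insert.prems(5-7)
  have radius_pos: "r p > 0" and "exterior_cone D p (2 * r p)" using insert.prems(2) by auto
  then obtain b s0 where s0: "s0 > 0"
    and cone: "\<forall>x\<in>cball p (2 * r p) - D. \<forall>y\<in>cball b 1. \<forall>s. 0 < s \<longrightarrow> s < s0 \<longrightarrow> x + s *\<^sub>R y \<notin> D"
    unfolding exterior_cone_def by blast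
  let ?z = "bump p (r p)" and ?z' = "bump_grad p (r p)"
  have "H1_0 (- closure D) (\<lambda>x. ?z x * V x) (\<lambda>x. ?z x *\<^sub>R K x + V x *\<^sub>R ?z' x)"
  proof (rule H1_0_mollify[OF weak_grad_bump[OF V(1) radius_pos, of p] _ _ s0])
    show "compact (cball p (2 * r p) - D)" using D by (intro compact_diff) auto
    show "?z x * V x = 0" if "x \<notin> cball p (2 * r p) - D" for x
      using that V(2)[of x] closure_subset[of D] bump_eq_0[OF radius_pos, of x p]
      by (auto simp: dist_norm norm_minus_commute)
  qed (use cone in blast)
  moreover have "H1_0 (- closure D) (\<lambda>x. (1 - ?z x) * V x) (\<lambda>x. (1 - ?z x) *\<^sub>R K x + V x *\<^sub>R (0 - ?z' x))"
  proof (rule insert.IH[OF D _ _ _ weak_grad_bump_compl[OF V(1) radius_pos, of p], of "Z \<union> ball p (r p)"])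
    show "(1 - ?z x) * V x = 0" if "x \<in> closure D \<union> (Z \<union> ball p (r p))" for x
      using that V(2)[of x] bump_eq_1[OF radius_pos, of x p] by (auto simp: dist_norm norm_minus_commute)
  qed (use insert.prems in auto)
  ultimately have "H1_0 (- closure D) (\<lambda>x. ?z x * V x + (1 - ?z x) * V x)
      (\<lambda>x. (?z x *\<^sub>R K x + V x *\<^sub>R ?z' x) + ((1 - ?z x) *\<^sub>R K x + V x *\<^sub>R (0 - ?z' x)))"
    by (rule H1_0_add)
  then show ?case
    by (simp add: algebra_simps)
qed

lemma
  fixes x :: "'a::euclidean_space"
  shows bump_exhaustion_tendsto: "(\<lambda>n. bump 0 (real (Suc n)) x) \<longlonglongrightarrow> 1"
    and bump_grad_exhaustion_tendsto: "(\<lambda>n. bump_grad 0 (real (Suc n)) x) \<longlonglongrightarrow> 0"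
proof -
  obtain N where N: "norm x \<le> real N" using real_arch_simple by blast
  have "\<forall>\<^sub>F n in sequentially. bump 0 (real (Suc n)) x = 1"
    using eventually_ge_at_top[of N] by eventually_elim (use N in \<open>auto intro!: bump_eq_1\<close>)
  then show "(\<lambda>n. bump 0 (real (Suc n)) x) \<longlonglongrightarrow> 1" by (rule tendsto_eventually)
  show "(\<lambda>n. bump_grad 0 (real (Suc n)) x) \<longlonglongrightarrow> 0"
  proof (rule Lim_null_comparison)
    show "\<forall>\<^sub>F n in sequentially. norm (bump_grad 0 (real (Suc n)) x) \<le> 16 / real (Suc n)"
      by (intro always_eventually allI norm_bump_grad_le) simp
    show "(\<lambda>n. 16 / real (Suc n)) \<longlonglongrightarrow> 0" by real_asymp
  qed
qed

lemma norm_truncated_gradient_diff_le: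
  fixes h g :: "'a::real_normed_vector" and w z :: real
  assumes "0 \<le> z" "z \<le> 1" "norm g \<le> c"
  shows "norm (h - (z *\<^sub>R h + w *\<^sub>R g)) \<le> norm h + c * \<bar>w\<bar>"
proof -
  have "norm (h - (z *\<^sub>R h + w *\<^sub>R g)) = norm ((1 - z) *\<^sub>R h - w *\<^sub>R g)"
    by (simp add: algebra_simps)
  also have "\<dots> \<le> (1 - z) * norm h + \<bar>w\<bar> * norm g"
    using assms(2) by (intro order_trans[OF norm_triangle_ineq4]) simp
  also have "\<dots> \<le> 1 * norm h + \<bar>w\<bar> * c"
    using assms by (intro add_mono mult_mono) auto
  finally show ?thesis by (simp add: mult.commute)
qed

lemma weak_grad_truncate_approx:
  fixes W :: "'a::euclidean_space \<Rightarrow> real"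
  assumes W: "weak_grad W H" and e: "e > 0"
  obtains R where "R > 0" "L2_norm lborel (\<lambda>x. W x - bump 0 R x * W x) < e"
    "L2_norm lborel (\<lambda>x. H x - (bump 0 R x *\<^sub>R H x + W x *\<^sub>R bump_grad 0 R x)) < e"
proof -
  note sq = weak_gradD(1,2)[OF W]
  define z where "z n = bump (0::'a) (real (Suc n))" for n
  define z' where "z' n = bump_grad (0::'a) (real (Suc n))" for n
  have z: "C1_grad (z n) (z' n)" for n unfolding z_def z'_def by (rule C1_grad_bump) simp
  note [measurable] = C1_grad_measurable[OF z] square_integrable_measurable[OF sq(1)] square_integrable_measurable[OF sq(2)]
  have z01: "0 \<le> z n x" "z n x \<le> 1" for n x by (auto simp: z_def bump_bounds)
  have z'_le: "norm (z' n x) \<le> 16" for n x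
  proof -
    have "norm (z' n x) \<le> 16 / real (Suc n)" unfolding z'_def by (rule norm_bump_grad_le) simp
    also have "\<dots> \<le> 16" by (simp add: field_simps)
    finally show ?thesis .
  qed
  have z_lim: "(\<lambda>n. z n x) \<longlonglongrightarrow> 1" "(\<lambda>n. z' n x) \<longlonglongrightarrow> 0" for x
    unfolding z_def z'_def by (rule bump_exhaustion_tendsto bump_grad_exhaustion_tendsto)+
  have lim_W: "(\<lambda>n. L2_norm lborel (\<lambda>x. W x - z n x * W x)) \<longlonglongrightarrow> 0"
  proof (rule L2_norm_tendsto_0_dominated[OF _ sq(1)])
    show "AE x in lborel. (\<lambda>n. W x - z n x * W x) \<longlonglongrightarrow> 0"
      by (auto intro!: tendsto_eq_intros z_lim)
    fix n x
    have "norm ((1 - z n x) * W x) \<le> 1 * norm (W x)"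
      using z01[of n x] unfolding norm_mult by (intro mult_right_mono) auto
    then show "norm (W x - z n x * W x) \<le> norm (W x)" by (simp add: algebra_simps)
  qed measurable
  have lim_H: "(\<lambda>n. L2_norm lborel (\<lambda>x. H x - (z n x *\<^sub>R H x + W x *\<^sub>R z' n x))) \<longlonglongrightarrow> 0"
  proof (rule L2_norm_tendsto_0_dominated)
    show "square_integrable lborel (\<lambda>x. norm (H x) + 16 * norm (W x))"
      using square_integrable_add[OF square_integrable_norm[OF sq(2)] square_integrable_cmult[OF square_integrable_norm[OF sq(1)], of 16]]
      by simp
    show "AE x in lborel. (\<lambda>n. H x - (z n x *\<^sub>R H x + W x *\<^sub>R z' n x)) \<longlonglongrightarrow> 0"
      by (auto intro!: tendsto_eq_intros z_lim)
    show "norm (H x - (z n x *\<^sub>R H x + W x *\<^sub>R z' n x)) \<le> norm (norm (H x) + 16 * norm (W x))" for n x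
      using norm_truncated_gradient_diff_le[OF z01 z'_le] by simp
  qed measurable
  have "\<forall>\<^sub>F n in sequentially. L2_norm lborel (\<lambda>x. W x - z n x * W x) < e \<and>
      L2_norm lborel (\<lambda>x. H x - (z n x *\<^sub>R H x + W x *\<^sub>R z' n x)) < e"
    using e by (intro eventually_conj order_tendstoD(2)[OF lim_W] order_tendstoD(2)[OF lim_H])
  then obtain n where "L2_norm lborel (\<lambda>x. W x - z n x * W x) < e"
      "L2_norm lborel (\<lambda>x. H x - (z n x *\<^sub>R H x + W x *\<^sub>R z' n x)) < e"
    by (auto simp: eventually_sequentially)
  then show ?thesis
    by (intro that[of "real (Suc n)"]) (simp_all add: z_def z'_def)
qed

lemma weak_grad_H1_0:
  fixes D :: "'a::euclidean_space set"
  assumes D: "open D" "bounded D" and cone: "\<And>p. p \<in> frontier D \<Longrightarrow> \<exists>r>0. exterior_cone D p r"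
    and W: "weak_grad W H" "\<And>x. x \<in> closure D \<Longrightarrow> W x = 0"
  shows "H1_0 (- closure D) W H"
proof (rule H1_0_closed[OF weak_gradD(1,2)[OF W(1)]])
  obtain r where r: "\<And>p. p \<in> frontier D \<Longrightarrow> r p > 0 \<and> exterior_cone D p (r p)"
    using cone by metis
  obtain P where P: "P \<subseteq> frontier D" "finite P" "frontier D \<subseteq> (\<Union>p\<in>P. ball p (r p / 2))"
  proof (rule compactE_image[OF compact_frontier_bounded[OF D(2)]])
    show "frontier D \<subseteq> (\<Union>p\<in>frontier D. ball p (r p / 2))" using r by force
  qed (use that in auto)
  fix e :: real assume "e > 0"
  then obtain R where R: "R > 0" and approx: "L2_norm lborel (\<lambda>x. W x - bump 0 R x * W x) < e"
    "L2_norm lborel (\<lambda>x. H x - (bump 0 R x *\<^sub>R H x + W x *\<^sub>R bump_grad 0 R x)) < e"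
    by (rule weak_grad_truncate_approx[OF W(1)])
  have "H1_0 (- closure D) (\<lambda>x. bump 0 R x * W x) (\<lambda>x. bump 0 R x *\<^sub>R H x + W x *\<^sub>R bump_grad 0 R x)"
  proof (rule H1_0_of_finite_cover[OF P(2) D(1) _ _ _ weak_grad_bump[OF W(1) R, of 0], of "\<lambda>p. r p / 2" "{}" "2 * R"])
    show "bump 0 R x * W x = 0" if "x \<notin> cball 0 (2 * R)" for x
      using that bump_eq_0[OF R, of x 0] by simp
  qed (use P r W(2) in auto)
  then show "\<exists>V K. H1_0 (- closure D) V K \<and> L2_norm lborel (\<lambda>x. W x - V x) < e \<and> L2_norm lborel (\<lambda>x. H x - K x) < e"
    using approx by blast
qed

section \<open>The weak maximum principle\<close>

definition energy_form ::
  "real \<Rightarrow> ('a::euclidean_space \<Rightarrow> real) \<Rightarrow> ('a \<Rightarrow> 'a) \<Rightarrow> ('a \<Rightarrow> real) \<Rightarrow> ('a \<Rightarrow> 'a) \<Rightarrow> real" where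
  "energy_form k q q' \<phi> \<phi>' = (LBINT x. q' x \<bullet> \<phi>' x + k\<^sup>2 * q x * \<phi> x)"

lemma integrable_energy_density_L2:
  assumes "square_integrable lborel W" "square_integrable lborel H" and \<phi>: "C1c U \<phi> \<phi>'"
  shows "integrable lborel (\<lambda>x. H x \<bullet> \<phi>' x + k\<^sup>2 * W x * \<phi> x)"
  using integrable_inner_square_integrable[OF assms(2) C1c_integrable(4)[OF \<phi>]]
    integrable_mult_square_integrable[OF assms(1) C1c_integrable(3)[OF \<phi>]]
  by (simp add: mult.assoc)

lemma integrable_energy_density_C1:
  assumes q: "C1_grad q q'" and \<phi>: "C1c U \<phi> \<phi>'"
  shows "integrable lborel (\<lambda>x. q' x \<bullet> \<phi>' x + k\<^sup>2 * q x * \<phi> x)"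
  using integrable_continuous_mult_C1c[OF C1_grad_cont[OF q] \<phi>] by (simp add: mult.assoc)

lemma energy_form_cmult:
  "energy_form k (\<lambda>x. c * q x) (\<lambda>x. c *\<^sub>R q' x) \<phi> \<phi>' = c * energy_form k q q' \<phi> \<phi>'"
  by (simp add: energy_form_def algebra_simps flip: integral_mult_right_zero)

lemma energy_form_add:
  assumes "C1_grad q q'" "C1_grad r r'" "C1c U \<phi> \<phi>'"
  shows "energy_form k (\<lambda>x. q x + r x) (\<lambda>x. q' x + r' x) \<phi> \<phi>'
    = energy_form k q q' \<phi> \<phi>' + energy_form k r r' \<phi> \<phi>'"
  unfolding energy_form_def
  using integrable_energy_density_C1[OF assms(1,3), of k] integrable_energy_density_C1[OF assms(2,3), of k]
  by (subst Bochner_Integration.integral_add[symmetric]) (auto simp: inner_add_left algebra_simps)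

lemma energy_form_sum:
  assumes "\<And>i. i \<in> I \<Longrightarrow> C1_grad (q i) (q' i)" "C1c U \<phi> \<phi>'"
  shows "energy_form k (\<lambda>x. \<Sum>i\<in>I. q i x) (\<lambda>x. \<Sum>i\<in>I. q' i x) \<phi> \<phi>' = (\<Sum>i\<in>I. energy_form k (q i) (q' i) \<phi> \<phi>')"
  using assms
proof (induction I rule: infinite_finite_induct)
  case (insert i I)
  then show ?case using energy_form_add[of "q i" "q' i" "\<lambda>x. \<Sum>i\<in>I. q i x" "\<lambda>x. \<Sum>i\<in>I. q' i x" U \<phi> \<phi>' k]
    by (simp add: C1_grad_sum)
qed (simp_all add: energy_form_def)

lemma energy_form_change_mass:
  assumes q: "C1_grad q q'" and \<phi>: "C1c U \<phi> \<phi>'"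
  shows "energy_form k q q' \<phi> \<phi>' = energy_form \<kappa> q q' \<phi> \<phi>' - (\<kappa>\<^sup>2 - k\<^sup>2) * (LBINT x. q x * \<phi> x)"
proof -
  note integrable = integrable_continuous_mult_C1c[OF C1_grad_cont[OF q] \<phi>]
  have "energy_form k q q' \<phi> \<phi>' = (LBINT x. q' x \<bullet> \<phi>' x) + k\<^sup>2 * (LBINT x. q x * \<phi> x)" for k
    using integrable by (simp add: energy_form_def mult.assoc)
  then show ?thesis by (simp add: algebra_simps)
qed

definition dirichlet_solution ::
  "'a::euclidean_space set \<Rightarrow> real \<Rightarrow> ('a \<Rightarrow> real) \<Rightarrow> ('a \<Rightarrow> 'a) \<Rightarrow> ('a \<Rightarrow> real) \<Rightarrow> bool" where
  "dirichlet_solution U k W H P \<longleftrightarrow> H1_0 U W H \<and>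
     (\<forall>\<phi> \<phi>'. C1c U \<phi> \<phi>' \<longrightarrow> energy_form k W H \<phi> \<phi>' = (LBINT x. P x * \<phi> x))"

definition supersolution ::
  "'a::euclidean_space set \<Rightarrow> real \<Rightarrow> ('a \<Rightarrow> real) \<Rightarrow> ('a \<Rightarrow> 'a) \<Rightarrow> ('a \<Rightarrow> real) \<Rightarrow> bool" where
  "supersolution U k q q' Q \<longleftrightarrow> C1_grad q q' \<and>
     (\<forall>\<phi> \<phi>'. C1c U \<phi> \<phi>' \<longrightarrow> (\<forall>x. 0 \<le> \<phi> x) \<longrightarrow> (LBINT x. Q x * \<phi> x) \<le> energy_form k q q' \<phi> \<phi>')"

lemma supersolutionD:
  assumes "supersolution U k q q' Q"
  shows "C1_grad q q'"
    and "C1c U \<phi> \<phi>' \<Longrightarrow> (\<And>x. 0 \<le> \<phi> x) \<Longrightarrow> (LBINT x. Q x * \<phi> x) \<le> energy_form k q q' \<phi> \<phi>'"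
  using assms unfolding supersolution_def by blast+

lemma supersolution_add:
  assumes q: "supersolution U k q q' Q" and g: "supersolution U k g g' (\<lambda>x. 0)"
  shows "supersolution U k (\<lambda>x. q x + g x) (\<lambda>x. q' x + g' x) Q"
  unfolding supersolution_def
proof (intro conjI allI impI)
  show "C1_grad (\<lambda>x. q x + g x) (\<lambda>x. q' x + g' x)"
    by (rule C1_grad_add[OF supersolutionD(1)[OF q] supersolutionD(1)[OF g]])
  fix \<phi> \<phi>' assume \<phi>: "C1c U \<phi> \<phi>'" "\<forall>x. 0 \<le> \<phi> x"
  then show "(LBINT x. Q x * \<phi> x) \<le> energy_form k (\<lambda>x. q x + g x) (\<lambda>x. q' x + g' x) \<phi> \<phi>'"
    using supersolutionD(2)[OF q \<phi>(1)] supersolutionD(2)[OF g \<phi>(1)]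
    by (simp add: energy_form_add[OF supersolutionD(1)[OF q] supersolutionD(1)[OF g] \<phi>(1)])
qed

lemma dirichlet_solution_cmult:
  assumes "dirichlet_solution U k W H P"
  shows "dirichlet_solution U k (\<lambda>x. c * W x) (\<lambda>x. c *\<^sub>R H x) (\<lambda>x. c * P x)"
  unfolding dirichlet_solution_def
proof (intro conjI allI impI)
  show "energy_form k (\<lambda>x. c * W x) (\<lambda>x. c *\<^sub>R H x) \<phi> \<phi>' = (LBINT x. c * P x * \<phi> x)" if "C1c U \<phi> \<phi>'" for \<phi> \<phi>'
    using assms that by (simp add: dirichlet_solution_def energy_form_cmult mult.assoc)
  have W: "H1_0 U W H" using assms by (simp add: dirichlet_solution_def)
  then have sq: "square_integrable lborel W" "square_integrable lborel H" by (auto simp: H1_0_def)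
  show "H1_0 U (\<lambda>x. c * W x) (\<lambda>x. c *\<^sub>R H x)"
    unfolding H1_0_def
  proof (intro conjI allI impI)
    show "square_integrable lborel (\<lambda>x. c * W x)" "square_integrable lborel (\<lambda>x. c *\<^sub>R H x)"
      using square_integrable_cmult[OF sq(1), of c] square_integrable_cmult[OF sq(2), of c] by simp_all
    fix e :: real assume e: "e > 0"
    have c: "\<bar>c\<bar> + 1 > 0" by simp
    obtain \<phi> \<phi>' where \<phi>: "C1c U \<phi> \<phi>'" "L2_norm lborel (\<lambda>x. W x - \<phi> x) < e / (\<bar>c\<bar> + 1)" "L2_norm lborel (\<lambda>x. H x - \<phi>' x) < e / (\<bar>c\<bar> + 1)"
      by (rule H1_0_approx[OF W divide_pos_pos[OF e c]])
    have scale: "\<bar>c\<bar> * N < e" if "N < e / (\<bar>c\<bar> + 1)" "0 \<le> N" for N :: real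
      using that c by (simp add: pos_less_divide_eq algebra_simps)
    have "C1c U (\<lambda>x. c * \<phi> x) (\<lambda>x. c *\<^sub>R \<phi>' x)"
      using C1c_mult[OF \<phi>(1) C1_grad_const[of c]] by (simp add: mult.commute)
    moreover have "L2_norm lborel (\<lambda>x. c * W x - c * \<phi> x) < e" "L2_norm lborel (\<lambda>x. c *\<^sub>R H x - c *\<^sub>R \<phi>' x) < e"
      using scale[OF \<phi>(2)] scale[OF \<phi>(3)] L2_norm_cmult[of lborel c "\<lambda>x. W x - \<phi> x"] L2_norm_cmult[of lborel c "\<lambda>x. H x - \<phi>' x"]
      by (simp_all add: right_diff_distrib scaleR_diff_right)
    ultimately show "\<exists>\<phi> \<phi>'. C1c U \<phi> \<phi>' \<and> L2_norm lborel (\<lambda>x. c * W x - \<phi> x) < e \<and> L2_norm lborel (\<lambda>x. c *\<^sub>R H x - \<phi>' x) < e"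
      by blast
  qed
qed

definition huber :: "real \<Rightarrow> real \<Rightarrow> real" where
  "huber a t = (pos_sq t - pos_sq (t - a)) / (2 * a)"

definition huber_deriv :: "real \<Rightarrow> real \<Rightarrow> real" where
  "huber_deriv a t = (max 0 t - max 0 (t - a)) / a"

lemma C1_grad_huber:
  assumes "a > 0" shows "C1_grad (huber a) (huber_deriv a)"
proof -
  from C1_grad_cmult[OF C1_grad_diff[OF C1_grad_pos_sq C1_grad_shift[OF C1_grad_pos_sq, of a]], of "1 / (2 * a)"]
  show ?thesis using assms by (simp add: huber_def[abs_def] huber_deriv_def[abs_def] diff_divide_distrib)
qed

lemma huber_nonpos: "a > 0 \<Longrightarrow> t \<le> 0 \<Longrightarrow> huber a t = 0"
  by (simp add: huber_def pos_sq_def)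

lemma
  assumes a: "a > 0"
  shows huber_nonneg: "0 \<le> huber a t" and le_add_huber: "t \<le> a + huber a t"
    and huber_power2_le: "(huber a t)\<^sup>2 \<le> t * huber a t"
    and huber_deriv_bounds: "0 \<le> huber_deriv a t" "huber_deriv a t \<le> 1"
proof -
  show "0 \<le> huber_deriv a t" "huber_deriv a t \<le> 1"
    using a by (auto simp: huber_deriv_def max_def)
  have "0 \<le> huber a t \<and> t \<le> a + huber a t \<and> (0 \<le> t \<longrightarrow> huber a t \<le> t)"
  proof -
    consider (neg) "t \<le> 0" | (mid) "0 \<le> t" "t \<le> a" | (large) "a \<le> t" by linarith
    then show ?thesis
    proof cases
      case mid
      then have "huber a t = t\<^sup>2 / (2 * a)" by (simp add: huber_def pos_sq_def max_def)
      moreover have "t\<^sup>2 / (2 * a) \<le> t"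
        using mid a mult_left_mono[of t "2 * a" t] by (simp add: pos_divide_le_eq power2_eq_square)
      ultimately show ?thesis using mid a by (simp add: add_increasing2)
    next
      case large
      then have "huber a t = t - a / 2"
        using a by (simp add: huber_def pos_sq_def max_def power2_eq_square field_simps)
      then show ?thesis using large a by simp
    qed (use a in \<open>simp add: huber_nonpos\<close>)
  qed
  then show "0 \<le> huber a t" "t \<le> a + huber a t" "(huber a t)\<^sup>2 \<le> t * huber a t"
    using huber_nonpos[OF a, of t] by (auto simp: power2_eq_square intro: mult_right_mono)
qed

lemma comparison_pointwise:
  fixes H G w' :: "'a::real_inner" and W q w P Q \<phi> t a \<tau> :: real
  assumes "\<tau> > 0" "0 \<le> a" "0 \<le> t" "t \<le> 1" "0 \<le> \<phi>" "\<phi>\<^sup>2 \<le> (w - q - a) * \<phi>"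
  shows "\<tau>\<^sup>2 / 4 * \<phi>\<^sup>2 + ((P - Q) * \<phi> - (H - G) \<bullet> (t *\<^sub>R (w' - G)) - \<tau>\<^sup>2 * (W - q) * \<phi>)
    \<le> (P - Q)\<^sup>2 / \<tau>\<^sup>2 + (norm (H - w'))\<^sup>2 / 4 + \<tau>\<^sup>2 / 2 * (W - w)\<^sup>2"
proof -
  define X where "X = w' - G"
  define Y where "Y = H - w'"
  have "0 \<le> (norm (X + (1/2) *\<^sub>R Y))\<^sup>2" by simp
  also have "\<dots> = (X + Y) \<bullet> X + (norm Y)\<^sup>2 / 4"
    unfolding power2_norm_eq_inner by (simp add: inner_add_left inner_add_right inner_commute algebra_simps)
  finally have "- ((norm Y)\<^sup>2 / 4) \<le> (X + Y) \<bullet> X" by simp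
  then have "t * - ((norm Y)\<^sup>2 / 4) \<le> t * ((X + Y) \<bullet> X)"
    using assms by (intro mult_left_mono) auto
  moreover have "t * ((norm Y)\<^sup>2 / 4) \<le> 1 * ((norm Y)\<^sup>2 / 4)"
    using assms by (intro mult_right_mono) auto
  ultimately have gradient: "- ((norm Y)\<^sup>2 / 4) \<le> (H - G) \<bullet> (t *\<^sub>R (w' - G))"
    by (simp add: X_def Y_def)
  have "(W - q) * \<phi> = (w - q - a) * \<phi> + a * \<phi> + (W - w) * \<phi>"
    by (simp add: algebra_simps)
  moreover have "0 \<le> \<phi>\<^sup>2 + (W - w)\<^sup>2 + 2 * ((W - w) * \<phi>)"
    using zero_le_power2[of "\<phi> + (W - w)"] by (simp add: power2_sum mult_ac)
  moreover have "0 \<le> a * \<phi>" using assms by simp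
  ultimately have "\<phi>\<^sup>2 / 2 - (W - w)\<^sup>2 / 2 \<le> (W - q) * \<phi>"
    using assms(6) by linarith
  then have zeroth: "\<tau>\<^sup>2 * (\<phi>\<^sup>2 / 2 - (W - w)\<^sup>2 / 2) \<le> \<tau>\<^sup>2 * ((W - q) * \<phi>)"
    by (intro mult_left_mono) auto
  have "0 \<le> ((P - Q) / \<tau> - \<tau> / 2 * \<phi>)\<^sup>2" by simp
  also have "\<dots> = (P - Q)\<^sup>2 / \<tau>\<^sup>2 + \<tau>\<^sup>2 / 4 * \<phi>\<^sup>2 - (P - Q) * \<phi>"
    using assms(1) by (simp add: power2_diff power_divide power_mult_distrib)
  finally have source: "(P - Q) * \<phi> \<le> (P - Q)\<^sup>2 / \<tau>\<^sup>2 + \<tau>\<^sup>2 / 4 * \<phi>\<^sup>2" by simp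
  show ?thesis
    using gradient zeroth source by (simp add: Y_def algebra_simps)
qed

text \<open>The test function is a \<open>C\<^sup>1\<close> regularisation of the positive part of \<open>W - q\<close>, with \<open>w\<close> a test function close to
  \<open>W\<close>; the shift by \<open>a\<close> makes its support compact and disjoint from the complement of \<open>U\<close>.\<close>

lemma C1c_huber_diff:
  fixes q w :: "'a::euclidean_space \<Rightarrow> real"
  assumes a: "a > 0" and w: "C1c U w w'" and q: "C1_grad q q'" "\<And>x. x \<notin> U \<Longrightarrow> 0 \<le> q x" "(q \<longlongrightarrow> 0) at_infinity"
  shows "C1c U (\<lambda>x. huber a (w x - q x - a)) (\<lambda>x. huber_deriv a (w x - q x - a) *\<^sub>R (w' x - q' x))"
proof -
  obtain S where S: "compact S" "S \<subseteq> U" "\<And>x. x \<notin> S \<Longrightarrow> w x = 0"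
    using C1c_support[OF w] by metis
  obtain b where b: "\<And>x. b \<le> norm x \<Longrightarrow> dist (q x) 0 < a"
    using q(3) a unfolding Lim_at_infinity by blast
  have "norm x \<le> b" if "q x \<le> - a" for x
    using b[of x] that by (cases "b \<le> norm x") auto
  then have "bounded {x. q x \<le> - a}" unfolding bounded_iff by blast
  moreover have "closed {x. q x \<le> - a}"
    using C1_grad_cont(1)[OF q(1)] by (intro closed_Collect_le) auto
  ultimately have "compact {x. q x \<le> - a}" by (simp add: compact_eq_bounded_closed)
  then have "compact (S \<union> {x. q x \<le> - a})" using S(1) by auto
  moreover have "S \<union> {x. q x \<le> - a} \<subseteq> U" using S(2) q(2) a by force
  moreover have "huber a (w x - q x - a) = 0" if "x \<notin> S \<union> {x. q x \<le> - a}" for x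
    using that S(3)[of x] by (intro huber_nonpos a) auto
  moreover have "C1_grad (\<lambda>x. huber a (w x - q x - a)) (\<lambda>x. huber_deriv a (w x - q x - a) *\<^sub>R (w' x - q' x))"
    using C1_grad_compose_real[OF C1_grad_huber[OF a] C1_grad_diff[OF C1_grad_diff[OF C1c_imp_C1_grad[OF w] q(1)] C1_grad_const]]
    by simp
  ultimately show ?thesis by (intro C1cI)
qed

lemma comparison_energy_estimate:
  fixes W :: "'a::euclidean_space \<Rightarrow> real"
  assumes \<tau>: "\<tau> > 0" and a: "a > 0" and W: "dirichlet_solution U \<tau> W H P" and q: "supersolution U \<tau> q q' Q"
    and PQ: "square_integrable lborel P" "square_integrable lborel Q"
    and w: "C1c U w w'"
    and test: "C1c U (\<lambda>x. huber a (w x - q x - a)) (\<lambda>x. huber_deriv a (w x - q x - a) *\<^sub>R (w' x - q' x))"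
  shows "\<tau>\<^sup>2 / 4 * (L2_norm lborel (\<lambda>x. huber a (w x - q x - a)))\<^sup>2
    \<le> (L2_norm lborel (\<lambda>x. P x - Q x))\<^sup>2 / \<tau>\<^sup>2 + (L2_norm lborel (\<lambda>x. H x - w' x))\<^sup>2 / 4
      + \<tau>\<^sup>2 / 2 * (L2_norm lborel (\<lambda>x. W x - w x))\<^sup>2"
proof -
  define \<phi> where "\<phi> x = huber a (w x - q x - a)" for x
  define \<phi>' where "\<phi>' x = huber_deriv a (w x - q x - a) *\<^sub>R (w' x - q' x)" for x
  have \<phi>: "C1c U \<phi> \<phi>'" using test by (simp add: \<phi>_def[abs_def] \<phi>'_def[abs_def])
  have \<phi>0: "0 \<le> \<phi> x" for x unfolding \<phi>_def by (rule huber_nonneg[OF a])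
  have sqWH: "square_integrable lborel W" "square_integrable lborel H"
    using W by (auto simp: dirichlet_solution_def H1_0_def)
  note sq\<phi> = C1c_integrable(3)[OF \<phi>] and sqw = C1c_integrable(3,4)[OF w]
  define R where "R x = (P x * \<phi> x - Q x * \<phi> x) -
      ((H x \<bullet> \<phi>' x + \<tau>\<^sup>2 * W x * \<phi> x) - (q' x \<bullet> \<phi>' x + \<tau>\<^sup>2 * q x * \<phi> x))" for x
  note integrable = integrable_energy_density_L2[OF sqWH \<phi>, of \<tau>]
    integrable_energy_density_C1[OF supersolutionD(1)[OF q] \<phi>, of \<tau>]
    integrable_mult_square_integrable[OF PQ(1) sq\<phi>] integrable_mult_square_integrable[OF PQ(2) sq\<phi>]
  have "(LBINT x. H x \<bullet> \<phi>' x + \<tau>\<^sup>2 * W x * \<phi> x) = (LBINT x. P x * \<phi> x)"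
    using W \<phi> by (simp add: dirichlet_solution_def energy_form_def)
  moreover have "(LBINT x. Q x * \<phi> x) \<le> (LBINT x. q' x \<bullet> \<phi>' x + \<tau>\<^sup>2 * q x * \<phi> x)"
    using supersolutionD(2)[OF q \<phi> \<phi>0] by (simp add: energy_form_def)
  ultimately have R: "0 \<le> (LBINT x. R x)" "integrable lborel R"
    unfolding R_def[abs_def] using integrable by auto
  have R_le: "\<tau>\<^sup>2 / 4 * (norm (\<phi> x))\<^sup>2 + R x
      \<le> (norm (P x - Q x))\<^sup>2 / \<tau>\<^sup>2 + (norm (H x - w' x))\<^sup>2 / 4 + \<tau>\<^sup>2 / 2 * (norm (W x - w x))\<^sup>2" for x
    using comparison_pointwise[OF \<tau> less_imp_le[OF a] huber_deriv_bounds[OF a, of "w x - q x - a"] \<phi>0[of x]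
        huber_power2_le[OF a, of "w x - q x - a", folded \<phi>_def],
        where P = "P x" and Q = "Q x" and H = "H x" and G = "q' x" and w' = "w' x" and W = "W x"]
    by (simp add: R_def \<phi>'_def inner_diff_left algebra_simps)
  have sqdiff: "square_integrable lborel (\<lambda>x. P x - Q x)" "square_integrable lborel (\<lambda>x. H x - w' x)"
      "square_integrable lborel (\<lambda>x. W x - w x)"
    using PQ sqWH sqw by (auto intro: square_integrable_diff)
  note int2 = sqdiff[THEN square_integrableD] square_integrableD[OF sq\<phi>]
  have "\<tau>\<^sup>2 / 4 * (L2_norm lborel \<phi>)\<^sup>2 \<le> (LBINT x. \<tau>\<^sup>2 / 4 * (norm (\<phi> x))\<^sup>2 + R x)"
    using int2 R by (simp add: L2_norm_power2)
  also have "\<dots> \<le> (LBINT x. (norm (P x - Q x))\<^sup>2 / \<tau>\<^sup>2 + (norm (H x - w' x))\<^sup>2 / 4 + \<tau>\<^sup>2 / 2 * (norm (W x - w x))\<^sup>2)"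
    using int2 R by (intro integral_mono R_le) auto
  finally show ?thesis
    using int2 by (simp add: L2_norm_power2 \<phi>_def[abs_def])
qed

lemma L2_norm_huber_le:
  fixes W :: "'a::euclidean_space \<Rightarrow> real"
  assumes \<tau>: "\<tau> > 0" and a: "a > 0" and W: "dirichlet_solution U \<tau> W H P" and q: "supersolution U \<tau> q q' Q"
    and PQ: "square_integrable lborel P" "square_integrable lborel Q"
    and w: "C1c U w w'" "L2_norm lborel (\<lambda>x. W x - w x) \<le> a" "L2_norm lborel (\<lambda>x. H x - w' x) \<le> a"
    and test: "C1c U (\<lambda>x. huber a (w x - q x - a)) (\<lambda>x. huber_deriv a (w x - q x - a) *\<^sub>R (w' x - q' x))"
  shows "L2_norm lborel (\<lambda>x. huber a (w x - q x - a))
    \<le> sqrt (4 * (L2_norm lborel (\<lambda>x. P x - Q x))\<^sup>2 / \<tau>^4 + a\<^sup>2 * (1 / \<tau>\<^sup>2 + 2))"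
proof (rule real_le_rsqrt)
  let ?D = "L2_norm lborel (\<lambda>x. P x - Q x)" and ?N = "L2_norm lborel (\<lambda>x. huber a (w x - q x - a))"
  have "\<tau>\<^sup>2 / 4 * ?N\<^sup>2 \<le> ?D\<^sup>2 / \<tau>\<^sup>2 + (L2_norm lborel (\<lambda>x. H x - w' x))\<^sup>2 / 4
      + \<tau>\<^sup>2 / 2 * (L2_norm lborel (\<lambda>x. W x - w x))\<^sup>2"
    by (rule comparison_energy_estimate[OF \<tau> a W q PQ w(1) test])
  also have "\<dots> \<le> ?D\<^sup>2 / \<tau>\<^sup>2 + a\<^sup>2 / 4 + \<tau>\<^sup>2 / 2 * a\<^sup>2"
    using w by (intro add_mono mult_left_mono divide_right_mono power_mono) auto
  finally have "4 / \<tau>\<^sup>2 * (\<tau>\<^sup>2 / 4 * ?N\<^sup>2) \<le> 4 / \<tau>\<^sup>2 * (?D\<^sup>2 / \<tau>\<^sup>2 + a\<^sup>2 / 4 + \<tau>\<^sup>2 / 2 * a\<^sup>2)"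
    by (intro mult_left_mono) auto
  then show "?N\<^sup>2 \<le> 4 * ?D\<^sup>2 / \<tau>^4 + a\<^sup>2 * (1 / \<tau>\<^sup>2 + 2)"
    using \<tau> by (simp add: distrib_left power4_eq_xxxx power2_eq_square mult_ac)
qed

lemma comparison_approx:
  fixes W :: "'a::euclidean_space \<Rightarrow> real"
  assumes \<tau>: "\<tau> > 0" and a: "a > 0" and W: "dirichlet_solution U \<tau> W H P"
    and q: "supersolution U \<tau> q q' Q" "\<And>x. x \<notin> U \<Longrightarrow> 0 \<le> q x" "(q \<longlongrightarrow> 0) at_infinity"
    and PQ: "square_integrable lborel P" "square_integrable lborel Q"
    and M: "M \<in> sets lborel" "emeasure lborel M < \<infinity>" "set_integrable lborel M q"
  shows "(LINT x:M|lborel. W x) - (LINT x:M|lborel. q x)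
    \<le> sqrt (measure lborel M) * (a + sqrt (4 * (L2_norm lborel (\<lambda>x. P x - Q x))\<^sup>2 / \<tau>^4 + a\<^sup>2 * (1 / \<tau>\<^sup>2 + 2)))
      + 2 * a * measure lborel M"
proof -
  let ?D = "L2_norm lborel (\<lambda>x. P x - Q x)"
  have H1_0: "H1_0 U W H" using W by (simp add: dirichlet_solution_def)
  obtain w w' where w: "C1c U w w'" "L2_norm lborel (\<lambda>x. W x - w x) < a" "L2_norm lborel (\<lambda>x. H x - w' x) < a"
    by (rule H1_0_approx[OF H1_0 a])
  define \<phi> where "\<phi> x = huber a (w x - q x - a)" for x
  note test = C1c_huber_diff[OF a w(1) supersolutionD(1)[OF q(1)] q(2,3)]
  have sqW: "square_integrable lborel W" using H1_0 by (simp add: H1_0_def)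
  then have sqWw: "square_integrable lborel (\<lambda>x. W x - w x)"
    by (rule square_integrable_diff[OF _ C1c_integrable(3)[OF w(1)]])
  have sq\<phi>: "square_integrable lborel \<phi>"
    using C1c_integrable(3)[OF test] by (simp add: \<phi>_def[abs_def])
  have \<phi>_le: "L2_norm lborel \<phi> \<le> sqrt (4 * ?D\<^sup>2 / \<tau>^4 + a\<^sup>2 * (1 / \<tau>\<^sup>2 + 2))"
    unfolding \<phi>_def[abs_def] using w(2,3) by (intro L2_norm_huber_le[OF \<tau> a W q(1) PQ w(1) _ _ test]) auto
  note setint = set_integrable_square_integrable[OF sqW M(1,2)] set_integrable_square_integrable[OF sqWw M(1,2)]
    set_integrable_square_integrable[OF sq\<phi> M(1,2)]
  have const: "set_integrable lborel M (\<lambda>x. 2 * a)"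
    using M(1,2) by (simp add: set_integrable_def less_top[symmetric])
  have "(LINT x:M|lborel. W x) - (LINT x:M|lborel. q x) = (LINT x:M|lborel. W x - q x)"
    using setint(1) M(3) by (simp add: set_integral_diff)
  also have "\<dots> \<le> (LINT x:M|lborel. (W x - w x) + \<phi> x + 2 * a)"
  proof (rule set_integral_mono)
    show "W x - q x \<le> (W x - w x) + \<phi> x + 2 * a" for x
      using le_add_huber[OF a, of "w x - q x - a"] by (simp add: \<phi>_def)
  qed (use setint M(3) const in \<open>auto intro: set_integral_add set_integral_diff\<close>)
  also have "\<dots> = (LINT x:M|lborel. W x - w x) + (LINT x:M|lborel. \<phi> x) + 2 * a * measure lborel M"
    using setint const M(1,2) by (simp add: set_integral_add set_integral_const less_top[symmetric])
  also have "\<dots> \<le> sqrt (measure lborel M) * a + sqrt (measure lborel M) * sqrt (4 * ?D\<^sup>2 / \<tau>^4 + a\<^sup>2 * (1 / \<tau>\<^sup>2 + 2))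
      + 2 * a * measure lborel M"
    using abs_set_integral_le_L2_norm[OF sqWw M(1,2)] abs_set_integral_le_L2_norm[OF sq\<phi> M(1,2)]
      mult_left_mono[OF less_imp_le[OF w(2)], of "sqrt (measure lborel M)"] mult_left_mono[OF \<phi>_le, of "sqrt (measure lborel M)"]
    by simp
  finally show ?thesis by (simp add: distrib_left)
qed

lemma comparison_principle:
  fixes W :: "'a::euclidean_space \<Rightarrow> real"
  assumes \<tau>: "\<tau> > 0" and W: "dirichlet_solution U \<tau> W H P"
    and q: "supersolution U \<tau> q q' Q" "\<And>x. x \<notin> U \<Longrightarrow> 0 \<le> q x" "(q \<longlongrightarrow> 0) at_infinity"
    and PQ: "square_integrable lborel P" "square_integrable lborel Q"
    and M: "M \<in> sets lborel" "emeasure lborel M < \<infinity>" "set_integrable lborel M q"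
  shows "(LINT x:M|lborel. W x) - (LINT x:M|lborel. q x)
    \<le> 2 / \<tau>\<^sup>2 * sqrt (measure lborel M) * L2_norm lborel (\<lambda>x. P x - Q x)"
proof -
  let ?D = "L2_norm lborel (\<lambda>x. P x - Q x)"
  let ?bound = "\<lambda>a. sqrt (measure lborel M) * (a + sqrt (4 * ?D\<^sup>2 / \<tau>^4 + a\<^sup>2 * (1 / \<tau>\<^sup>2 + 2))) + 2 * a * measure lborel M"
  have "4 * ?D\<^sup>2 / \<tau>^4 = (2 / \<tau>\<^sup>2 * ?D)\<^sup>2"
    by (simp add: power_mult_distrib power_divide)
  then have "sqrt (4 * ?D\<^sup>2 / \<tau>^4) = 2 / \<tau>\<^sup>2 * ?D"
    using \<tau> by simp
  then have bound_0: "2 / \<tau>\<^sup>2 * sqrt (measure lborel M) * ?D = ?bound 0"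
    by simp
  have "(?bound \<longlongrightarrow> ?bound 0) (at_right 0)"
    by (intro tendsto_intros)
  then show ?thesis
    unfolding bound_0 by (rule tendsto_lowerbound)
      (auto intro!: eventually_at_rightI[of 0 1] comparison_approx[OF \<tau> _ W q PQ M])
qed

section \<open>Regularised Yukawa potentials\<close>

text \<open>The sign gives the half-lines \<open>{a<..}\<close> finite measure, so that they determine the distribution.\<close>

lemma distr_neg_norm:
  "distr lborel borel (\<lambda>x::'a::euclidean_space. - norm x)
    = density lborel (\<lambda>r. ennreal (DIM('a) * unit_ball_vol DIM('a) * (- r) ^ (DIM('a) - 1)) * indicator {..0} r)"
    (is "?distr = density lborel ?f")
proof (rule measure_eqI_lessThan)
  define V where "V = unit_ball_vol DIM('a)"
  have V: "0 \<le> V" by (simp add: V_def)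
  have distr: "emeasure ?distr {a<..} = ennreal (if a < 0 then V * (- a) ^ DIM('a) else 0)" for a
  proof -
    have "emeasure ?distr {a<..} = emeasure lborel {x::'a. a < - norm x}"
      by (subst emeasure_distr) (auto simp: vimage_def)
    also have "{x::'a. a < - norm x} = (if a < 0 then ball 0 (- a) else {})"
      using norm_ge_zero by (auto simp: not_less) (smt (verit) norm_ge_zero)
    finally show ?thesis
      by (auto simp: emeasure_ball V_def)
  qed
  show "emeasure ?distr {a<..} < \<infinity>" for a
    unfolding distr by simp
  show "emeasure ?distr {a<..} = emeasure (density lborel ?f) {a<..}" for a
  proof -
    have density: "emeasure (density lborel ?f) {a<..} = (\<integral>\<^sup>+r. ?f r * indicator {a<..} r \<partial>lborel)"
      by (subst emeasure_density) auto
    show ?thesis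
    proof (cases "a < 0")
      case True
      have "(\<integral>\<^sup>+r. ?f r * indicator {a<..} r \<partial>lborel)
          = (\<integral>\<^sup>+r. ennreal (DIM('a) * V * (- r) ^ (DIM('a) - 1)) * indicator {a..0} r \<partial>lborel)"
        using AE_lborel_singleton[of a]
        by (intro nn_integral_cong_AE) (auto simp: indicator_def V_def elim: eventually_mono)
      also have "\<dots> = ennreal (- V * (- 0) ^ DIM('a) - - V * (- a) ^ DIM('a))"
        using V True by (intro nn_integral_FTC_Icc) (auto intro!: derivative_eq_intros)
      finally show ?thesis unfolding distr density using True by (simp add: zero_power[OF DIM_positive])
    next
      case False
      then have "(\<lambda>r. ?f r * indicator {a<..} r) = (\<lambda>r. 0)"
        by (auto simp: indicator_def fun_eq_iff)
      then show ?thesis unfolding distr density using False by simp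
    qed
  qed
qed auto

lemma nn_integral_radial:
  fixes f :: "real \<Rightarrow> ennreal"
  assumes [measurable]: "f \<in> borel_measurable borel"
  shows "(\<integral>\<^sup>+x. f (norm (x::'a::euclidean_space)) \<partial>lborel)
    = (\<integral>\<^sup>+r. ennreal (DIM('a) * unit_ball_vol DIM('a) * r ^ (DIM('a) - 1)) * f r * indicator {0..} r \<partial>lborel)"
proof -
  have "(\<integral>\<^sup>+x. f (norm (x::'a)) \<partial>lborel) = (\<integral>\<^sup>+r. f (- r) \<partial>distr lborel borel (\<lambda>x::'a. - norm x))"
    by (subst nn_integral_distr) auto
  also have "\<dots> = (\<integral>\<^sup>+r. ennreal (DIM('a) * unit_ball_vol DIM('a) * (- r) ^ (DIM('a) - 1)) * indicator {..0} r * f (- r) \<partial>lborel)"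
    unfolding distr_neg_norm by (subst nn_integral_density) auto
  also have "\<dots> = (\<integral>\<^sup>+r. ennreal (DIM('a) * unit_ball_vol DIM('a) * r ^ (DIM('a) - 1)) * f r * indicator {0..} r \<partial>lborel)"
    by (subst nn_integral_real_affine[of _ "-1" 0])
       (auto simp: indicator_def mult_ac intro!: nn_integral_cong)
  finally show ?thesis .
qed

definition reg_norm :: "real \<Rightarrow> 'a::euclidean_space \<Rightarrow> real" where
  "reg_norm e x = sqrt ((norm x)\<^sup>2 + e\<^sup>2)"

lemma reg_norm_pos: "e > 0 \<Longrightarrow> reg_norm e x > 0"
  by (simp add: reg_norm_def add_nonneg_pos)

lemma norm_le_reg_norm: "norm x \<le> reg_norm e x"
  and le_reg_norm: "e > 0 \<Longrightarrow> e \<le> reg_norm e x"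
  unfolding reg_norm_def by (auto intro!: real_le_rsqrt)

lemma reg_norm_le: "e > 0 \<Longrightarrow> reg_norm e x \<le> norm x + e"
  unfolding reg_norm_def by (rule sqrt_sum_squares_le_sum) auto

lemma reg_norm_power2: "(reg_norm e x)\<^sup>2 = (norm x)\<^sup>2 + e\<^sup>2"
  by (simp add: reg_norm_def)

lemma reg_norm_scaleR:
  assumes "e > 0" shows "reg_norm e (e *\<^sub>R x) = e * reg_norm 1 x"
proof -
  have "(norm (e *\<^sub>R x))\<^sup>2 + e\<^sup>2 = e\<^sup>2 * ((norm x)\<^sup>2 + 1\<^sup>2)"
    by (simp add: power_mult_distrib algebra_simps)
  then show ?thesis unfolding reg_norm_def using assms by (simp add: real_sqrt_mult)
qed

lemma C1_grad_radial:
  fixes g g' :: "real \<Rightarrow> real"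
  assumes e: "e > 0" and g: "\<And>s. s > 0 \<Longrightarrow> (g has_real_derivative g' s) (at s)" "continuous_on {0<..} g'"
  shows "C1_grad (\<lambda>x::'a::euclidean_space. g (reg_norm e x)) (\<lambda>x. (g' (reg_norm e x) / reg_norm e x) *\<^sub>R x)"
proof -
  have pos: "0 < (norm (x - 0))\<^sup>2 + e\<^sup>2" for x :: 'a
    using e by (simp add: add_nonneg_pos)
  have "((\<lambda>t. sqrt (t + e\<^sup>2)) has_real_derivative inverse (2 * sqrt ((norm (x - 0))\<^sup>2 + e\<^sup>2))) (at ((norm (x - 0))\<^sup>2))" for x :: 'a
    using pos[of x] by (auto intro!: derivative_eq_intros simp: field_simps)
  moreover have "continuous_on (range (\<lambda>x::'a. (norm (x - 0))\<^sup>2)) (\<lambda>t. inverse (2 * sqrt (t + e\<^sup>2)))"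
    using e by (intro continuous_intros) (auto simp: add_nonneg_eq_0_iff)
  ultimately have "C1_grad (\<lambda>x::'a. sqrt ((norm (x - 0))\<^sup>2 + e\<^sup>2)) (\<lambda>x. inverse (2 * sqrt ((norm (x - 0))\<^sup>2 + e\<^sup>2)) *\<^sub>R 2 *\<^sub>R (x - 0))"
    by (rule C1_grad_compose[OF _ _ C1_grad_norm_sq])
  moreover have "(\<lambda>x::'a. inverse (2 * sqrt ((norm (x - 0))\<^sup>2 + e\<^sup>2)) *\<^sub>R 2 *\<^sub>R (x - 0)) = (\<lambda>x. (1 / reg_norm e x) *\<^sub>R x)"
    by (simp add: reg_norm_def fun_eq_iff field_simps)
  moreover have "(\<lambda>x::'a. sqrt ((norm (x - 0))\<^sup>2 + e\<^sup>2)) = reg_norm e"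
    by (simp add: reg_norm_def fun_eq_iff)
  ultimately have "C1_grad (reg_norm e) (\<lambda>x::'a. (1 / reg_norm e x) *\<^sub>R x)"
    by (simp only:)
  moreover have "range (reg_norm e :: 'a \<Rightarrow> real) \<subseteq> {0<..}"
    using reg_norm_pos[OF e] by auto
  ultimately have "C1_grad (\<lambda>x::'a. g (reg_norm e x)) (\<lambda>x. g' (reg_norm e x) *\<^sub>R (1 / reg_norm e x) *\<^sub>R x)"
    by (intro C1_grad_compose[OF g(1)[OF reg_norm_pos[OF e]] continuous_on_subset[OF g(2)]])
  then show ?thesis by simp
qed

definition yukawa :: "real \<Rightarrow> real \<Rightarrow> real^3 \<Rightarrow> real" where
  "yukawa k e x = exp (- k * reg_norm e x) / reg_norm e x"

definition yukawa_slope :: "real \<Rightarrow> real \<Rightarrow> real" where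
  "yukawa_slope k s = exp (- k * s) * (k / s\<^sup>2 + 1 / s^3)"

definition yukawa_grad :: "real \<Rightarrow> real \<Rightarrow> real^3 \<Rightarrow> real^3" where
  "yukawa_grad k e x = - yukawa_slope k (reg_norm e x) *\<^sub>R x"

definition yukawa_curv :: "real \<Rightarrow> real \<Rightarrow> real" where
  "yukawa_curv k s = exp (- k * s) * (k\<^sup>2 / s^3 + 3 * k / s^4 + 3 / s^5)"

text \<open>\<open>yukawa_src = (k\<^sup>2 - \<Delta>) yukawa\<close>; as \<open>e \<rightarrow> 0\<close>, it tends to \<open>4 \<pi>\<close> times the Dirac measure at the origin.\<close>

definition yukawa_src :: "real \<Rightarrow> real \<Rightarrow> real^3 \<Rightarrow> real" where
  "yukawa_src k e x = e\<^sup>2 * yukawa_curv k (reg_norm e x)"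

lemma C1_grad_yukawa:
  assumes e: "e > 0" shows "C1_grad (yukawa k e) (yukawa_grad k e)"
proof -
  have "((\<lambda>s. exp (- k * s) / s) has_real_derivative - s * yukawa_slope k s) (at s)" if "s > 0" for s
    using that by (auto intro!: derivative_eq_intros simp: yukawa_slope_def field_simps power2_eq_square power3_eq_cube)
  moreover have "continuous_on {0<..} (\<lambda>s. - s * yukawa_slope k s)"
    unfolding yukawa_slope_def by (intro continuous_intros) auto
  ultimately have "C1_grad (yukawa k e) (\<lambda>x. (- reg_norm e x * yukawa_slope k (reg_norm e x) / reg_norm e x) *\<^sub>R x)"
    unfolding yukawa_def[abs_def] by (rule C1_grad_radial[OF e])
  moreover have "- reg_norm e x * yukawa_slope k (reg_norm e x) / reg_norm e x = - yukawa_slope k (reg_norm e x)" for x :: "real^3"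
    using reg_norm_pos[OF e, of x] by simp
  ultimately show ?thesis by (simp only: yukawa_grad_def[abs_def])
qed

lemma C1_grad_yukawa_grad_inner:
  assumes e: "e > 0"
  shows "C1_grad (\<lambda>x. yukawa_grad k e x \<bullet> b)
    (\<lambda>x. (yukawa_curv k (reg_norm e x) * (x \<bullet> b)) *\<^sub>R x - yukawa_slope k (reg_norm e x) *\<^sub>R b)"
proof -
  have "(yukawa_slope k has_real_derivative - s * yukawa_curv k s) (at s)" if "s > 0" for s
    unfolding yukawa_slope_def[abs_def] using that
    by (auto intro!: derivative_eq_intros simp: yukawa_curv_def field_simps eval_nat_numeral)
  moreover have "continuous_on {0<..} (\<lambda>s. - s * yukawa_curv k s)"
    unfolding yukawa_curv_def by (intro continuous_intros) auto
  ultimately have "C1_grad (\<lambda>x::real^3. yukawa_slope k (reg_norm e x)) (\<lambda>x. (- reg_norm e x * yukawa_curv k (reg_norm e x) / reg_norm e x) *\<^sub>R x)"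
    by (rule C1_grad_radial[OF e])
  moreover have "- reg_norm e x * yukawa_curv k (reg_norm e x) / reg_norm e x = - yukawa_curv k (reg_norm e x)" for x :: "real^3"
    using reg_norm_pos[OF e, of x] by simp
  ultimately have "C1_grad (\<lambda>x::real^3. yukawa_slope k (reg_norm e x)) (\<lambda>x. - yukawa_curv k (reg_norm e x) *\<^sub>R x)"
    by (simp only:)
  from C1_grad_cmult[OF C1_grad_mult[OF this C1_grad_inner[of b]], of "-1"] show ?thesis
    by (simp add: yukawa_grad_def algebra_simps)
qed

lemma yukawa_laplacian:
  assumes e: "e > 0"
  shows "(\<Sum>b\<in>Basis. ((yukawa_curv k (reg_norm e x) * (x \<bullet> b)) *\<^sub>R x - yukawa_slope k (reg_norm e x) *\<^sub>R b) \<bullet> b)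
    = k\<^sup>2 * yukawa k e x - yukawa_src k e (x :: real^3)"
proof -
  define s where "s = reg_norm e x"
  have s: "s > 0" using e by (simp add: s_def reg_norm_pos)
  have "(\<Sum>b\<in>Basis. ((yukawa_curv k s * (x \<bullet> b)) *\<^sub>R x - yukawa_slope k s *\<^sub>R b) \<bullet> b)
      = (\<Sum>b\<in>Basis. yukawa_curv k s * ((x \<bullet> b) * (x \<bullet> b)) - yukawa_slope k s)"
    by (intro sum.cong) (auto simp: inner_diff_left)
  also have "\<dots> = yukawa_curv k s * (norm x)\<^sup>2 - 3 * yukawa_slope k s"
    by (simp add: sum_subtractf flip: sum_distrib_left euclidean_inner power2_norm_eq_inner)
  also have "(norm x)\<^sup>2 = s\<^sup>2 - e\<^sup>2" by (simp add: s_def reg_norm_power2)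
  also have "yukawa_curv k s * (s\<^sup>2 - e\<^sup>2) - 3 * yukawa_slope k s = k\<^sup>2 * (exp (- k * s) / s) - e\<^sup>2 * yukawa_curv k s"
    using s by (simp add: yukawa_curv_def yukawa_slope_def field_simps eval_nat_numeral)
  finally show ?thesis by (simp add: yukawa_def yukawa_src_def s_def)
qed

lemma continuous_yukawa_src:
  assumes "e > 0" shows "continuous_on UNIV (yukawa_src k e)"
proof -
  have "continuous_on {0<..} (yukawa_curv k)"
    unfolding yukawa_curv_def by (intro continuous_intros) auto
  moreover have "continuous_on UNIV (reg_norm e :: real^3 \<Rightarrow> real)"
    unfolding reg_norm_def by (intro continuous_intros)
  ultimately show ?thesis
    unfolding yukawa_src_def using reg_norm_pos[OF assms]
    by (intro continuous_intros continuous_on_compose2[of "{0<..}" "yukawa_curv k" UNIV "reg_norm e"]) auto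
qed

lemma yukawa_src_measurable [measurable]: "yukawa_src k e \<in> borel_measurable borel"
  unfolding yukawa_src_def[abs_def] yukawa_curv_def reg_norm_def by measurable

lemma energy_form_yukawa:
  assumes e: "e > 0" and \<phi>: "C1c U \<phi> \<phi>'"
  shows "energy_form k (\<lambda>x. yukawa k e (x - p)) (\<lambda>x. yukawa_grad k e (x - p)) \<phi> \<phi>' = (LBINT x. yukawa_src k e (x - p) * \<phi> x)"
proof -
  note C1 = C1_grad_cont[OF C1_grad_shift[OF C1_grad_yukawa[OF e, of k], of p]]
  note integrable = integrable_continuous_mult_C1c[OF C1 \<phi>]
  have "continuous_on UNIV (\<lambda>x. yukawa_src k e (x - p))"
    by (intro continuous_on_compose2[OF continuous_yukawa_src[OF e]] continuous_intros) auto
  note integrable_src = integrable_continuous_mult_C1c(1)[OF this C1(2) \<phi>]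
  have "(LBINT x. yukawa_grad k e (x - p) \<bullet> \<phi>' x)
      = - (LBINT x. (k\<^sup>2 * yukawa k e (x - p) - yukawa_src k e (x - p)) * \<phi> x)"
    using C1c_integral_divergence[OF \<phi> C1_grad_shift[OF C1_grad_yukawa_grad_inner[OF e, of k], of p]]
    by (simp add: yukawa_laplacian[OF e])
  also have "\<dots> = (LBINT x. yukawa_src k e (x - p) * \<phi> x) - k\<^sup>2 * (LBINT x. yukawa k e (x - p) * \<phi> x)"
    using integrable(1) integrable_src by (simp add: left_diff_distrib mult.assoc)
  finally show ?thesis
    using integrable by (simp add: energy_form_def mult.assoc)
qed

lemma yukawa_pos: "e > 0 \<Longrightarrow> yukawa k e x > 0"
  using reg_norm_pos[of e x] by (simp add: yukawa_def)

lemma yukawa_uminus: "yukawa k e (- x) = yukawa k e x"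
  by (simp add: yukawa_def reg_norm_def)

lemma yukawa_le:
  assumes "k \<ge> 0" "0 < b" "a \<le> reg_norm e x" "b \<le> reg_norm e x"
  shows "yukawa k e x \<le> exp (- k * a) / b"
  unfolding yukawa_def using assms by (intro frac_le) (auto intro: mult_left_mono)

lemma yukawa_ge:
  assumes "e > 0" "k \<ge> 0" "norm x + e \<le> a" "norm x + e \<le> b"
  shows "exp (- k * a) / b \<le> yukawa k e x"
proof -
  have "reg_norm e x \<le> a" "reg_norm e x \<le> b" using reg_norm_le[OF assms(1), of x] assms(3,4) by auto
  then show ?thesis unfolding yukawa_def using assms(2) reg_norm_pos[OF assms(1), of x]
    by (intro frac_le) (auto intro: mult_left_mono)
qed

lemma yukawa_src_nonneg: "e > 0 \<Longrightarrow> k \<ge> 0 \<Longrightarrow> 0 \<le> yukawa_src k e x"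
  using reg_norm_pos[of e x] by (simp add: yukawa_src_def yukawa_curv_def)

lemma yukawa_bounded:
  assumes e: "e > 0" and k: "k \<ge> 0"
  obtains M where "0 \<le> M" "\<And>x. \<bar>yukawa k e x\<bar> \<le> M" "\<And>x. norm (yukawa_grad k e x) \<le> M" "\<And>x. \<bar>yukawa_src k e x\<bar> \<le> M"
proof
  define A where "A = 1 / e"
  define B where "B = k / e + 1 / e\<^sup>2"
  define C where "C = e\<^sup>2 * (k\<^sup>2 / e^3 + 3 * k / e^4 + 3 / e^5)"
  have ABC: "0 \<le> A" "0 \<le> B" "0 \<le> C" using e k by (auto simp: A_def B_def C_def)
  then show "0 \<le> A + B + C" by simp
  fix x :: "real^3"
  define s where "s = reg_norm e x"
  have s: "0 < s" "e \<le> s" "norm x \<le> s" using e by (auto simp: s_def reg_norm_pos le_reg_norm norm_le_reg_norm)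
  have exp_le_1: "exp (- k * s) \<le> 1" using s k by simp
  have "\<bar>yukawa k e x\<bar> \<le> A"
    using yukawa_le[OF k e, of 0 e x] yukawa_pos[OF e, of k x] s by (simp add: A_def s_def)
  then show "\<bar>yukawa k e x\<bar> \<le> A + B + C" using ABC by simp
  have "0 \<le> yukawa_slope k s" using s k by (simp add: yukawa_slope_def)
  then have "norm (yukawa_grad k e x) \<le> yukawa_slope k s * s"
    using s by (simp add: yukawa_grad_def mult_left_mono flip: s_def)
  also have "\<dots> = exp (- k * s) * (k / s + 1 / s\<^sup>2)"
    using s by (simp add: yukawa_slope_def field_simps power2_eq_square power3_eq_cube)
  also have "\<dots> \<le> 1 * B"
    unfolding B_def using s e k by (intro mult_mono exp_le_1 add_mono divide_left_mono power_mono) auto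
  finally show "norm (yukawa_grad k e x) \<le> A + B + C" using ABC by simp
  have "\<bar>yukawa_src k e x\<bar> = e\<^sup>2 * (exp (- k * s) * (k\<^sup>2 / s^3 + 3 * k / s^4 + 3 / s^5))"
    using yukawa_src_nonneg[OF e k, of x] by (simp add: yukawa_src_def yukawa_curv_def s_def)
  also have "\<dots> \<le> e\<^sup>2 * (1 * (k\<^sup>2 / e^3 + 3 * k / e^4 + 3 / e^5))"
    using s e k by (intro mult_left_mono mult_mono exp_le_1 add_mono divide_left_mono power_mono add_nonneg_nonneg) auto
  finally show "\<bar>yukawa_src k e x\<bar> \<le> A + B + C" using ABC by (simp add: C_def)
qed

lemma yukawa_integrable:
  assumes k: "k > 0"
  shows "integrable lborel (\<lambda>x::real^3. exp (- k * norm x) / norm x)"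
proof -
  have "(\<integral>\<^sup>+x. ennreal (exp (- k * norm (x::real^3)) / norm x) \<partial>lborel)
      = (\<integral>\<^sup>+r. ennreal (4 * pi * r\<^sup>2) * ennreal (exp (- k * r) / r) * indicator {0..} r \<partial>lborel)"
    by (subst nn_integral_radial) (simp_all add: unit_ball_vol_3)
  also have "\<dots> = (\<integral>\<^sup>+r. ennreal (4 * pi * (r * exp (- k * r))) * indicator {0..} r \<partial>lborel)"
    by (intro nn_integral_cong) (auto simp flip: ennreal_mult simp: indicator_def power2_eq_square field_simps)
  also have "\<dots> = ennreal (0 - 4 * pi * (- (0 / k + 1 / k\<^sup>2) * exp (- k * 0)))"
  proof (rule nn_integral_FTC_atLeast)
    show "((\<lambda>r. 4 * pi * (- (r / k + 1 / k\<^sup>2) * exp (- k * r))) has_real_derivative 4 * pi * (r * exp (- k * r))) (at r)" for r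
      using k by (auto intro!: derivative_eq_intros simp: field_simps power2_eq_square)
    show "((\<lambda>r. 4 * pi * (- (r / k + 1 / k\<^sup>2) * exp (- k * r))) \<longlongrightarrow> 0) at_top"
      using k by real_asymp
  qed auto
  finally have "(\<integral>\<^sup>+x. ennreal (exp (- k * norm (x::real^3)) / norm x) \<partial>lborel) < \<infinity>" by simp
  then show ?thesis by (intro integrableI_nonneg) auto
qed

lemma yukawa_tendsto:
  assumes X: "X \<longlonglongrightarrow> 0" and x: "x \<noteq> 0"
  shows "(\<lambda>n. yukawa k (X n) x) \<longlonglongrightarrow> exp (- k * norm x) / norm x"
proof -
  have "(\<lambda>n. exp (- k * sqrt ((norm x)\<^sup>2 + (X n)\<^sup>2)) / sqrt ((norm x)\<^sup>2 + (X n)\<^sup>2))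
      \<longlonglongrightarrow> exp (- k * sqrt ((norm x)\<^sup>2 + 0\<^sup>2)) / sqrt ((norm x)\<^sup>2 + 0\<^sup>2)"
    by (intro tendsto_intros X) (use x in auto)
  then show ?thesis by (simp add: yukawa_def reg_norm_def)
qed

lemma tendsto_0_at_infinity_of_le_inverse:
  fixes f :: "'a::real_normed_vector \<Rightarrow> real"
  assumes "\<And>x. norm x > R \<Longrightarrow> \<bar>f x\<bar> \<le> c / (norm x - R)"
  shows "(f \<longlongrightarrow> 0) at_infinity"
proof (rule Lim_null_comparison)
  have "((\<lambda>t. c / (t - R)) \<longlongrightarrow> 0) at_top" by real_asymp
  then show "((\<lambda>x::'a. c / (norm x - R)) \<longlongrightarrow> 0) at_infinity"
    by (rule filterlim_compose[OF _ filterlim_norm_at_top])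
  have "\<forall>\<^sub>F x::'a in at_infinity. norm x > R"
    using filterlim_norm_at_top unfolding filterlim_at_top_dense by blast
  then show "\<forall>\<^sub>F x in at_infinity. norm (f x) \<le> c / (norm x - R)"
    by eventually_elim (use assms in simp)
qed

lemma yukawa_le_inverse:
  assumes "e > 0" "k \<ge> 0" "norm p \<le> R" "norm x > R"
  shows "yukawa k e (x - p) \<le> 1 / (norm x - R)"
proof -
  have "norm x - R \<le> reg_norm e (x - p)"
    using norm_triangle_ineq2[of x p] norm_le_reg_norm[of "x - p" e] assms(3) by simp
  then show ?thesis
    using yukawa_le[of k "norm x - R" 0 e "x - p"] reg_norm_pos[OF assms(1), of "x - p"] assms by simp
qed

lemma yukawa_at_infinity:
  assumes "e > 0" "k \<ge> 0" shows "((\<lambda>x. yukawa k e (x - p)) \<longlongrightarrow> 0) at_infinity"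
proof (rule tendsto_0_at_infinity_of_le_inverse)
  show "\<bar>yukawa k e (x - p)\<bar> \<le> 1 / (norm x - norm p)" if "norm x > norm p" for x
    using yukawa_le_inverse[OF assms _ that] yukawa_pos[OF assms(1), of k "x - p"] by simp
qed

subsection \<open>Concentration of the source at the origin\<close>

lemma yukawa_src_scaleR:
  fixes k e :: real
  assumes e: "e > 0"
  defines "y x \<equiv> k * e * reg_norm 1 x"
  shows "e^3 * yukawa_src k e (e *\<^sub>R x) = exp (- y x) * ((y x)\<^sup>2 + 3 * y x + 3) / (reg_norm 1 x)^5"
proof -
  have "reg_norm 1 x > 0" by (rule reg_norm_pos) simp
  then show ?thesis
    unfolding yukawa_src_def yukawa_curv_def reg_norm_scaleR[OF e] y_def using e
    by (simp add: field_simps eval_nat_numeral)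
qed

lemma yukawa_src_scaleR_le:
  assumes "e > 0" "k \<ge> 0"
  shows "e^3 * yukawa_src k e (e *\<^sub>R x) \<le> 3 / (reg_norm 1 x)^5"
proof -
  define y where "y = k * e * reg_norm 1 x"
  have s: "reg_norm 1 x > 0" by (rule reg_norm_pos) simp
  have y: "y \<ge> 0" using assms s by (simp add: y_def)
  have "y\<^sup>2 + 3 * y + 3 \<le> 3 * (1 + y + y\<^sup>2 / 2)"
    using zero_le_power2[of y] by (simp add: algebra_simps del: zero_le_power2)
  also have "\<dots> \<le> 3 * exp y" using exp_lower_Taylor_quadratic[OF y] by simp
  finally have "exp (- y) * (y\<^sup>2 + 3 * y + 3) \<le> exp (- y) * (3 * exp y)" by (intro mult_left_mono) auto
  also have "\<dots> = 3" by (simp add: exp_minus)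
  finally show ?thesis
    unfolding yukawa_src_scaleR[OF assms(1)] y_def[symmetric] using s by (intro divide_right_mono) auto
qed

lemma yukawa_src_scaleR_tendsto:
  assumes X: "X \<longlonglongrightarrow> 0" "\<And>n. X n > 0"
  shows "(\<lambda>n. (X n)^3 * yukawa_src k (X n) (X n *\<^sub>R x)) \<longlonglongrightarrow> 3 / (reg_norm 1 x)^5"
proof -
  define s where "s = reg_norm 1 x"
  have s: "s \<noteq> 0" using reg_norm_pos[of 1 x] by (simp add: s_def)
  have "(\<lambda>n. exp (- (k * X n * s)) * ((k * X n * s)\<^sup>2 + 3 * (k * X n * s) + 3) / s^5)
    \<longlonglongrightarrow> exp (- (k * 0 * s)) * ((k * 0 * s)\<^sup>2 + 3 * (k * 0 * s) + 3) / s^5"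
    by (intro tendsto_intros X) (use s in auto)
  then show ?thesis using X(2) by (simp add: yukawa_src_scaleR s_def)
qed

lemma DERIV_div_sqrt_add_1_power3:
  "((\<lambda>r. (r / sqrt (r\<^sup>2 + 1))^3) has_real_derivative 3 * r\<^sup>2 / (sqrt (r\<^sup>2 + 1))^5) (at r)"
proof -
  define s where "s = sqrt (r\<^sup>2 + 1)"
  have pos: "0 < r\<^sup>2 + 1" by (simp add: add_nonneg_pos)
  then have s: "s > 0" "s\<^sup>2 - r\<^sup>2 = 1" by (auto simp: s_def)
  have "((\<lambda>r. sqrt (r\<^sup>2 + 1)) has_real_derivative r / s) (at r)"
    using pos unfolding s_def by (auto intro!: derivative_eq_intros simp: field_simps)
  from DERIV_divide[OF DERIV_ident this] s(1)
  have "((\<lambda>r. r / sqrt (r\<^sup>2 + 1)) has_real_derivative (1 * s - r * (r / s)) / (s * s)) (at r)"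
    by (simp add: s_def)
  also have "(1 * s - r * (r / s)) / (s * s) = (s\<^sup>2 - r\<^sup>2) / s^3"
    using s(1) by (simp add: field_simps power2_eq_square power3_eq_cube)
  finally have "((\<lambda>r. r / sqrt (r\<^sup>2 + 1)) has_real_derivative 1 / s^3) (at r)"
    unfolding s(2) .
  from DERIV_power[OF this, of 3]
  have "((\<lambda>r. (r / sqrt (r\<^sup>2 + 1))^3) has_real_derivative 3 * (r / s)\<^sup>2 * (1 / s^3)) (at r)"
    by (simp add: s_def mult_ac)
  then show ?thesis
    using s(1) by (simp add: s_def field_simps eval_nat_numeral)
qed

lemma
  shows integrable_reg_norm_power5: "integrable lborel (\<lambda>x::real^3. 3 / (reg_norm 1 x)^5)"
    and integral_reg_norm_power5: "(LBINT x. 3 / (reg_norm 1 (x::real^3))^5) = 4 * pi"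
proof -
  let ?g = "\<lambda>r. ennreal (3 / (sqrt (r\<^sup>2 + 1))^5)"
  have "(\<integral>\<^sup>+x. ennreal (3 / (reg_norm 1 (x::real^3))^5) \<partial>lborel) = (\<integral>\<^sup>+x. ?g (norm (x::real^3)) \<partial>lborel)"
    by (simp add: reg_norm_def)
  also have "\<dots> = (\<integral>\<^sup>+r. ennreal (4 * pi * r\<^sup>2) * ?g r * indicator {0..} r \<partial>lborel)"
    by (subst nn_integral_radial) (simp_all add: unit_ball_vol_3)
  also have "\<dots> = (\<integral>\<^sup>+r. ennreal (4 * pi * (3 * r\<^sup>2 / (sqrt (r\<^sup>2 + 1))^5)) * indicator {0..} r \<partial>lborel)"
    by (intro nn_integral_cong) (simp flip: ennreal_mult add: field_simps)
  also have "\<dots> = ennreal (4 * pi - 4 * pi * (0 / sqrt (0\<^sup>2 + 1))^3)"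
  proof (rule nn_integral_FTC_atLeast)
    have "((\<lambda>r::real. r / sqrt (r\<^sup>2 + 1)) \<longlongrightarrow> 1) at_top"
      by real_asymp
    from tendsto_mult[OF tendsto_const tendsto_power[OF this, of 3], of "4 * pi"]
    show "((\<lambda>r. 4 * pi * (r / sqrt (r\<^sup>2 + 1))^3) \<longlongrightarrow> 4 * pi) at_top" by simp
    show "((\<lambda>r. 4 * pi * (r / sqrt (r\<^sup>2 + 1))^3) has_real_derivative 4 * pi * (3 * r\<^sup>2 / (sqrt (r\<^sup>2 + 1))^5)) (at r)" for r
      by (rule DERIV_cmult[OF DERIV_div_sqrt_add_1_power3])
  qed auto
  finally have nn: "(\<integral>\<^sup>+x. ennreal (3 / (reg_norm 1 (x::real^3))^5) \<partial>lborel) = ennreal (4 * pi)" by simp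
  have pos: "0 \<le> 3 / (reg_norm 1 x)^5" for x :: "real^3" using reg_norm_pos[of 1 x] by simp
  have meas: "(\<lambda>x::real^3. 3 / (reg_norm 1 x)^5) \<in> borel_measurable lborel" unfolding reg_norm_def by measurable
  show "integrable lborel (\<lambda>x::real^3. 3 / (reg_norm 1 x)^5)"
    by (rule integrableI_nonneg[OF meas AE_I2[OF pos]]) (simp add: nn)
  show "(LBINT x. 3 / (reg_norm 1 (x::real^3))^5) = 4 * pi"
    using integral_eq_nn_integral[OF meas AE_I2[OF pos]] nn by simp
qed

lemma integrable_yukawa_src:
  assumes e: "e > 0" and k: "k \<ge> 0"
  shows "integrable lborel (yukawa_src k e)"
proof -
  have "norm (e^3 * yukawa_src k e (e *\<^sub>R x)) \<le> norm (3 / (reg_norm 1 x)^5)" for x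
    using yukawa_src_scaleR_le[OF e k, of x] yukawa_src_nonneg[OF e k, of "e *\<^sub>R x"] e reg_norm_pos[of 1 x]
    by (simp add: power_abs)
  then have "integrable lborel (\<lambda>x. e^3 * yukawa_src k e (e *\<^sub>R x))"
    by (intro Bochner_Integration.integrable_bound[OF integrable_reg_norm_power5]) auto
  then have "integrable lborel (\<lambda>x. yukawa_src k e (0 + e *\<^sub>R x))" using e by simp
  from integrable_affine[OF this, of "1 / e" 0] e show ?thesis by simp
qed

lemma yukawa_src_tendsto_dirac:
  assumes k: "k \<ge> 0" and X: "X \<longlonglongrightarrow> 0" "\<And>n. X n > 0"
    and g [measurable]: "g \<in> borel_measurable borel" and C: "\<And>y. \<bar>g y\<bar> \<le> C" and cont: "isCont g 0"
  shows "(\<lambda>n. LBINT y. yukawa_src k (X n) y * g y) \<longlonglongrightarrow> 4 * pi * g 0"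
proof -
  let ?s = "\<lambda>n x. (X n)^3 * yukawa_src k (X n) (X n *\<^sub>R x)"
  have scaled: "(LBINT y. yukawa_src k (X n) y * g y) = (LBINT x. ?s n x * g (X n *\<^sub>R x))" for n
    by (subst integral_affine[of _ "X n" 0]) (use X(2)[of n] in \<open>auto simp: mult.assoc\<close>)
  have "(\<lambda>n. LBINT x. ?s n x * g (X n *\<^sub>R x)) \<longlonglongrightarrow> (LBINT x. 3 / (reg_norm 1 (x::real^3))^5 * g 0)"
  proof (rule integral_dominated_convergence)
    show "integrable lborel (\<lambda>x::real^3. 3 / (reg_norm 1 x)^5 * C)"
      using integrable_reg_norm_power5 by (rule integrable_mult_left)
    have "(\<lambda>n. g (X n *\<^sub>R x)) \<longlonglongrightarrow> g 0" for x
      using tendsto_scaleR[OF X(1) tendsto_const[of x]] by (intro isCont_tendsto_compose[OF cont]) simp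
    then show "AE x in lborel. (\<lambda>n. ?s n x * g (X n *\<^sub>R x)) \<longlonglongrightarrow> 3 / (reg_norm 1 x)^5 * g 0"
      by (intro AE_I2 tendsto_mult yukawa_src_scaleR_tendsto X)
    show "(\<lambda>x::real^3. 3 / (reg_norm 1 x)^5 * g 0) \<in> borel_measurable lborel" unfolding reg_norm_def by measurable
    fix n
    have "?s n x * \<bar>g (X n *\<^sub>R x)\<bar> \<le> 3 / (reg_norm 1 x)^5 * C" for x
      using yukawa_src_scaleR_le[OF X(2) k] C reg_norm_pos[of 1 x] by (intro mult_mono) auto
    then have "norm (?s n x * g (X n *\<^sub>R x)) \<le> 3 / (reg_norm 1 x)^5 * C" for x
      using X(2)[of n] yukawa_src_nonneg[OF X(2) k, of n "X n *\<^sub>R x"] by (simp add: abs_mult)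
    then show "AE x in lborel. norm (?s n x * g (X n *\<^sub>R x)) \<le> 3 / (reg_norm 1 x)^5 * C" by simp
  qed measurable
  also have "(LBINT x. 3 / (reg_norm 1 (x::real^3))^5 * g 0) = 4 * pi * g 0"
    by (simp only: integral_mult_left_zero integral_reg_norm_power5)
  finally show ?thesis by (simp only: scaled)
qed

subsection \<open>Potentials of bounded sets\<close>

lemma set_integrable_bounded:
  fixes f :: "'a::euclidean_space \<Rightarrow> 'b::{banach, second_countable_topology}"
  assumes "B \<in> sets borel" "bounded B" "f \<in> borel_measurable borel" "\<And>x. norm (f x) \<le> C"
  shows "set_integrable lborel B f"
  unfolding set_integrable_def
  using assms emeasure_bounded_finite[OF assms(2)] by (intro integrableI_bounded_set_indicator) auto

lemma
  fixes K :: "'a::euclidean_space \<Rightarrow> 'b::euclidean_space"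
  assumes K [measurable]: "K \<in> borel_measurable borel" and M: "\<And>x. norm (K x) \<le> M"
    and \<psi>: "integrable lborel \<psi>" and B: "B \<in> sets borel" "bounded B"
  shows integrable_set_convolution_inner: "integrable lborel (\<lambda>x. (LINT z:B|lborel. K (x - z)) \<bullet> \<psi> x)"
    and Fubini_set_convolution_inner:
      "(LBINT x. (LINT z:B|lborel. K (x - z)) \<bullet> \<psi> x) = (LINT z:B|lborel. (LBINT x. K (x - z) \<bullet> \<psi> x))"
    and set_integrable_convolution_inner: "set_integrable lborel B (\<lambda>z. LBINT x. K (x - z) \<bullet> \<psi> x)"
proof -
  have [measurable]: "\<psi> \<in> borel_measurable borel" "B \<in> sets borel" using \<psi> B by (auto dest: borel_measurable_integrable)
  have "integrable (lborel \<Otimes>\<^sub>M lborel) (\<lambda>(z, x). (M * indicator B z) *\<^sub>R norm (\<psi> x))"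
  proof (rule lborel_pair.Fubini_integrable)
    have "integrable lborel (indicat_real B)"
      using B emeasure_bounded_finite[OF B(2)] by (intro integrable_real_indicator) auto
    then show "integrable lborel (\<lambda>z. LBINT x. norm (case (z, x) of (z, x) \<Rightarrow> (M * indicator B z) *\<^sub>R norm (\<psi> x)))"
      by (simp add: abs_mult)
  qed (use \<psi> in auto)
  then have dom: "integrable (lborel \<Otimes>\<^sub>M lborel) (\<lambda>(z, x). indicator B z *\<^sub>R (K (x - z) \<bullet> \<psi> x))"
  proof (rule Bochner_Integration.integrable_bound)
    have "\<bar>K y \<bullet> \<psi> x\<bar> \<le> M * norm (\<psi> x)" for x y
      by (rule order_trans[OF Cauchy_Schwarz_ineq2]) (intro mult_right_mono M, simp)
    then have "norm (case y of (z, x) \<Rightarrow> indicator B z *\<^sub>R (K (x - z) \<bullet> \<psi> x))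
        \<le> norm (case y of (z, x) \<Rightarrow> (M * indicator B z) *\<^sub>R norm (\<psi> x))" for y
      by (cases y) (auto simp: indicator_def intro: order_trans[OF _ abs_ge_self])
    then show "AE y in lborel \<Otimes>\<^sub>M lborel. norm (case y of (z, x) \<Rightarrow> indicator B z *\<^sub>R (K (x - z) \<bullet> \<psi> x))
        \<le> norm (case y of (z, x) \<Rightarrow> (M * indicator B z) *\<^sub>R norm (\<psi> x))"
      by simp
  qed measurable
  have inner: "(LINT z:B|lborel. K (x - z)) \<bullet> \<psi> x = (LBINT z. indicator B z *\<^sub>R (K (x - z) \<bullet> \<psi> x))" for x
  proof -
    have "set_integrable lborel B (\<lambda>z. K (x - z))"
      by (rule set_integrable_bounded[OF B _ M]) measurable
    then show ?thesis
      unfolding set_lebesgue_integral_def set_integrable_def by (simp flip: integral_inner_left)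
  qed
  show "integrable lborel (\<lambda>x. (LINT z:B|lborel. K (x - z)) \<bullet> \<psi> x)"
    unfolding inner using lborel_pair.integrable_snd[OF dom] by simp
  show "(LBINT x. (LINT z:B|lborel. K (x - z)) \<bullet> \<psi> x) = (LINT z:B|lborel. (LBINT x. K (x - z) \<bullet> \<psi> x))"
    unfolding inner using lborel_pair.Fubini_integral[OF dom] by (simp add: set_lebesgue_integral_def)
  show "set_integrable lborel B (\<lambda>z. LBINT x. K (x - z) \<bullet> \<psi> x)"
    using lborel_pair.integrable_fst[OF dom] by (simp add: set_integrable_def)
qed

definition yukawa_pot :: "real \<Rightarrow> real \<Rightarrow> (real^3) set \<Rightarrow> real^3 \<Rightarrow> real" where
  "yukawa_pot k e B x = (1 / (4 * pi)) * (LINT z:B|lborel. yukawa k e (x - z))"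

definition yukawa_pot_grad :: "real \<Rightarrow> real \<Rightarrow> (real^3) set \<Rightarrow> real^3 \<Rightarrow> real^3" where
  "yukawa_pot_grad k e B x = (1 / (4 * pi)) *\<^sub>R (LINT z:B|lborel. yukawa_grad k e (x - z))"

definition yukawa_pot_src :: "real \<Rightarrow> real \<Rightarrow> (real^3) set \<Rightarrow> real^3 \<Rightarrow> real" where
  "yukawa_pot_src k e B x = (1 / (4 * pi)) * (LINT z:B|lborel. yukawa_src k e (x - z))"

lemma set_integrable_yukawa:
  assumes e: "e > 0" and k: "k \<ge> 0" and B: "B \<in> sets borel" "bounded B"
  shows "set_integrable lborel B (\<lambda>z. yukawa k e (x - z))" "set_integrable lborel B (\<lambda>z. yukawa k e (z - x))"
proof -
  obtain M where M: "\<And>x. \<bar>yukawa k e x\<bar> \<le> M" using yukawa_bounded[OF e k] by metis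
  have [measurable]: "yukawa k e \<in> borel_measurable borel"
    using C1_grad_measurable[OF C1_grad_yukawa[OF e]] by auto
  show "set_integrable lborel B (\<lambda>z. yukawa k e (x - z))" "set_integrable lborel B (\<lambda>z. yukawa k e (z - x))"
    by (rule set_integrable_bounded[OF B, of _ M]; simp add: M)+
qed

lemma C1_grad_yukawa_pot:
  assumes e: "e > 0" and k: "k \<ge> 0" and B: "B \<in> sets borel" "bounded B"
  shows "C1_grad (yukawa_pot k e B) (yukawa_pot_grad k e B)"
proof -
  obtain M where M: "\<And>x. \<bar>yukawa k e x\<bar> \<le> M" "\<And>x. norm (yukawa_grad k e x) \<le> M"
    using yukawa_bounded[OF e k] by metis
  have "integrable lborel (indicat_real B)"
    using B emeasure_bounded_finite[OF B(2)] by (intro integrable_real_indicator) auto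
  from C1_grad_cmult[OF C1_grad_convolution[OF this C1_grad_yukawa[OF e] M], of "1 / (4 * pi)"]
  show ?thesis
    by (simp add: yukawa_pot_def[abs_def] yukawa_pot_grad_def[abs_def] set_lebesgue_integral_def)
qed

lemma energy_form_yukawa_pot:
  assumes e: "e > 0" and k: "k \<ge> 0" and B: "B \<in> sets borel" "bounded B" and \<phi>: "C1c U \<phi> \<phi>'"
  shows "energy_form k (yukawa_pot k e B) (yukawa_pot_grad k e B) \<phi> \<phi>' = (LBINT x. yukawa_pot_src k e B x * \<phi> x)"
proof -
  obtain M where M: "\<And>x. norm (yukawa k e x) \<le> M" "\<And>x. norm (yukawa_grad k e x) \<le> M" "\<And>x. norm (yukawa_src k e x) \<le> M"
    using yukawa_bounded[OF e k] unfolding real_norm_def by metis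
  note meas = C1_grad_measurable[OF C1_grad_yukawa[OF e, of k]]
  let ?Y = "\<lambda>x. LINT z:B|lborel. yukawa k e (x - z)" and ?Y' = "\<lambda>x. LINT z:B|lborel. yukawa_grad k e (x - z)"
  let ?S = "\<lambda>x. LINT z:B|lborel. yukawa_src k e (x - z)"
  note grad = meas(2) M(2) C1c_integrable(2)[OF \<phi>] B and pot = meas(1) M(1) C1c_integrable(1)[OF \<phi>] B
    and src = yukawa_src_measurable M(3) C1c_integrable(1)[OF \<phi>] B
  have "(LBINT x. ?Y' x \<bullet> \<phi>' x + k\<^sup>2 * (?Y x \<bullet> \<phi> x)) = (LBINT x. ?Y' x \<bullet> \<phi>' x) + k\<^sup>2 * (LBINT x. ?Y x \<bullet> \<phi> x)"
    using integrable_set_convolution_inner[OF grad] integrable_set_convolution_inner[OF pot] by simp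
  also have "\<dots> = (LINT z:B|lborel. (LBINT x. yukawa_grad k e (x - z) \<bullet> \<phi>' x) + k\<^sup>2 * (LBINT x. yukawa k e (x - z) \<bullet> \<phi> x))"
    unfolding Fubini_set_convolution_inner[OF grad] Fubini_set_convolution_inner[OF pot]
    using set_integrable_convolution_inner[OF grad] set_integrable_convolution_inner[OF pot]
    by (simp add: set_integral_add)
  also have "\<dots> = (LINT z:B|lborel. (LBINT x. yukawa_src k e (x - z) \<bullet> \<phi> x))"
  proof (intro set_lebesgue_integral_cong allI impI)
    fix z
    have "(LBINT x. yukawa_grad k e (x - z) \<bullet> \<phi>' x) + k\<^sup>2 * (LBINT x. yukawa k e (x - z) \<bullet> \<phi> x)
        = energy_form k (\<lambda>x. yukawa k e (x - z)) (\<lambda>x. yukawa_grad k e (x - z)) \<phi> \<phi>'"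
      using integrable_continuous_mult_C1c[OF C1_grad_cont[OF C1_grad_shift[OF C1_grad_yukawa[OF e, of k], of z]] \<phi>]
      by (simp add: energy_form_def mult.assoc)
    then show "(LBINT x. yukawa_grad k e (x - z) \<bullet> \<phi>' x) + k\<^sup>2 * (LBINT x. yukawa k e (x - z) \<bullet> \<phi> x)
        = (LBINT x. yukawa_src k e (x - z) \<bullet> \<phi> x)"
      by (simp add: energy_form_yukawa[OF e \<phi>])
  qed (use B in simp)
  also have "\<dots> = (LBINT x. ?S x \<bullet> \<phi> x)"
    by (rule Fubini_set_convolution_inner[OF src, symmetric])
  finally have unscaled: "(LBINT x. ?Y' x \<bullet> \<phi>' x + k\<^sup>2 * (?Y x \<bullet> \<phi> x)) = (LBINT x. ?S x \<bullet> \<phi> x)" .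
  have "energy_form k (yukawa_pot k e B) (yukawa_pot_grad k e B) \<phi> \<phi>' = (1 / (4 * pi)) * energy_form k ?Y ?Y' \<phi> \<phi>'"
    unfolding yukawa_pot_def[abs_def] yukawa_pot_grad_def[abs_def] by (rule energy_form_cmult)
  also have "\<dots> = (1 / (4 * pi)) * (LBINT x. ?S x * \<phi> x)"
    using unscaled by (simp add: energy_form_def mult.assoc)
  also have "\<dots> = (LBINT x. yukawa_pot_src k e B x * \<phi> x)"
    by (simp add: yukawa_pot_src_def mult.assoc)
  finally show ?thesis .
qed

lemma
  assumes e: "e > 0" and k: "k \<ge> 0" and B: "B \<in> sets borel" "bounded B"
  defines "mass \<equiv> LBINT y. yukawa_src k e y"
    and "r \<equiv> \<lambda>x. LBINT y. yukawa_src k e y *\<^sub>R (indicat_real B (x - y) - indicat_real B x)"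
  shows yukawa_pot_src_eq: "yukawa_pot_src k e B x = (1 / (4 * pi)) *\<^sub>R r x + (mass / (4 * pi)) *\<^sub>R indicat_real B x"
    and square_integrable_yukawa_pot_src_remainder: "square_integrable lborel r"
    and L2_norm_yukawa_pot_src_remainder_le:
      "(L2_norm lborel r)\<^sup>2 \<le> mass * (LBINT y. yukawa_src k e y * (L2_modulus (indicat_real B) y)\<^sup>2)"
    and square_integrable_yukawa_pot_src: "square_integrable lborel (yukawa_pot_src k e B)"
proof -
  let ?f = "indicat_real B" and ?S = "yukawa_src k e"
  have f: "square_integrable lborel ?f"
    using B emeasure_bounded_finite[OF B(2)] by (intro square_integrable_indicator) auto
  note [measurable] = square_integrable_measurable[OF f]
  note S = integrable_yukawa_src[OF e k] yukawa_src_nonneg[OF e k]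
  show r: "square_integrable lborel r" "(L2_norm lborel r)\<^sup>2 \<le> mass * (LBINT y. ?S y * (L2_modulus ?f y)\<^sup>2)"
    using L2_norm_averaged_difference_le[OF f S] by (auto simp: r_def mass_def)
  show eq: "yukawa_pot_src k e B x = (1 / (4 * pi)) *\<^sub>R r x + (mass / (4 * pi)) *\<^sub>R ?f x" for x
  proof -
    have "integrable lborel (\<lambda>y. ?S (x - y) *\<^sub>R ?f y)" for x
      by (rule Bochner_Integration.integrable_bound[OF integrable_translate(3)[OF S(1), of x]], measurable)
         (auto simp: indicator_def)
    from convolution_diff_eq[OF S(1) this] have "(LBINT y. ?S (x - y) * ?f y) - mass * ?f x = r x"
      by (simp add: r_def mass_def)
    then have "(LBINT y. ?f y * ?S (x - y)) = r x + mass * ?f x"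
      by (simp add: mult.commute)
    then show ?thesis
      by (simp add: yukawa_pot_src_def set_lebesgue_integral_def add_divide_distrib)
  qed
  show "square_integrable lborel (yukawa_pot_src k e B)"
    unfolding eq[abs_def] by (intro square_integrable_add square_integrable_cmult r f)
qed

lemma yukawa_pot_src_tendsto:
  assumes k: "k \<ge> 0" and B: "B \<in> sets borel" "bounded B" and X: "X \<longlonglongrightarrow> 0" "\<And>n. X n > 0"
  shows "(\<lambda>n. L2_norm lborel (\<lambda>x. yukawa_pot_src k (X n) B x - indicator B x)) \<longlonglongrightarrow> 0"
proof -
  let ?f = "indicat_real B" and ?S = "\<lambda>n. yukawa_src k (X n)"
  have f: "square_integrable lborel ?f"
    using B emeasure_bounded_finite[OF B(2)] by (intro square_integrable_indicator) auto
  note [measurable] = L2_modulus_measurable[OF f]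
  define mass where "mass n = (LBINT y. ?S n y)" for n
  define r where "r n x = (LBINT y. ?S n y *\<^sub>R (?f (x - y) - ?f x))" for n x
  note eq = yukawa_pot_src_eq[OF X(2) k B, folded r_def mass_def]
  note r = square_integrable_yukawa_pot_src_remainder[OF X(2) k B, folded r_def]
    L2_norm_yukawa_pot_src_remainder_le[OF X(2) k B, folded r_def mass_def]
  have mass: "mass \<longlonglongrightarrow> 4 * pi"
    unfolding mass_def[abs_def] using yukawa_src_tendsto_dirac[OF k X, of "\<lambda>_. 1" 1] by simp
  have "isCont (\<lambda>y. (L2_modulus ?f y)\<^sup>2) 0"
    unfolding isCont_def using L2_modulus_tendsto_0[OF f] by (auto intro!: tendsto_eq_intros)
  moreover have "\<bar>(L2_modulus ?f y)\<^sup>2\<bar> \<le> (2 * L2_norm lborel ?f)\<^sup>2" for y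
    using power_mono[OF L2_modulus_le[OF f, of y] L2_modulus_nonneg, of 2] by simp
  ultimately have "(\<lambda>n. LBINT y. ?S n y * (L2_modulus ?f y)\<^sup>2) \<longlonglongrightarrow> 4 * pi * (L2_modulus ?f 0)\<^sup>2"
    by (intro yukawa_src_tendsto_dirac[OF k X]) measurable
  from tendsto_mult[OF mass this] have "(\<lambda>n. mass n * (LBINT y. ?S n y * (L2_modulus ?f y)\<^sup>2)) \<longlonglongrightarrow> 0"
    by simp
  then have "(\<lambda>n. (L2_norm lborel (r n))\<^sup>2) \<longlonglongrightarrow> 0"
    by (rule Lim_null_comparison[rotated]) (simp add: r(2))
  then have r_lim: "(\<lambda>n. L2_norm lborel (r n)) \<longlonglongrightarrow> 0"
    by simp
  show "(\<lambda>n. L2_norm lborel (\<lambda>x. yukawa_pot_src k (X n) B x - ?f x)) \<longlonglongrightarrow> 0"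
  proof (rule Lim_null_comparison, intro always_eventually allI)
    fix n
    have "(\<lambda>x. yukawa_pot_src k (X n) B x - ?f x) = (\<lambda>x. (1 / (4 * pi)) *\<^sub>R r n x + (mass n / (4 * pi) - 1) *\<^sub>R ?f x)"
      by (simp add: eq algebra_simps)
    then show "norm (L2_norm lborel (\<lambda>x. yukawa_pot_src k (X n) B x - ?f x))
        \<le> (1 / (4 * pi)) * L2_norm lborel (r n) + \<bar>mass n / (4 * pi) - 1\<bar> * L2_norm lborel ?f"
      using L2_norm_triangle_ineq[OF square_integrable_cmult[OF r(1)[of n], of "1 / (4 * pi)"]
          square_integrable_cmult[OF f, of "mass n / (4 * pi) - 1"]]
      by (simp only: L2_norm_cmult real_norm_def abs_of_nonneg L2_norm_nonneg abs_divide abs_one abs_mult abs_numeral pi_ge_zero)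
    have "(\<lambda>n. (1 / (4 * pi)) * L2_norm lborel (r n) + \<bar>mass n / (4 * pi) - 1\<bar> * L2_norm lborel ?f)
        \<longlonglongrightarrow> (1 / (4 * pi)) * 0 + \<bar>(4 * pi) / (4 * pi) - 1\<bar> * L2_norm lborel ?f"
      by (intro tendsto_intros r_lim mass) simp
    then show "(\<lambda>n. (1 / (4 * pi)) * L2_norm lborel (r n) + \<bar>mass n / (4 * pi) - 1\<bar> * L2_norm lborel ?f) \<longlonglongrightarrow> 0"
      by simp
  qed
qed

lemma set_integral_yukawa_pot_commute:
  assumes e: "e > 0" and k: "k \<ge> 0" and A: "A \<in> sets borel" "bounded A" and B: "B \<in> sets borel" "bounded B"
  shows "(LINT x:A|lborel. yukawa_pot k e B x) = (LINT x:B|lborel. yukawa_pot k e A x)"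
proof -
  obtain M where M: "\<And>x. norm (yukawa k e x) \<le> M" using yukawa_bounded[OF e k] unfolding real_norm_def by metis
  have meas: "yukawa k e \<in> borel_measurable borel" by (rule C1_grad_measurable(1)[OF C1_grad_yukawa[OF e]])
  have "integrable lborel (indicat_real A)"
    using A emeasure_bounded_finite[OF A(2)] by (intro integrable_real_indicator) auto
  from Fubini_set_convolution_inner[OF meas M this B]
  have "(LINT x:A|lborel. (LINT z:B|lborel. yukawa k e (x - z))) = (LINT z:B|lborel. (LINT x:A|lborel. yukawa k e (x - z)))"
    by (simp add: set_lebesgue_integral_def mult.commute)
  also have "\<dots> = (LINT z:B|lborel. (LINT x:A|lborel. yukawa k e (z - x)))"
    using yukawa_uminus[of k e "_ - _"] by simp
  finally show ?thesis by (simp add: yukawa_pot_def[abs_def])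
qed

lemma yukawa_pot_nonneg: "e > 0 \<Longrightarrow> 0 \<le> yukawa_pot k e B x"
  unfolding yukawa_pot_def set_lebesgue_integral_def using yukawa_pos[of e k]
  by (intro mult_nonneg_nonneg integral_nonneg_AE AE_I2) (auto simp: less_imp_le)

lemma
  fixes f :: "'a::euclidean_space \<Rightarrow> real"
  assumes B: "B \<in> sets borel" "bounded B" and f: "set_integrable lborel B f"
  shows set_integral_le_measure_mult: "(\<And>x. x \<in> B \<Longrightarrow> f x \<le> c) \<Longrightarrow> (LINT x:B|lborel. f x) \<le> measure lborel B * c"
    and measure_mult_le_set_integral: "A \<in> sets borel \<Longrightarrow> A \<subseteq> B \<Longrightarrow> (\<And>x. x \<in> B \<Longrightarrow> 0 \<le> f x) \<Longrightarrow> (\<And>x. x \<in> A \<Longrightarrow> c \<le> f x) \<Longrightarrow>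
      measure lborel A * c \<le> (LINT x:B|lborel. f x)"
proof -
  have const: "set_integrable lborel A (\<lambda>_. c)" "(LINT x:A|lborel. c) = measure lborel A * c"
    if "A \<in> sets borel" "A \<subseteq> B" for A
    using that emeasure_bounded_finite[OF bounded_subset[OF B(2) that(2)]]
    by (auto intro: set_integrable_bounded[OF that(1) bounded_subset[OF B(2) that(2)]] simp: set_integral_const)
  show "(LINT x:B|lborel. f x) \<le> measure lborel B * c" if "\<And>x. x \<in> B \<Longrightarrow> f x \<le> c"
    using set_integral_mono[OF f const(1)[OF B(1) order_refl] that] by (simp add: const(2)[OF B(1) order_refl])
  assume A: "A \<in> sets borel" "A \<subseteq> B" and f_ge: "\<And>x. x \<in> B \<Longrightarrow> 0 \<le> f x" "\<And>x. x \<in> A \<Longrightarrow> c \<le> f x"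
  have "(LINT x:A|lborel. c) \<le> (LINT x:B|lborel. f x)"
    unfolding set_lebesgue_integral_def
    using const(1)[OF A] f A f_ge
    by (intro integral_mono) (auto simp: set_integrable_def indicator_def)
  then show "measure lborel A * c \<le> (LINT x:B|lborel. f x)" by (simp add: const(2)[OF A])
qed

lemma yukawa_pot_le:
  assumes e: "e > 0" and k: "k \<ge> 0" and B: "B \<in> sets borel" "bounded B" and c: "\<And>z. z \<in> B \<Longrightarrow> yukawa k e (x - z) \<le> c"
  shows "yukawa_pot k e B x \<le> measure lborel B * c / (4 * pi)"
  using set_integral_le_measure_mult[OF B set_integrable_yukawa(1)[OF e k B] c]
  by (simp add: yukawa_pot_def divide_right_mono)

lemma yukawa_pot_ge:
  assumes e: "e > 0" and k: "k \<ge> 0" and B: "B \<in> sets borel" "bounded B"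
    and A: "A \<in> sets borel" "A \<subseteq> B" and c: "\<And>z. z \<in> A \<Longrightarrow> c \<le> yukawa k e (x - z)"
  shows "measure lborel A * c / (4 * pi) \<le> yukawa_pot k e B x"
  using measure_mult_le_set_integral[OF B set_integrable_yukawa(1)[OF e k B] A less_imp_le[OF yukawa_pos[OF e]] c]
  by (simp add: yukawa_pot_def divide_right_mono)

lemma yukawa_pot_at_infinity:
  assumes e: "e > 0" and k: "k \<ge> 0" and B: "B \<in> sets borel" "bounded B"
  shows "(yukawa_pot k e B \<longlongrightarrow> 0) at_infinity"
proof -
  obtain R where R: "\<And>z. z \<in> B \<Longrightarrow> norm z \<le> R" using B(2) unfolding bounded_iff by blast
  show ?thesis
  proof (rule tendsto_0_at_infinity_of_le_inverse)
    fix x :: "real^3" assume x: "norm x > R"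
    have "yukawa_pot k e B x \<le> measure lborel B * (1 / (norm x - R)) / (4 * pi)"
      using yukawa_le_inverse[OF e k R x] by (intro yukawa_pot_le[OF e k B])
    then show "\<bar>yukawa_pot k e B x\<bar> \<le> (measure lborel B / (4 * pi)) / (norm x - R)"
      using yukawa_pot_nonneg[OF e, of k B x] by (simp add: mult.commute)
  qed
qed

lemma indicator_mult_yukawa_le:
  assumes "e > 0" "k \<ge> 0" "x \<noteq> 0"
  shows "\<bar>indicat_real A z * yukawa k e x\<bar> \<le> exp (- k * norm x) / norm x"
  using assms yukawa_le[of k "norm x" "norm x" e x] yukawa_pos[OF assms(1), of k x]
  by (simp add: norm_le_reg_norm indicator_def)

lemma AE_lborel_diff_neq_0: "AE z in lborel. x - z \<noteq> (0 :: 'a::euclidean_space)"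
  using AE_lborel_singleton[of x] by eventually_elim auto

lemma yukawa_pot_tendsto_vsol:
  assumes k: "k > 0" and A: "A \<in> sets borel" and X: "X \<longlonglongrightarrow> 0" "\<And>n. X n > 0"
  shows "(\<lambda>n. yukawa_pot k (X n) A x) \<longlonglongrightarrow> vsol (indicator A) x k"
proof -
  let ?G = "\<lambda>x::real^3. exp (- k * norm x) / norm x"
  have [measurable]: "A \<in> sets borel" "yukawa k (X n) \<in> borel_measurable borel" for n
    using A C1_grad_measurable[OF C1_grad_yukawa[OF X(2)]] by auto
  have vsol: "vsol (indicator A) x k = (1 / (4 * pi)) * (LINT z:A|lborel. ?G (x - z))"
    by (simp add: vsol_def set_lebesgue_integral_def dist_norm mult.commute)
  show ?thesis
    unfolding vsol yukawa_pot_def set_lebesgue_integral_def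
  proof (intro tendsto_mult tendsto_const integral_dominated_convergence[OF _ _ integrable_translate(3)[OF yukawa_integrable[OF k], of x]])
    show "AE z in lborel. (\<lambda>n. indicat_real A z *\<^sub>R yukawa k (X n) (x - z)) \<longlonglongrightarrow> indicat_real A z *\<^sub>R ?G (x - z)"
      using AE_lborel_diff_neq_0[of x] by eventually_elim (intro tendsto_intros yukawa_tendsto X)
    show "AE z in lborel. norm (indicat_real A z *\<^sub>R yukawa k (X n) (x - z)) \<le> ?G (x - z)" for n
      using AE_lborel_diff_neq_0[of x]
    proof eventually_elim
      case (elim z)
      then show ?case using indicator_mult_yukawa_le[OF X(2)[of n], of k "x - z" A z] k by simp
    qed
  qed measurable
qed

lemma yukawa_pot_le_integral:
  assumes k: "k > 0" and e: "e > 0" and A: "A \<in> sets borel" "bounded A"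
  shows "yukawa_pot k e A x \<le> (1 / (4 * pi)) * (LBINT z::real^3. exp (- k * norm z) / norm z)"
proof -
  let ?G = "\<lambda>x::real^3. exp (- k * norm x) / norm x"
  have k0: "k \<ge> 0" using k by simp
  have "(LINT z:A|lborel. yukawa k e (x - z)) \<le> (LBINT z. ?G (x - z))"
    unfolding set_lebesgue_integral_def
  proof (rule integral_mono_AE[OF _ integrable_translate(3)[OF yukawa_integrable[OF k]]])
    show "integrable lborel (\<lambda>z. indicat_real A z *\<^sub>R yukawa k e (x - z))"
      using set_integrable_yukawa(1)[OF e k0 A] by (simp add: set_integrable_def)
    show "AE z in lborel. indicat_real A z *\<^sub>R yukawa k e (x - z) \<le> ?G (x - z)"
      using AE_lborel_diff_neq_0[of x]
    proof eventually_elim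
      case (elim z)
      then show ?case using abs_le_D1[OF indicator_mult_yukawa_le[OF e k0, of "x - z" A z]] by simp
    qed
  qed
  also have "\<dots> = (LBINT z. ?G z)" by (rule integral_translate(3)[of ?G]) measurable
  finally show ?thesis by (simp add: yukawa_pot_def divide_right_mono)
qed

lemma set_integral_yukawa_pot_tendsto:
  assumes k: "k > 0" and A: "A \<in> sets borel" "bounded A" and B: "B \<in> sets borel" "bounded B"
    and X: "X \<longlonglongrightarrow> 0" "\<And>n. X n > 0"
  shows "(\<lambda>n. LINT x:B|lborel. yukawa_pot k (X n) A x) \<longlonglongrightarrow> (LINT x:B|lborel. vsol (indicator A) x k)"
  unfolding set_lebesgue_integral_def
proof (rule integral_dominated_convergence)
  let ?C = "(1 / (4 * pi)) * (LBINT z::real^3. exp (- k * norm z) / norm z)"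
  have k0: "k \<ge> 0" using k by simp
  note lim = yukawa_pot_tendsto_vsol[OF k A(1) X]
  have [measurable]: "B \<in> sets borel" "yukawa_pot k (X n) A \<in> borel_measurable borel" for n
    using B(1) C1_grad_measurable(1)[OF C1_grad_yukawa_pot[OF X(2) k0 A]] by auto
  have [measurable]: "(\<lambda>x. vsol (indicator A) x k) \<in> borel_measurable borel"
    using lim by (rule borel_measurable_LIMSEQ_metric[rotated]) measurable
  show "(\<lambda>x. indicator B x *\<^sub>R vsol (indicator A) x k) \<in> borel_measurable lborel"
    and "(\<lambda>x. indicator B x *\<^sub>R yukawa_pot k (X n) A x) \<in> borel_measurable lborel" for n
    by measurable
  show "integrable lborel (\<lambda>x. indicator B x *\<^sub>R ?C)"
    using set_integrable_bounded[OF B borel_measurable_const order_refl] by (simp only: set_integrable_def)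
  show "AE x in lborel. (\<lambda>n. indicator B x *\<^sub>R yukawa_pot k (X n) A x) \<longlonglongrightarrow> indicator B x *\<^sub>R vsol (indicator A) x k"
    by (intro AE_I2 tendsto_intros lim)
  show "AE x in lborel. norm (indicat_real B x *\<^sub>R yukawa_pot k (X n) A x) \<le> indicator B x *\<^sub>R ?C" for n
    using yukawa_pot_le_integral[OF k X(2)[of n] A] yukawa_pot_nonneg[OF X(2), of k n A] by (auto simp: indicator_def)
qed

section \<open>From the wave equation to an elliptic problem\<close>

lemma AE_snd_neq: "AE z in lborel. snd (z :: 'a::euclidean_space \<times> real) \<noteq> c"
  unfolding lborel_prod[symmetric]
proof (rule lborel_pair.AE_pair_measure)
  show "{z \<in> space (lborel \<Otimes>\<^sub>M lborel). snd z \<noteq> c} \<in> sets ((lborel :: 'a measure) \<Otimes>\<^sub>M (lborel :: real measure))"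
    by measurable
qed (simp add: AE_lborel_singleton)

lemma square_integrable_tensor:
  fixes c :: "'b::euclidean_space \<Rightarrow> real" and \<psi> :: "'a::euclidean_space \<Rightarrow> 'c::euclidean_space"
  assumes c: "square_integrable lborel c" and \<psi>: "square_integrable lborel \<psi>"
  shows "square_integrable lborel (\<lambda>z. c (snd z) *\<^sub>R \<psi> (fst z))"
  unfolding square_integrable_def lborel_prod[symmetric]
proof
  note [measurable] = square_integrable_measurable[OF c] square_integrable_measurable[OF \<psi>]
  show "(\<lambda>z. c (snd z) *\<^sub>R \<psi> (fst z)) \<in> borel_measurable (lborel \<Otimes>\<^sub>M lborel)"
    by measurable
  show "integrable (lborel \<Otimes>\<^sub>M lborel) (\<lambda>z. (norm (c (snd z) *\<^sub>R \<psi> (fst z)))\<^sup>2)"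
  proof (rule lborel_pair.Fubini_integrable)
    show "integrable lborel (\<lambda>x. LBINT t. norm ((norm (c (snd (x, t)) *\<^sub>R \<psi> (fst (x, t))))\<^sup>2))"
      using square_integrableD[OF \<psi>] by (simp add: power_mult_distrib)
    show "AE x in lborel. integrable lborel (\<lambda>t. (norm (c (snd (x, t)) *\<^sub>R \<psi> (fst (x, t))))\<^sup>2)"
      using square_integrableD[OF c] by (simp add: power_mult_distrib)
  qed measurable
qed

lemma C1c_tensor:
  fixes \<phi> :: "'a::euclidean_space \<Rightarrow> real" and \<psi> :: "'b::euclidean_space \<Rightarrow> real"
  assumes \<phi>: "C1c U \<phi> \<phi>'" and \<psi>: "C1c V \<psi> \<psi>'"
  shows "C1c (U \<times> V) (\<lambda>z. \<phi> (fst z) * \<psi> (snd z)) (\<lambda>z. (\<psi> (snd z) *\<^sub>R \<phi>' (fst z), \<phi> (fst z) *\<^sub>R \<psi>' (snd z)))"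
proof -
  obtain S where S: "compact S" "S \<subseteq> U" "\<And>x. x \<notin> S \<Longrightarrow> \<phi> x = 0"
    using C1c_support[OF \<phi>] by metis
  obtain S' where S': "compact S'" "S' \<subseteq> V" "\<And>x. x \<notin> S' \<Longrightarrow> \<psi> x = 0"
    using C1c_support[OF \<psi>] by metis
  show ?thesis
    by (rule C1cI[OF C1_grad_tensor[OF \<phi>[THEN C1c_imp_C1_grad] \<psi>[THEN C1c_imp_C1_grad]] compact_Times[OF S(1) S'(1)]])
       (use S S' in \<open>auto simp: mem_Times_iff\<close>)
qed

definition time_moment :: "(real \<Rightarrow> real) \<Rightarrow> ('a::euclidean_space \<times> real \<Rightarrow> 'b::euclidean_space) \<Rightarrow> 'a \<Rightarrow> 'b" where
  "time_moment c g x = (LBINT t. c t *\<^sub>R g (x, t))"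

lemma
  fixes g :: "'a::euclidean_space \<times> real \<Rightarrow> 'b::euclidean_space"
  assumes c: "square_integrable lborel c" and g: "square_integrable lborel g"
  shows square_integrable_time_moment: "square_integrable lborel (time_moment c g)"
    and L2_norm_time_moment_le: "L2_norm lborel (time_moment c g) \<le> L2_norm lborel c * L2_norm lborel g"
proof -
  have [measurable]: "c \<in> borel_measurable borel" "g \<in> borel_measurable (borel \<Otimes>\<^sub>M borel)"
    using square_integrable_measurable[OF c] square_integrable_measurable[OF g] by (simp_all add: borel_prod)
  have meas: "time_moment c g \<in> borel_measurable lborel"
    unfolding time_moment_def[abs_def] by measurable
  have "(\<integral>\<^sup>+x. ennreal ((norm (time_moment c g x))\<^sup>2) \<partial>lborel)
      \<le> (\<integral>\<^sup>+x. (\<integral>\<^sup>+t. ennreal ((c t)\<^sup>2) \<partial>lborel) * (\<integral>\<^sup>+t. ennreal ((norm (g (x, t)))\<^sup>2) \<partial>lborel) \<partial>lborel)"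
    unfolding time_moment_def by (intro nn_integral_mono norm_integral_scaleR_power2_le) measurable
  also have "\<dots> = (\<integral>\<^sup>+t. ennreal ((c t)\<^sup>2) \<partial>lborel) * (\<integral>\<^sup>+x. \<integral>\<^sup>+t. ennreal ((norm (g (x, t)))\<^sup>2) \<partial>lborel \<partial>lborel)"
    by (rule nn_integral_cmult) measurable
  also have "(\<integral>\<^sup>+x. \<integral>\<^sup>+t. ennreal ((norm (g (x, t)))\<^sup>2) \<partial>lborel \<partial>lborel) = (\<integral>\<^sup>+z. ennreal ((norm (g z))\<^sup>2) \<partial>lborel)"
    unfolding lborel_prod[symmetric] by (rule lborel.nn_integral_fst) measurable
  also have "(\<integral>\<^sup>+t. ennreal ((c t)\<^sup>2) \<partial>lborel) * \<dots> = ennreal ((L2_norm lborel c * L2_norm lborel g)\<^sup>2)"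
    using ennreal_L2_norm_power2[OF c] ennreal_L2_norm_power2[OF g] by (simp add: power_mult_distrib ennreal_mult)
  finally have nn_integral_le: "(\<integral>\<^sup>+x. ennreal ((norm (time_moment c g x))\<^sup>2) \<partial>lborel) \<le> ennreal ((L2_norm lborel c * L2_norm lborel g)\<^sup>2)" .
  show "square_integrable lborel (time_moment c g)" "L2_norm lborel (time_moment c g) \<le> L2_norm lborel c * L2_norm lborel g"
    using square_integrable_L2_norm_le[OF meas _ nn_integral_le] by auto
qed

lemma integral_inner_time_moment:
  fixes g :: "'a::euclidean_space \<times> real \<Rightarrow> 'b::euclidean_space"
  assumes c: "square_integrable lborel c" and g: "square_integrable lborel g" and \<psi>: "square_integrable lborel \<psi>"
  shows "(LBINT x. \<psi> x \<bullet> time_moment c g x) = (LBINT z. (c (snd z) *\<^sub>R \<psi> (fst z)) \<bullet> g z)"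
proof -
  note [measurable] = square_integrable_measurable[OF c] square_integrable_measurable[OF \<psi>]
  have [measurable]: "g \<in> borel_measurable (borel \<Otimes>\<^sub>M borel)"
    using square_integrable_measurable[OF g] by (simp add: borel_prod)
  have [measurable]: "time_moment c g \<in> borel_measurable borel"
    using square_integrable_time_moment[OF c g] by (auto dest: square_integrable_measurable)
  have "integrable (lborel \<Otimes>\<^sub>M lborel) (\<lambda>z. (norm (g z))\<^sup>2)"
    using square_integrableD[OF g] by (simp add: lborel_prod)
  from lborel_pair.AE_integrable_fst'[OF this]
  have "AE x in lborel. integrable lborel (\<lambda>t. c t *\<^sub>R g (x, t))"
  proof eventually_elim
    case (elim x)
    then show ?case
      by (intro integrable_scaleR_square_integrable[OF c]) (simp add: square_integrable_def)
  qed
  then have "AE x in lborel. \<psi> x \<bullet> time_moment c g x = (LBINT t. (c t *\<^sub>R \<psi> x) \<bullet> g (x, t))"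
    by eventually_elim (simp add: time_moment_def flip: integral_inner_right)
  then have "(LBINT x. \<psi> x \<bullet> time_moment c g x) = (LBINT x. LBINT t. (c t *\<^sub>R \<psi> x) \<bullet> g (x, t))"
    by (intro integral_cong_AE) measurable
  also have "\<dots> = (LBINT z. (c (snd z) *\<^sub>R \<psi> (fst z)) \<bullet> g z)"
    using lborel_pair.integral_fst'[of "\<lambda>z. (c (snd z) *\<^sub>R \<psi> (fst z)) \<bullet> g z"]
      integrable_inner_square_integrable[OF square_integrable_tensor[OF c \<psi>] g]
    by (simp add: lborel_prod)
  finally show ?thesis .
qed

lemma integral_time_moment_weight_add:
  fixes g :: "'a::euclidean_space \<times> real \<Rightarrow> 'b::euclidean_space"
  assumes c: "square_integrable lborel c" and d: "square_integrable lborel d"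
    and g: "square_integrable lborel g" and \<psi>: "square_integrable lborel \<psi>"
  shows "(LBINT x. \<psi> x \<bullet> time_moment (\<lambda>t. c t + s * d t) g x)
    = (LBINT x. \<psi> x \<bullet> time_moment c g x) + s * (LBINT x. \<psi> x \<bullet> time_moment d g x)"
proof -
  have "square_integrable lborel (\<lambda>t. c t + s * d t)"
    using square_integrable_add[OF c square_integrable_cmult[OF d, of s]] by simp
  moreover note integrable_inner_square_integrable[OF square_integrable_tensor[OF c \<psi>] g]
    integrable_inner_square_integrable[OF square_integrable_tensor[OF d \<psi>] g]
  ultimately show ?thesis
    using c d g \<psi> by (simp add: integral_inner_time_moment scaleR_add_left inner_add_left mult.assoc)
qed

lemma integral_time_moment_add:
  fixes g h :: "'a::euclidean_space \<times> real \<Rightarrow> 'b::euclidean_space"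
  assumes c: "square_integrable lborel c" and g: "square_integrable lborel g" and h: "square_integrable lborel h"
    and \<psi>: "square_integrable lborel \<psi>"
  shows "(LBINT x. \<psi> x \<bullet> time_moment c (\<lambda>z. s *\<^sub>R g z + h z) x)
    = s * (LBINT x. \<psi> x \<bullet> time_moment c g x) + (LBINT x. \<psi> x \<bullet> time_moment c h x)"
proof -
  have "square_integrable lborel (\<lambda>z. s *\<^sub>R g z + h z)"
    using g h by (intro square_integrable_add square_integrable_cmult)
  moreover note integrable_inner_square_integrable[OF square_integrable_tensor[OF c \<psi>] g]
    integrable_inner_square_integrable[OF square_integrable_tensor[OF c \<psi>] h]
  ultimately show ?thesis
    using c g h \<psi> by (simp add: integral_inner_time_moment inner_add_right)
qed

definition window :: "real \<Rightarrow> (real \<Rightarrow> real) \<Rightarrow> real \<Rightarrow> real" where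
  "window T a t = indicator {0<..<T} t * a t"

lemma
  assumes T: "0 < T" and a: "a \<in> borel_measurable borel" and C: "\<And>t. 0 < t \<Longrightarrow> t < T \<Longrightarrow> \<bar>a t\<bar> \<le> C"
  shows square_integrable_window: "square_integrable lborel (window T a)"
    and L2_norm_window_le: "L2_norm lborel (window T a) \<le> C * sqrt T"
proof -
  have C0: "0 \<le> C" using C[of "T / 2"] T by (auto intro: order_trans[OF abs_ge_zero])
  have meas: "window T a \<in> borel_measurable lborel" unfolding window_def[abs_def] using a by measurable
  have window_le: "norm (window T a t) \<le> C * indicator {0<..<T} t" for t
    using C[of t] by (auto simp: window_def indicator_def)
  show "square_integrable lborel (window T a)" "L2_norm lborel (window T a) \<le> C * sqrt T"
    using square_integrable_le_indicator[OF meas _ _ C0 window_le] L2_norm_le_indicator[OF meas _ _ C0 window_le] T by auto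
qed

lemma square_integrable_window_continuous:
  assumes "0 < T" "continuous_on UNIV a"
  shows "square_integrable lborel (window T a)"
proof -
  have "bounded (a ` {0..T})"
    using assms(2) by (intro compact_imp_bounded compact_continuous_image) (auto elim: continuous_on_subset)
  then obtain C where "\<And>t. t \<in> {0..T} \<Longrightarrow> \<bar>a t\<bar> \<le> C" unfolding bounded_iff by fastforce
  then show ?thesis
    using assms by (intro square_integrable_window[where C = C] borel_measurable_continuous_onI) auto
qed

text \<open>A weight that does not vanish for negative times is cut off there, which changes nothing where \<open>t \<ge> 0\<close>.\<close>

definition left_cut :: "real \<Rightarrow> (real \<Rightarrow> real) \<Rightarrow> real \<Rightarrow> real" where
  "left_cut \<epsilon> a t = a t * cutoff 0 \<epsilon> (- t)"

definition left_cut_deriv :: "real \<Rightarrow> (real \<Rightarrow> real) \<Rightarrow> (real \<Rightarrow> real) \<Rightarrow> real \<Rightarrow> real" where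
  "left_cut_deriv \<epsilon> a a' t = cutoff 0 \<epsilon> (- t) * a' t - a t * cutoff_deriv 0 \<epsilon> (- t)"

lemma left_cut_eq_0: "0 < \<epsilon> \<Longrightarrow> t \<le> - \<epsilon> \<Longrightarrow> left_cut \<epsilon> a t = 0"
  and left_cut_eq: "0 < \<epsilon> \<Longrightarrow> 0 \<le> t \<Longrightarrow> left_cut \<epsilon> a t = a t"
  and left_cut_deriv_eq: "0 < \<epsilon> \<Longrightarrow> 0 \<le> t \<Longrightarrow> left_cut_deriv \<epsilon> a a' t = a' t"
  by (simp_all add: left_cut_def left_cut_deriv_def cutoff_eq_0 cutoff_eq_1 cutoff_deriv_eq_0)

lemma C1c_left_cut:
  assumes \<epsilon>: "0 < \<epsilon>" and a: "C1_grad a a'" "\<And>t. T' \<le> t \<Longrightarrow> a t = 0" and "T' < T"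
  shows "C1c {..<T} (left_cut \<epsilon> a) (left_cut_deriv \<epsilon> a a')"
proof (rule C1cI)
  show "C1_grad (left_cut \<epsilon> a) (left_cut_deriv \<epsilon> a a')"
    using C1_grad_mult[OF a(1) C1_grad_reflect[OF C1_grad_cutoff[OF \<epsilon>], of 0]]
    by (simp add: left_cut_def[abs_def] left_cut_deriv_def[abs_def])
  show "left_cut \<epsilon> a t = 0" if "t \<notin> {- \<epsilon>..T'}" for t
    using that left_cut_eq_0[OF \<epsilon>, of t a] a(2)[of t] by (cases "t \<le> - \<epsilon>") (auto simp: left_cut_def)
qed (use \<open>T' < T\<close> in auto)

lemma left_cut_dominated:
  assumes "continuous_on UNIV a"
  obtains K where "square_integrable lborel K" "\<And>n t. t < T \<Longrightarrow> \<bar>left_cut (1 / real (Suc n)) a t\<bar> \<le> K t"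
proof -
  have "bounded (a ` {- 1..T})"
    using assms by (intro compact_imp_bounded compact_continuous_image) (auto elim: continuous_on_subset)
  then obtain A where A: "\<And>t. t \<in> {- 1..T} \<Longrightarrow> \<bar>a t\<bar> \<le> A" unfolding bounded_iff by fastforce
  define K where "K t = \<bar>A\<bar> * indicator {- 1..T} t" for t
  show ?thesis
  proof (rule that)
    show "square_integrable lborel K"
      by (rule square_integrable_bounded_support[of _ "\<bar>A\<bar>" "{- 1..T}"]) (auto simp: K_def[abs_def] indicator_def)
    fix n t assume "t < T"
    show "\<bar>left_cut (1 / real (Suc n)) a t\<bar> \<le> K t"
    proof (cases "t < - 1")
      case True
      moreover have "1 / real (Suc n) \<le> 1" by simp
      ultimately have "left_cut (1 / real (Suc n)) a t = 0" by (intro left_cut_eq_0) (simp, linarith)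
      then show ?thesis by (simp add: K_def)
    next
      case False
      have "\<bar>left_cut (1 / real (Suc n)) a t\<bar> \<le> \<bar>a t\<bar> * 1"
        using cutoff_bounds[of 0 "1 / real (Suc n)" "- t"] unfolding left_cut_def abs_mult by (intro mult_left_mono) auto
      then show ?thesis using A[of t] \<open>t < T\<close> False by (simp add: K_def)
    qed
  qed
qed

lemma eventually_left_cut_eq:
  assumes "t \<noteq> 0"
  shows "\<forall>\<^sub>F n in sequentially. left_cut (1 / real (Suc n)) a t = indicator {0<..} t * a t"
proof (cases "t > 0")
  case True
  then show ?thesis by (simp add: left_cut_eq)
next
  case False
  then have "- t > 0" using assms by simp
  then have "\<forall>\<^sub>F n in sequentially. 1 / real (Suc n) < - t" by real_asymp
  then show ?thesis by eventually_elim (use False in \<open>simp add: left_cut_eq_0\<close>)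
qed

definition elliptic_approximation ::
  "(real^3) set \<Rightarrow> real \<Rightarrow> (real^3 \<Rightarrow> real) \<Rightarrow> ((real^3) \<times> real \<Rightarrow> real) \<Rightarrow> real \<Rightarrow> real \<Rightarrow>
    (real^3 \<Rightarrow> real) \<Rightarrow> (real^3 \<Rightarrow> real^3) \<Rightarrow> (real^3 \<Rightarrow> real) \<Rightarrow> bool" where
  "elliptic_approximation D T f u \<tau> \<epsilon> W H F \<longleftrightarrow>
     dirichlet_solution (- closure D) \<tau> W H (\<lambda>x. f x + F x) \<and> square_integrable lborel F \<and> L2_norm lborel F \<le> \<epsilon> * \<tau> \<and>
     (\<forall>M\<in>sets borel. bounded M \<longrightarrow>
        \<bar>(LINT x:M|lborel. wlap T u x \<tau>) - (LINT x:M|lborel. W x)\<bar> \<le> \<epsilon> * sqrt (measure lborel M))"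

locale weak_wave =
  fixes D :: "(real^3) set" and T :: real and f :: "real^3 \<Rightarrow> real"
    and u :: "(real^3) \<times> real \<Rightarrow> real" and G :: "(real^3) \<times> real \<Rightarrow> (real^3) \<times> real"
  assumes T_pos: "0 < T"
    and u_eq_0: "\<And>x t. x \<in> closure D \<or> t \<le> 0 \<Longrightarrow> u (x, t) = 0"
    and H1: "H1_on (UNIV \<times> {..<T}) u G"
    and wave_eq: "\<And>\<eta> \<eta>'. C1c ((- closure D) \<times> {..<T}) \<eta> \<eta>' \<Longrightarrow>
      (LINT z:((- closure D) \<times> {0<..<T})|lborel. - (snd (G z) * snd (\<eta>' z)) + fst (G z) \<bullet> fst (\<eta>' z))
        = (LINT x:(- closure D)|lborel. f x * \<eta> (x, 0))"
begin

definition u_slab :: "(real^3) \<times> real \<Rightarrow> real" where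
  "u_slab z = indicator {0<..<T} (snd z) *\<^sub>R u z"

definition grad_slab :: "(real^3) \<times> real \<Rightarrow> real^3" where
  "grad_slab z = indicator {0<..<T} (snd z) *\<^sub>R fst (G z)"

definition dt_slab :: "(real^3) \<times> real \<Rightarrow> real" where
  "dt_slab z = indicator {0<..<T} (snd z) *\<^sub>R snd (G z)"

lemma G_measurable [measurable]: "u \<in> borel_measurable borel" "G \<in> borel_measurable borel"
  using H1 unfolding H1_on_def by auto

lemma indicator_snd_measurable [measurable]:
  "(\<lambda>z::(real^3) \<times> real. indicat_real {a<..<b} (snd z)) \<in> borel_measurable borel"
  "(\<lambda>z::(real^3) \<times> real. indicat_real {..<b} (snd z)) \<in> borel_measurable borel"
  unfolding borel_prod[symmetric] by measurable

lemma square_integrable_half_space: "square_integrable lborel (\<lambda>z. indicator {..<T} (snd z) *\<^sub>R G z)"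
proof (rule square_integrable_bound)
  show "integrable lborel (\<lambda>z. indicator (UNIV \<times> {..<T}) z *\<^sub>R (norm (G z))\<^sup>2)"
    using H1 unfolding H1_on_def set_integrable_def by auto
  show "(norm (indicat_real {..<T} (snd z) *\<^sub>R G z))\<^sup>2 \<le> indicator (UNIV \<times> {..<T}) z *\<^sub>R (norm (G z))\<^sup>2" for z
    by (cases z) (simp add: indicator_def)
qed simp

lemma square_integrable_slab:
  "square_integrable lborel u_slab" "square_integrable lborel grad_slab" "square_integrable lborel dt_slab"
proof -
  show "square_integrable lborel u_slab"
  proof (rule square_integrable_bound)
    show "integrable lborel (\<lambda>z. indicator (UNIV \<times> {..<T}) z *\<^sub>R (u z)\<^sup>2)"
      using H1 unfolding H1_on_def set_integrable_def by auto
    show "(norm (u_slab z))\<^sup>2 \<le> indicator (UNIV \<times> {..<T}) z *\<^sub>R (u z)\<^sup>2" for z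
      by (cases z) (auto simp: u_slab_def indicator_def)
  qed (simp add: u_slab_def[abs_def])
  have "square_integrable lborel (\<lambda>z. indicat_real {0<..<T} (snd z) *\<^sub>R G z)"
  proof (rule square_integrable_bound[OF _ square_integrableD[OF square_integrable_half_space]])
    show "(norm (indicat_real {0<..<T} (snd z) *\<^sub>R G z))\<^sup>2 \<le> (norm (indicat_real {..<T} (snd z) *\<^sub>R G z))\<^sup>2" for z
      by (simp add: indicator_def)
  qed simp
  from square_integrable_bounded_linear[OF bounded_linear_fst this]
    square_integrable_bounded_linear[OF bounded_linear_snd this]
  show "square_integrable lborel grad_slab" "square_integrable lborel dt_slab"
    by (simp_all add: grad_slab_def[abs_def] dt_slab_def[abs_def])
qed

lemma integral_half_space_left_cut_tendsto:
  assumes a: "C1_grad a a'" "\<And>t. T' \<le> t \<Longrightarrow> a t = 0" and "T' < T" and \<phi>: "C1c UNIV \<phi> \<phi>'"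
  shows "(\<lambda>n. LINT z:(UNIV \<times> {..<T})|lborel. (G z \<bullet> h) * (\<phi> (fst z) * left_cut (1 / real (Suc n)) a (snd z)))
    \<longlonglongrightarrow> (LBINT z. (grad_slab z \<bullet> fst h + dt_slab z * snd h) * (\<phi> (fst z) * a (snd z)))"
proof -
  let ?U = "UNIV \<times> {..<T} :: ((real^3) \<times> real) set"
  let ?cut = "\<lambda>n. left_cut (1 / real (Suc n)) a"
  obtain K where sqK: "square_integrable lborel K" and cut_le: "\<And>n t. t < T \<Longrightarrow> \<bar>?cut n t\<bar> \<le> K t"
    using left_cut_dominated[OF C1_grad_cont(1)[OF a(1)]] by blast
  have [measurable]: "\<phi> \<in> borel_measurable borel" "a \<in> borel_measurable borel" "?cut n \<in> borel_measurable borel" for n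
    using C1_grad_measurable(1)[OF C1c_imp_C1_grad[OF \<phi>]] C1_grad_measurable(1)[OF a(1)]
      C1_grad_measurable(1)[OF C1c_imp_C1_grad[OF C1c_left_cut[OF _ a \<open>T' < T\<close>, of "1 / real (Suc n)"]]] by auto
  note sqK = square_integrable_tensor[OF sqK square_integrable_norm[OF C1c_integrable(3)[OF \<phi>]]]
  define g where "g z = norm (indicat_real {..<T} (snd z) *\<^sub>R G z) * norm h" for z
  have sqg: "square_integrable lborel g"
    using square_integrable_cmult[OF square_integrable_norm[OF square_integrable_half_space], of "norm h"]
    by (simp add: g_def[abs_def] mult.commute)
  have [measurable]: "G \<in> borel_measurable (borel \<Otimes>\<^sub>M borel)" "grad_slab \<in> borel_measurable (borel \<Otimes>\<^sub>M borel)"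
      "dt_slab \<in> borel_measurable (borel \<Otimes>\<^sub>M borel)"
    using square_integrable_slab[THEN square_integrable_measurable] by (simp_all add: borel_prod)
  have indicator_U: "indicat_real ?U z = indicat_real {..<T} (snd z)" for z by (cases z) (simp add: indicator_def)
  show ?thesis
    unfolding set_lebesgue_integral_def
  proof (rule integral_dominated_convergence[OF _ _ integrable_mult_square_integrable[OF sqg sqK]])
    show "(\<lambda>z. indicat_real ?U z *\<^sub>R ((G z \<bullet> h) * (\<phi> (fst z) * ?cut n (snd z)))) \<in> borel_measurable lborel" for n
      unfolding indicator_U measurable_lborel2 borel_prod[symmetric] by measurable
    show "(\<lambda>z. (grad_slab z \<bullet> fst h + dt_slab z * snd h) * (\<phi> (fst z) * a (snd z))) \<in> borel_measurable lborel"
      unfolding measurable_lborel2 borel_prod[symmetric] by measurable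
    show "AE z in lborel. norm (indicat_real ?U z *\<^sub>R ((G z \<bullet> h) * (\<phi> (fst z) * ?cut n (snd z)))) \<le> g z * (K (snd z) *\<^sub>R norm (\<phi> (fst z)))" for n
    proof (rule AE_I2)
      fix z
      have "\<bar>G z \<bullet> h\<bar> * (\<bar>\<phi> (fst z)\<bar> * \<bar>?cut n (snd z)\<bar>) \<le> (norm (G z) * norm h) * (\<bar>\<phi> (fst z)\<bar> * K (snd z))" if "snd z < T"
        using cut_le[OF that] by (intro mult_mono Cauchy_Schwarz_ineq2 mult_left_mono) auto
      then show "norm (indicat_real ?U z *\<^sub>R ((G z \<bullet> h) * (\<phi> (fst z) * ?cut n (snd z)))) \<le> g z * (K (snd z) *\<^sub>R norm (\<phi> (fst z)))"
        unfolding indicator_U by (auto simp: g_def indicator_def abs_mult mult_ac)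
    qed
    show "AE z in lborel. (\<lambda>n. indicat_real ?U z *\<^sub>R ((G z \<bullet> h) * (\<phi> (fst z) * ?cut n (snd z)))) \<longlonglongrightarrow>
        (grad_slab z \<bullet> fst h + dt_slab z * snd h) * (\<phi> (fst z) * a (snd z))"
      using AE_snd_neq[of 0]
    proof eventually_elim
      case (elim z)
      have "\<forall>\<^sub>F n in sequentially. ?cut n (snd z) = indicator {0<..} (snd z) * a (snd z)"
        by (rule eventually_left_cut_eq[OF elim])
      then show ?case
        by (intro tendsto_eventually, eventually_elim)
           (auto simp: mem_Times_iff grad_slab_def dt_slab_def indicator_def inner_prod_def)
    qed
  qed
qed

lemma integral_by_parts_slab:
  assumes a: "C1_grad a a'" "\<And>t. T' \<le> t \<Longrightarrow> a t = 0" and "T' < T" and \<phi>: "C1c UNIV \<phi> \<phi>'"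
  shows "(LBINT z. u_slab z * (a (snd z) * (\<phi>' (fst z) \<bullet> fst h) + \<phi> (fst z) * a' (snd z) * snd h))
    = - (LBINT z. (grad_slab z \<bullet> fst h + dt_slab z * snd h) * (\<phi> (fst z) * a (snd z)))" (is "?L = - ?R")
proof -
  let ?U = "UNIV \<times> {..<T} :: ((real^3) \<times> real) set"
  define \<epsilon> where "\<epsilon> n = 1 / real (Suc n)" for n
  have \<epsilon>: "0 < \<epsilon> n" for n by (simp add: \<epsilon>_def)
  have "(LINT z:?U|lborel. (G z \<bullet> h) * (\<phi> (fst z) * left_cut (\<epsilon> n) a (snd z))) = - ?L" for n
  proof -
    let ?\<psi>' = "\<lambda>z. (left_cut (\<epsilon> n) a (snd z) *\<^sub>R \<phi>' (fst z), \<phi> (fst z) *\<^sub>R left_cut_deriv (\<epsilon> n) a a' (snd z))"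
    have "C1c ?U (\<lambda>z. \<phi> (fst z) * left_cut (\<epsilon> n) a (snd z)) ?\<psi>'"
      by (rule C1c_tensor[OF \<phi> C1c_left_cut[OF \<epsilon> a \<open>T' < T\<close>]])
    then have "(LINT z:?U|lborel. u z * (?\<psi>' z \<bullet> h)) = - (LINT z:?U|lborel. (G z \<bullet> h) * (\<phi> (fst z) * left_cut (\<epsilon> n) a (snd z)))"
      using H1 unfolding H1_on_def C1c_on_iff_C1c by blast
    moreover have "(LINT z:?U|lborel. u z * (?\<psi>' z \<bullet> h)) = ?L"
      unfolding set_lebesgue_integral_def
    proof (intro Bochner_Integration.integral_cong refl)
      fix z :: "(real^3) \<times> real"
      show "indicat_real ?U z *\<^sub>R (u z * (?\<psi>' z \<bullet> h))
          = u_slab z * (a (snd z) * (\<phi>' (fst z) \<bullet> fst h) + \<phi> (fst z) * a' (snd z) * snd h)"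
        using u_eq_0[of "fst z" "snd z"] left_cut_eq[OF \<epsilon>, of "snd z" n a] left_cut_deriv_eq[OF \<epsilon>, of "snd z" n a a']
        by (cases z; cases "snd z \<le> 0") (auto simp: u_slab_def indicator_def inner_prod_def)
    qed
    ultimately show ?thesis by simp
  qed
  then have "(\<lambda>n. - ?L) \<longlonglongrightarrow> ?R"
    using integral_half_space_left_cut_tendsto[OF a \<open>T' < T\<close> \<phi>, of h] by (simp add: \<epsilon>_def)
  then show ?thesis by (simp add: LIMSEQ_const_iff)
qed

lemma weak_grad_time_moment:
  assumes a: "C1_grad a a'" "\<And>t. T' \<le> t \<Longrightarrow> a t = 0" and "T' < T"
  shows "weak_grad (time_moment (window T a) u_slab) (time_moment (window T a) grad_slab)"
  unfolding weak_grad_def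
proof (intro conjI allI impI)
  note w = square_integrable_window_continuous[OF T_pos C1_grad_cont(1)[OF a(1)]]
  note slab = square_integrable_slab
  show "square_integrable lborel (time_moment (window T a) u_slab)" "square_integrable lborel (time_moment (window T a) grad_slab)"
    using w slab by (auto intro: square_integrable_time_moment)
  fix \<phi> :: "real^3 \<Rightarrow> real" and \<phi>' and h :: "real^3" assume \<phi>: "C1c UNIV \<phi> \<phi>'"
  have sq_grad: "square_integrable lborel (\<lambda>x. \<phi>' x \<bullet> h)"
    by (rule square_integrable_bounded_linear[OF bounded_linear_inner_left C1c_integrable(4)[OF \<phi>]])
  have sq_test: "square_integrable lborel (\<lambda>x. \<phi> x *\<^sub>R h)"
    by (rule square_integrable_bounded_linear[OF bounded_linear_scaleR_left C1c_integrable(3)[OF \<phi>]])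
  have "(LBINT x. time_moment (window T a) u_slab x * (\<phi>' x \<bullet> h)) = (LBINT x. (\<phi>' x \<bullet> h) \<bullet> time_moment (window T a) u_slab x)"
    by (simp add: mult.commute)
  also have "\<dots> = (LBINT z. u_slab z * (a (snd z) * (\<phi>' (fst z) \<bullet> fst (h, 0 :: real)) + \<phi> (fst z) * a' (snd z) * snd (h, 0 :: real)))"
    unfolding integral_inner_time_moment[OF w slab(1) sq_grad]
    by (intro Bochner_Integration.integral_cong refl) (simp add: window_def u_slab_def indicator_def)
  also have "\<dots> = - (LBINT z. (grad_slab z \<bullet> fst (h, 0 :: real) + dt_slab z * snd (h, 0 :: real)) * (\<phi> (fst z) * a (snd z)))"
    by (rule integral_by_parts_slab[OF a \<open>T' < T\<close> \<phi>])
  also have "(LBINT z. (grad_slab z \<bullet> fst (h, 0 :: real) + dt_slab z * snd (h, 0 :: real)) * (\<phi> (fst z) * a (snd z)))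
      = (LBINT x. (\<phi> x *\<^sub>R h) \<bullet> time_moment (window T a) grad_slab x)"
    unfolding integral_inner_time_moment[OF w slab(2) sq_test]
    by (intro Bochner_Integration.integral_cong refl) (simp add: window_def grad_slab_def indicator_def inner_commute)
  also have "\<dots> = (LBINT x. (time_moment (window T a) grad_slab x \<bullet> h) * \<phi> x)"
    by (simp add: inner_commute mult.commute)
  finally show "(LBINT x. time_moment (window T a) u_slab x * (\<phi>' x \<bullet> h))
      = - (LBINT x. (time_moment (window T a) grad_slab x \<bullet> h) * \<phi> x)" .
qed

lemma time_moment_by_parts:
  assumes a: "C1_grad a a'" "\<And>t. T' \<le> t \<Longrightarrow> a t = 0" and "T' < T" and \<phi>: "C1c UNIV \<phi> \<phi>'"
  shows "(LBINT x. \<phi> x \<bullet> time_moment (window T a') u_slab x) = - (LBINT x. \<phi> x \<bullet> time_moment (window T a) dt_slab x)"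
proof -
  note w = C1_grad_cont[OF a(1), THEN square_integrable_window_continuous[OF T_pos]]
  note slab = square_integrable_slab and sq\<phi> = C1c_integrable(3)[OF \<phi>]
  have "(LBINT x. \<phi> x \<bullet> time_moment (window T a') u_slab x)
      = (LBINT z. u_slab z * (a (snd z) * (\<phi>' (fst z) \<bullet> fst (0 :: real^3, 1 :: real)) + \<phi> (fst z) * a' (snd z) * snd (0 :: real^3, 1 :: real)))"
    unfolding integral_inner_time_moment[OF w(2) slab(1) sq\<phi>]
    by (intro Bochner_Integration.integral_cong refl) (simp add: window_def u_slab_def indicator_def)
  also have "\<dots> = - (LBINT z. (grad_slab z \<bullet> fst (0 :: real^3, 1 :: real) + dt_slab z * snd (0 :: real^3, 1 :: real)) * (\<phi> (fst z) * a (snd z)))"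
    by (rule integral_by_parts_slab[OF a \<open>T' < T\<close> \<phi>])
  also have "(LBINT z. (grad_slab z \<bullet> fst (0 :: real^3, 1 :: real) + dt_slab z * snd (0 :: real^3, 1 :: real)) * (\<phi> (fst z) * a (snd z)))
      = (LBINT x. \<phi> x \<bullet> time_moment (window T a) dt_slab x)"
    unfolding integral_inner_time_moment[OF w(1) slab(3) sq\<phi>]
    by (intro Bochner_Integration.integral_cong refl) (simp add: window_def dt_slab_def indicator_def)
  finally show ?thesis .
qed

lemma time_moment_wave_eq:
  assumes a: "C1_grad a a'" "\<And>t. T' \<le> t \<Longrightarrow> a t = 0" and "T' < T" and \<phi>: "C1c (- closure D) \<phi> \<phi>'"
  shows "(LBINT x. \<phi>' x \<bullet> time_moment (window T a) grad_slab x) - (LBINT x. \<phi> x \<bullet> time_moment (window T a') dt_slab x)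
    = a 0 * (LBINT x. f x * \<phi> x)"
proof -
  note w = C1_grad_cont[OF a(1), THEN square_integrable_window_continuous[OF T_pos]]
  note slab = square_integrable_slab and sq\<phi> = C1c_integrable(3,4)[OF \<phi>]
  obtain S where S: "S \<subseteq> - closure D" "\<And>x. x \<notin> S \<Longrightarrow> \<phi> x = 0" "\<And>x. x \<notin> S \<Longrightarrow> \<phi>' x = 0"
    using C1c_support[OF \<phi>] by metis
  then have out: "\<phi> x = 0" "\<phi>' x = 0" if "x \<in> closure D" for x using that by auto
  let ?\<eta>' = "\<lambda>z. (left_cut 1 a (snd z) *\<^sub>R \<phi>' (fst z), \<phi> (fst z) *\<^sub>R left_cut_deriv 1 a a' (snd z))"
  let ?F = "\<lambda>z. (window T a (snd z) *\<^sub>R \<phi>' (fst z)) \<bullet> grad_slab z"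
  let ?E = "\<lambda>z. (window T a' (snd z) *\<^sub>R \<phi> (fst z)) \<bullet> dt_slab z"
  have "(LBINT x. \<phi>' x \<bullet> time_moment (window T a) grad_slab x) - (LBINT x. \<phi> x \<bullet> time_moment (window T a') dt_slab x)
      = (LBINT z. ?F z - ?E z)"
    unfolding integral_inner_time_moment[OF w(1) slab(2) sq\<phi>(2)] integral_inner_time_moment[OF w(2) slab(3) sq\<phi>(1)]
    using integrable_inner_square_integrable[OF square_integrable_tensor[OF w(1) sq\<phi>(2)] slab(2)]
      integrable_inner_square_integrable[OF square_integrable_tensor[OF w(2) sq\<phi>(1)] slab(3)] by simp
  also have "\<dots> = (LINT z:((- closure D) \<times> {0<..<T})|lborel. - (snd (G z) * snd (?\<eta>' z)) + fst (G z) \<bullet> fst (?\<eta>' z))"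
    unfolding set_lebesgue_integral_def
  proof (intro Bochner_Integration.integral_cong refl)
    fix z :: "(real^3) \<times> real"
    show "?F z - ?E z = indicat_real ((- closure D) \<times> {0<..<T}) z *\<^sub>R (- (snd (G z) * snd (?\<eta>' z)) + fst (G z) \<bullet> fst (?\<eta>' z))"
      using out[of "fst z"] left_cut_eq[of 1 "snd z" a] left_cut_deriv_eq[of 1 "snd z" a a']
      by (cases z; cases "fst z \<in> closure D"; cases "snd z \<in> {0<..<T}")
         (auto simp: indicator_def window_def grad_slab_def dt_slab_def inner_commute)
  qed
  also have "\<dots> = (LINT x:(- closure D)|lborel. f x * (\<phi> (fst (x, 0 :: real)) * left_cut 1 a (snd (x, 0 :: real))))"
    by (rule wave_eq[OF C1c_tensor[OF \<phi> C1c_left_cut[OF zero_less_one a \<open>T' < T\<close>]]])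
  also have "\<dots> = (LBINT x. a 0 * (f x * \<phi> x))"
    unfolding set_lebesgue_integral_def using out(1)
    by (intro Bochner_Integration.integral_cong refl) (auto simp: left_cut_eq indicator_def)
  finally show ?thesis by simp
qed

text \<open>The Laplace transform with weight \<open>a t = exp (- \<tau> t) \<theta> t\<close> instead of \<open>exp (- \<tau> t)\<close>, where \<open>\<theta>\<close> cuts off smoothly before
  time \<open>T\<close>: no trace of \<open>u\<close> or \<open>\<partial>u/\<partial>t\<close> at time \<open>T\<close> is needed, and \<open>b = a' + \<tau> a\<close> lives after the cutoff time.\<close>

lemma energy_form_time_moment:
  assumes a: "C1_grad a (\<lambda>t. b t - \<tau> * a t)" "\<And>t. T' \<le> t \<Longrightarrow> a t = 0" "a 0 = 1" and "T' < T"
    and b: "continuous_on UNIV b" and f: "square_integrable lborel f" and \<phi>: "C1c (- closure D) \<phi> \<phi>'"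
  shows "energy_form \<tau> (time_moment (window T a) u_slab) (time_moment (window T a) grad_slab) \<phi> \<phi>'
    = (LBINT x. (f x + time_moment (window T b) (\<lambda>z. \<tau> *\<^sub>R u_slab z + dt_slab z) x) * \<phi> x)"
proof -
  let ?P = "\<lambda>c g. LBINT x. \<phi> x \<bullet> time_moment (window T c) g x"
  let ?F = "time_moment (window T b) (\<lambda>z. \<tau> *\<^sub>R u_slab z + dt_slab z)"
  note slab = square_integrable_slab and sq\<phi> = C1c_integrable(3)[OF \<phi>]
  have w: "square_integrable lborel (window T a)" "square_integrable lborel (window T b)"
    using C1_grad_cont(1)[OF a(1)] b by (auto intro: square_integrable_window_continuous[OF T_pos])
  note sq = square_integrable_time_moment[OF w(1) slab(1)] square_integrable_time_moment[OF w(1) slab(2)]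
    square_integrable_time_moment[OF w(2) square_integrable_add[OF square_integrable_cmult[OF slab(1), of \<tau>] slab(3)]]
  have "window T (\<lambda>t. b t - \<tau> * a t) = (\<lambda>t. window T b t + (- \<tau>) * window T a t)"
    by (simp add: window_def fun_eq_iff algebra_simps)
  then have expand: "?P (\<lambda>t. b t - \<tau> * a t) g = ?P b g - \<tau> * ?P a g" if "square_integrable lborel g" for g
    using integral_time_moment_weight_add[OF w(2,1) that sq\<phi>, of "- \<tau>"] by simp
  have "(LBINT x. \<phi>' x \<bullet> time_moment (window T a) grad_slab x) = (LBINT x. f x * \<phi> x) + (?P b dt_slab - \<tau> * ?P a dt_slab)"
    using time_moment_wave_eq[OF a(1,2) \<open>T' < T\<close> \<phi>] unfolding a(3) expand[OF slab(3)] by simp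
  moreover have "?P b u_slab - \<tau> * ?P a u_slab = - ?P a dt_slab"
    using time_moment_by_parts[OF a(1,2) \<open>T' < T\<close> C1c_mono[OF \<phi>]] unfolding expand[OF slab(1)] by simp
  then have "?P a dt_slab = \<tau> * ?P a u_slab - ?P b u_slab" by simp
  then have "\<tau> * ?P a dt_slab = \<tau> * (\<tau> * ?P a u_slab) - \<tau> * ?P b u_slab"
    by (simp only: right_diff_distrib)
  moreover have "(LBINT x. \<phi> x \<bullet> ?F x) = \<tau> * ?P b u_slab + ?P b dt_slab"
    by (rule integral_time_moment_add[OF w(2) slab(1,3) sq\<phi>])
  ultimately have "(LBINT x. \<phi>' x \<bullet> time_moment (window T a) grad_slab x) + \<tau>\<^sup>2 * ?P a u_slab
      = (LBINT x. f x * \<phi> x) + (LBINT x. \<phi> x \<bullet> ?F x)"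
    by (simp add: power2_eq_square)
  moreover have "energy_form \<tau> (time_moment (window T a) u_slab) (time_moment (window T a) grad_slab) \<phi> \<phi>'
      = (LBINT x. \<phi>' x \<bullet> time_moment (window T a) grad_slab x) + \<tau>\<^sup>2 * ?P a u_slab"
    using integrable_inner_square_integrable[OF sq(2) C1c_integrable(4)[OF \<phi>]] integrable_mult_square_integrable[OF sq(1) sq\<phi>]
    by (simp add: energy_form_def inner_commute mult.commute[of _ "\<phi> _"] mult.assoc mult.left_commute[of _ "\<tau>\<^sup>2"])
  moreover have "(LBINT x. (f x + ?F x) * \<phi> x) = (LBINT x. f x * \<phi> x) + (LBINT x. \<phi> x \<bullet> ?F x)"
    using integrable_mult_square_integrable[OF f sq\<phi>] integrable_mult_square_integrable[OF sq(3) sq\<phi>]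
    by (simp add: distrib_right mult.commute[of "\<phi> _"])
  ultimately show ?thesis by simp
qed

lemma dirichlet_solution_time_moment:
  assumes D: "open D" "bounded D" "C2_boundary D" and f: "square_integrable lborel f"
    and a: "C1_grad a (\<lambda>t. b t - \<tau> * a t)" "\<And>t. T' \<le> t \<Longrightarrow> a t = 0" "a 0 = 1" and "T' < T" and b: "continuous_on UNIV b"
  shows "dirichlet_solution (- closure D) \<tau> (time_moment (window T a) u_slab) (time_moment (window T a) grad_slab)
    (\<lambda>x. f x + time_moment (window T b) (\<lambda>z. \<tau> *\<^sub>R u_slab z + dt_slab z) x)"
  unfolding dirichlet_solution_def
proof (intro conjI allI impI)
  show "H1_0 (- closure D) (time_moment (window T a) u_slab) (time_moment (window T a) grad_slab)"
  proof (rule weak_grad_H1_0[OF D(1,2)])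
    show "\<exists>r>0. exterior_cone D p r" if "p \<in> frontier D" for p
      using C2_boundary_exterior_cone[OF D(3) that] by blast
    show "weak_grad (time_moment (window T a) u_slab) (time_moment (window T a) grad_slab)"
      by (rule weak_grad_time_moment[OF a(1,2) \<open>T' < T\<close>])
    show "time_moment (window T a) u_slab x = 0" if "x \<in> closure D" for x
      using u_eq_0 that by (simp add: time_moment_def u_slab_def)
  qed
qed (rule energy_form_time_moment[OF a \<open>T' < T\<close> b f])

lemma wlap_eq_time_moment: "wlap T u x \<tau> = time_moment (window T (\<lambda>t. exp (- \<tau> * t))) u_slab x"
  unfolding wlap_def time_moment_def set_lebesgue_integral_def
proof (rule integral_cong_AE)
  have "u \<in> borel_measurable (borel \<Otimes>\<^sub>M borel)" by (simp add: borel_prod)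
  from measurable_Pair2[OF this] have [measurable]: "(\<lambda>t. u (x, t)) \<in> borel_measurable borel" by simp
  show "(\<lambda>t. indicat_real {0..T} t *\<^sub>R (exp (- \<tau> * t) * u (x, t))) \<in> borel_measurable lborel" by measurable
  show "(\<lambda>t. window T (\<lambda>t. exp (- \<tau> * t)) t *\<^sub>R u_slab (x, t)) \<in> borel_measurable lborel"
    unfolding window_def u_slab_def by measurable
  show "AE t in lborel. indicat_real {0..T} t *\<^sub>R (exp (- \<tau> * t) * u (x, t)) = window T (\<lambda>t. exp (- \<tau> * t)) t *\<^sub>R u_slab (x, t)"
    using AE_lborel_singleton[of T]
    by eventually_elim (use u_eq_0 in \<open>auto simp: window_def u_slab_def indicator_def\<close>)
qed

lemma set_integral_wlap_diff_le:
  assumes "\<tau> \<ge> 0" and \<theta>: "continuous_on UNIV \<theta>" "\<And>t. 0 \<le> \<theta> t" "\<And>t. \<theta> t \<le> 1" "\<And>t. t \<le> T1 \<Longrightarrow> \<theta> t = 1"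
    and M: "M \<in> sets borel" "bounded M"
  shows "\<bar>(LINT x:M|lborel. wlap T u x \<tau>) - (LINT x:M|lborel. time_moment (window T (\<lambda>t. exp (- \<tau> * t) * \<theta> t)) u_slab x)\<bar>
    \<le> sqrt (measure lborel M) * (exp (- \<tau> * T1) * sqrt T * L2_norm lborel u_slab)"
proof -
  let ?a = "window T (\<lambda>t. exp (- \<tau> * t) * \<theta> t)" and ?e = "window T (\<lambda>t. exp (- \<tau> * t))"
  let ?r = "window T (\<lambda>t. exp (- \<tau> * t) * (1 - \<theta> t))"
  note u = square_integrable_slab(1)
  have M': "M \<in> sets lborel" "emeasure lborel M < \<infinity>" using M emeasure_bounded_finite by auto
  note sqM = square_integrable_indicator[OF M']
  have cont: "continuous_on UNIV (\<lambda>t. exp (- \<tau> * t))" "continuous_on UNIV (\<lambda>t. exp (- \<tau> * t) * \<theta> t)"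
      "continuous_on UNIV (\<lambda>t. exp (- \<tau> * t) * (1 - \<theta> t))"
    using \<theta>(1) by (auto intro!: continuous_intros)
  note w = cont[THEN square_integrable_window_continuous[OF T_pos]]
  have "?r = (\<lambda>t. ?e t + (- 1) * ?a t)"
    by (simp add: window_def fun_eq_iff algebra_simps)
  then have "(LINT x:M|lborel. time_moment ?r u_slab x) = (LINT x:M|lborel. wlap T u x \<tau>) - (LINT x:M|lborel. time_moment ?a u_slab x)"
    using integral_time_moment_weight_add[OF w(1,2) u sqM, of "- 1"]
    by (simp add: set_lebesgue_integral_def wlap_eq_time_moment)
  moreover have "\<bar>LINT x:M|lborel. time_moment ?r u_slab x\<bar> \<le> sqrt (measure lborel M) * L2_norm lborel (time_moment ?r u_slab)"
    by (rule abs_set_integral_le_L2_norm[OF square_integrable_time_moment[OF w(3) u] M'])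
  moreover have "L2_norm lborel (time_moment ?r u_slab) \<le> exp (- \<tau> * T1) * sqrt T * L2_norm lborel u_slab"
  proof (rule order_trans[OF L2_norm_time_moment_le[OF w(3) u]], intro mult_right_mono L2_norm_window_le[OF T_pos])
    fix t
    have "exp (- \<tau> * t) * (1 - \<theta> t) \<le> exp (- \<tau> * T1) * 1"
    proof (cases "T1 \<le> t")
      case True
      then have "exp (- \<tau> * t) \<le> exp (- \<tau> * T1)" using \<open>\<tau> \<ge> 0\<close> by (simp add: mult_left_mono)
      then show ?thesis using \<theta>(2,3)[of t] by (intro mult_mono) auto
    qed (use \<theta>(4)[of t] in simp)
    then show "\<bar>exp (- \<tau> * t) * (1 - \<theta> t)\<bar> \<le> exp (- \<tau> * T1)"
      using \<theta>(3)[of t] by (simp add: abs_mult)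
  qed (use cont in \<open>auto intro: borel_measurable_continuous_onI\<close>)
  ultimately show ?thesis
    using mult_left_mono[of "L2_norm lborel (time_moment ?r u_slab)" _ "sqrt (measure lborel M)"] by fastforce
qed

lemma L2_norm_source_le:
  assumes "\<tau> \<ge> 1" and \<theta>': "continuous_on UNIV \<theta>'" "\<And>t. \<bar>\<theta>' t\<bar> \<le> K" "\<And>t. t \<le> T1 \<Longrightarrow> \<theta>' t = 0"
  shows "square_integrable lborel (time_moment (window T (\<lambda>t. exp (- \<tau> * t) * \<theta>' t)) (\<lambda>z. \<tau> *\<^sub>R u_slab z + dt_slab z))"
    and "L2_norm lborel (time_moment (window T (\<lambda>t. exp (- \<tau> * t) * \<theta>' t)) (\<lambda>z. \<tau> *\<^sub>R u_slab z + dt_slab z))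
      \<le> sqrt T * K * (L2_norm lborel u_slab + L2_norm lborel dt_slab) * \<tau> * exp (- \<tau> * T1)"
proof -
  let ?b = "\<lambda>t. exp (- \<tau> * t) * \<theta>' t" and ?g = "\<lambda>z. \<tau> *\<^sub>R u_slab z + dt_slab z"
  note slab = square_integrable_slab
  have g: "square_integrable lborel ?g" by (intro square_integrable_add square_integrable_cmult slab)
  have cont: "continuous_on UNIV ?b" using \<theta>'(1) by (intro continuous_intros)
  have w: "square_integrable lborel (window T ?b)" by (rule square_integrable_window_continuous[OF T_pos cont])
  show "square_integrable lborel (time_moment (window T ?b) ?g)"
    by (rule square_integrable_time_moment[OF w g])
  have K: "0 \<le> K" using \<theta>'(2)[of 0] by (auto intro: order_trans[OF abs_ge_zero])
  have "\<bar>?b t\<bar> \<le> exp (- \<tau> * T1) * K" for t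
  proof (cases "T1 \<le> t")
    case True
    then have "exp (- \<tau> * t) \<le> exp (- \<tau> * T1)" using \<open>\<tau> \<ge> 1\<close> by (simp add: mult_left_mono)
    then show ?thesis using \<theta>'(2)[of t] unfolding abs_mult by (intro mult_mono) auto
  qed (use \<theta>'(3)[of t] K in simp)
  then have window: "L2_norm lborel (window T ?b) \<le> exp (- \<tau> * T1) * K * sqrt T"
    using cont by (intro L2_norm_window_le[OF T_pos] borel_measurable_continuous_onI)
  have "L2_norm lborel ?g \<le> \<tau> * L2_norm lborel u_slab + L2_norm lborel dt_slab"
    using L2_norm_triangle_ineq[OF square_integrable_cmult[OF slab(1), of \<tau>] slab(3)] \<open>\<tau> \<ge> 1\<close>
    unfolding L2_norm_cmult by simp
  also have "\<dots> \<le> \<tau> * (L2_norm lborel u_slab + L2_norm lborel dt_slab)"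
    using mult_right_mono[OF \<open>\<tau> \<ge> 1\<close> L2_norm_nonneg[of lborel dt_slab]] by (simp add: distrib_left)
  finally have "L2_norm lborel ?g \<le> \<tau> * (L2_norm lborel u_slab + L2_norm lborel dt_slab)" .
  then have "L2_norm lborel (time_moment (window T ?b) ?g)
      \<le> exp (- \<tau> * T1) * K * sqrt T * (\<tau> * (L2_norm lborel u_slab + L2_norm lborel dt_slab))"
    using K T_pos by (intro order_trans[OF L2_norm_time_moment_le[OF w g]] mult_mono window) auto
  then show "L2_norm lborel (time_moment (window T ?b) ?g)
      \<le> sqrt T * K * (L2_norm lborel u_slab + L2_norm lborel dt_slab) * \<tau> * exp (- \<tau> * T1)"
    by (simp add: mult_ac)
qed

lemma elliptic_approximation_exists:
  assumes D: "open D" "bounded D" "C2_boundary D" and f: "square_integrable lborel f" and T1: "0 < T1" "T1 < T"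
  obtains C where "\<And>\<tau>. \<tau> \<ge> 1 \<Longrightarrow> \<exists>W H F. elliptic_approximation D T f u \<tau> (C * exp (- \<tau> * T1)) W H F"
proof -
  define T' where "T' = (T1 + T) / 2"
  have T': "T1 < T'" "T' < T" using T1 by (auto simp: T'_def)
  let ?\<theta> = "cutoff T1 T'" and ?\<theta>' = "cutoff_deriv T1 T'"
  note \<theta> = C1_grad_cutoff[OF T'(1)]
  define C where "C = max (sqrt T * (4 / (T' - T1)) * (L2_norm lborel u_slab + L2_norm lborel dt_slab)) (sqrt T * L2_norm lborel u_slab)"
  show ?thesis
  proof (rule that)
    fix \<tau> :: real assume \<tau>: "\<tau> \<ge> 1"
    let ?a = "\<lambda>t. exp (- \<tau> * t) * ?\<theta> t" and ?b = "\<lambda>t. exp (- \<tau> * t) * ?\<theta>' t"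
    let ?W = "time_moment (window T ?a) u_slab" and ?H = "time_moment (window T ?a) grad_slab"
    let ?F = "time_moment (window T ?b) (\<lambda>z. \<tau> *\<^sub>R u_slab z + dt_slab z)"
    have "C1_grad (\<lambda>t. exp (- \<tau> * t)) (\<lambda>t. - \<tau> * exp (- \<tau> * t))"
      unfolding C1_grad_real_iff by (auto intro!: derivative_eq_intros continuous_intros)
    from C1_grad_mult[OF this \<theta>] have a: "C1_grad ?a (\<lambda>t. ?b t - \<tau> * ?a t)"
      by (simp add: algebra_simps)
    have a0: "?a t = 0" if "T' \<le> t" for t using cutoff_eq_0(1)[OF T'(1) that] by simp
    have sol: "dirichlet_solution (- closure D) \<tau> ?W ?H (\<lambda>x. f x + ?F x)"
      using C1_grad_cont(2)[OF \<theta>] T1 T'(1)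
      by (intro dirichlet_solution_time_moment[OF D f a a0 _ T'(2)] continuous_intros) (simp_all add: cutoff_eq_1)
    note source = L2_norm_source_le[where ?T1.0 = T1, OF \<tau> C1_grad_cont(2)[OF \<theta>] abs_cutoff_deriv_le[OF T'(1)] cutoff_deriv_eq_0[OF T'(1)]]
    have "sqrt T * (4 / (T' - T1)) * (L2_norm lborel u_slab + L2_norm lborel dt_slab) \<le> C"
      by (simp add: C_def)
    then have "L2_norm lborel ?F \<le> C * \<tau> * exp (- \<tau> * T1)"
      using \<tau> by (intro order_trans[OF source(2)] mult_right_mono) auto
    moreover have "\<bar>(LINT x:M|lborel. wlap T u x \<tau>) - (LINT x:M|lborel. ?W x)\<bar> \<le> C * exp (- \<tau> * T1) * sqrt (measure lborel M)"
      if M: "M \<in> sets borel" "bounded M" for M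
    proof -
      have "\<bar>(LINT x:M|lborel. wlap T u x \<tau>) - (LINT x:M|lborel. ?W x)\<bar>
          \<le> sqrt (measure lborel M) * (exp (- \<tau> * T1) * sqrt T * L2_norm lborel u_slab)"
        using \<tau> by (intro set_integral_wlap_diff_le C1_grad_cont(1)[OF \<theta>] cutoff_bounds cutoff_eq_1[OF T'(1)] M) auto
      also have "\<dots> = (sqrt T * L2_norm lborel u_slab) * (exp (- \<tau> * T1) * sqrt (measure lborel M))"
        by (simp add: mult_ac)
      also have "\<dots> \<le> C * (exp (- \<tau> * T1) * sqrt (measure lborel M))"
        by (intro mult_right_mono) (auto simp: C_def)
      finally show ?thesis by (simp add: mult.assoc)
    qed
    ultimately have "elliptic_approximation D T f u \<tau> (C * exp (- \<tau> * T1)) ?W ?H ?F"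
      using sol source(1) by (simp add: elliptic_approximation_def mult_ac)
    then show "\<exists>W H F. elliptic_approximation D T f u \<tau> (C * exp (- \<tau> * T1)) W H F"
      by blast
  qed
qed

end

lemma wave_weak_sol_imp_weak_wave:
  assumes "wave_weak_sol D T f u" "0 < T"
  obtains G where "weak_wave D T f u G"
  using assms unfolding wave_weak_sol_def weak_wave_def C1c_on_iff_C1c by blast

section \<open>Barriers\<close>

text \<open>With \<open>\<sigma> = 1\<close> a barrier bounds the indicator function from below, with \<open>\<sigma> = -1\<close> from above.\<close>

definition barrier ::
  "(real^3) set \<Rightarrow> (real^3) set \<Rightarrow> real \<Rightarrow> real \<Rightarrow> (real^3 \<Rightarrow> real) \<Rightarrow> (real^3 \<Rightarrow> real^3) \<Rightarrow> bool" where
  "barrier D B k \<sigma> g g' \<longleftrightarrow> supersolution (- closure D) k g g' (\<lambda>x. 0) \<and> (g \<longlongrightarrow> 0) at_infinity \<and>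
     (\<forall>\<^sub>F e in at_right 0. \<forall>x\<in>closure D. 0 \<le> \<sigma> * yukawa_pot k e B x + g x)"

lemma set_integrable_continuous_bounded:
  fixes f :: "'a::euclidean_space \<Rightarrow> 'b::euclidean_space"
  assumes "M \<in> sets borel" "bounded M" "continuous_on UNIV f"
  shows "set_integrable lborel M f"
proof (rule set_integrable_subset)
  show "set_integrable lborel (closure M) f"
    using assms(2,3) borel_integrable_compact[of "closure M" f]
    by (auto simp: set_integrable_def intro: continuous_on_subset)
qed (use assms(1) closure_subset in auto)

lemma supersolution_yukawa_pot:
  assumes e: "e > 0" and k: "k \<ge> 0" and B: "B \<in> sets borel" "bounded B"
  shows "supersolution U k (\<lambda>x. c * yukawa_pot k e B x) (\<lambda>x. c *\<^sub>R yukawa_pot_grad k e B x) (\<lambda>x. c * yukawa_pot_src k e B x)"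
  unfolding supersolution_def
proof (intro conjI allI impI)
  show "C1_grad (\<lambda>x. c * yukawa_pot k e B x) (\<lambda>x. c *\<^sub>R yukawa_pot_grad k e B x)"
    by (rule C1_grad_cmult[OF C1_grad_yukawa_pot[OF e k B]])
  show "(LBINT x. c * yukawa_pot_src k e B x * \<phi> x) \<le> energy_form k (\<lambda>x. c * yukawa_pot k e B x) (\<lambda>x. c *\<^sub>R yukawa_pot_grad k e B x) \<phi> \<phi>'"
    if "C1c U \<phi> \<phi>'" for \<phi> \<phi>'
    by (simp add: energy_form_cmult energy_form_yukawa_pot[OF e k B that] mult.assoc)
qed

lemma dirichlet_solution_le_regularised_barrier:
  assumes \<tau>: "\<tau> > 0" and \<sigma>: "\<bar>\<sigma>\<bar> = 1" and e: "e > 0"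
    and W: "dirichlet_solution (- closure D) \<tau> W H (\<lambda>x. indicator B x + F x)" and F: "square_integrable lborel F"
    and g: "supersolution (- closure D) \<tau> g g' (\<lambda>x. 0)" "(g \<longlongrightarrow> 0) at_infinity"
    and g_ge: "\<And>x. x \<in> closure D \<Longrightarrow> 0 \<le> \<sigma> * yukawa_pot \<tau> e B x + g x"
    and B: "B \<in> sets borel" "bounded B" and M: "M \<in> sets borel" "bounded M"
  shows "\<sigma> * (LINT x:M|lborel. W x) - (\<sigma> * (LINT x:M|lborel. yukawa_pot \<tau> e B x) + (LINT x:M|lborel. g x))
    \<le> 2 / \<tau>\<^sup>2 * sqrt (measure lborel M) *
      (L2_norm lborel F + L2_norm lborel (\<lambda>x. yukawa_pot_src \<tau> e B x - indicator B x))"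
proof -
  let ?v = "yukawa_pot \<tau> e B" and ?S = "yukawa_pot_src \<tau> e B"
  let ?q = "\<lambda>x. \<sigma> * ?v x + g x" and ?P = "\<lambda>x. \<sigma> * (indicat_real B x + F x)" and ?Q = "\<lambda>x. \<sigma> * ?S x"
  have \<tau>0: "\<tau> \<ge> 0" using \<tau> by simp
  have f: "square_integrable lborel (indicat_real B)"
    using B emeasure_bounded_finite[OF B(2)] by (intro square_integrable_indicator) auto
  note S = square_integrable_yukawa_pot_src[OF e \<tau>0 B]
  have P: "square_integrable lborel ?P" and Q: "square_integrable lborel ?Q"
    using square_integrable_cmult[OF square_integrable_add[OF f F], of \<sigma>] square_integrable_cmult[OF S, of \<sigma>] by simp_all
  note sup = supersolution_add[OF supersolution_yukawa_pot[OF e \<tau>0 B] g(1), of \<sigma>]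
  note cont = C1_grad_cont(1)[OF C1_grad_yukawa_pot[OF e \<tau>0 B]] C1_grad_cont(1)[OF supersolutionD(1)[OF g(1)]]
  have integrable_on_M: "set_integrable lborel M ?v" "set_integrable lborel M g" "set_integrable lborel M ?q"
    using cont by (auto intro!: set_integrable_continuous_bounded[OF M] continuous_intros)
  have "(?q \<longlongrightarrow> \<sigma> * 0 + 0) at_infinity"
    by (intro tendsto_intros yukawa_pot_at_infinity[OF e \<tau>0 B] g(2))
  then have "(LINT x:M|lborel. \<sigma> * W x) - (LINT x:M|lborel. ?q x)
      \<le> 2 / \<tau>\<^sup>2 * sqrt (measure lborel M) * L2_norm lborel (\<lambda>x. ?P x - ?Q x)"
    using M emeasure_bounded_finite[OF M(2)] g_ge integrable_on_M(3)
    by (intro comparison_principle[OF \<tau> dirichlet_solution_cmult[OF W] sup _ _ P Q]) auto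
  moreover have "L2_norm lborel (\<lambda>x. ?P x - ?Q x) \<le> L2_norm lborel F + L2_norm lborel (\<lambda>x. ?S x - indicator B x)"
  proof -
    have "(\<lambda>x. ?P x - ?Q x) = (\<lambda>x. \<sigma> *\<^sub>R (F x + (indicator B x - ?S x)))"
      by (simp add: fun_eq_iff algebra_simps)
    then have "L2_norm lborel (\<lambda>x. ?P x - ?Q x) = L2_norm lborel (\<lambda>x. F x + (indicator B x - ?S x))"
      using L2_norm_cmult[of lborel \<sigma> "\<lambda>x. F x + (indicator B x - ?S x)"] \<sigma> by simp
    then show ?thesis
      using L2_norm_triangle_ineq[OF F square_integrable_diff[OF f S]] by (simp add: L2_norm_minus_commute[of _ ?S])
  qed
  then have "2 / \<tau>\<^sup>2 * sqrt (measure lborel M) * L2_norm lborel (\<lambda>x. ?P x - ?Q x)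
      \<le> 2 / \<tau>\<^sup>2 * sqrt (measure lborel M) * (L2_norm lborel F + L2_norm lborel (\<lambda>x. ?S x - indicator B x))"
    by (intro mult_left_mono) auto
  moreover have "(LINT x:M|lborel. ?q x) = \<sigma> * (LINT x:M|lborel. ?v x) + (LINT x:M|lborel. g x)"
    using integrable_on_M(1,2) by (simp add: set_integral_add)
  ultimately show ?thesis by simp
qed

lemma dirichlet_solution_le_barrier:
  assumes \<tau>: "\<tau> > 0" and \<sigma>: "\<bar>\<sigma>\<bar> = 1" and g: "barrier D B \<tau> \<sigma> g g'"
    and W: "dirichlet_solution (- closure D) \<tau> W H (\<lambda>x. indicator B x + F x)" and F: "square_integrable lborel F"
    and B: "B \<in> sets borel" "bounded B" and M: "M \<in> sets borel" "bounded M"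
  shows "\<sigma> * (LINT x:M|lborel. W x) - (\<sigma> * (LINT x:B|lborel. vsol (indicator M) x \<tau>) + (LINT x:M|lborel. g x))
    \<le> 2 / \<tau>\<^sup>2 * sqrt (measure lborel M) * L2_norm lborel F"
proof -
  have \<tau>0: "\<tau> \<ge> 0" using \<tau> by simp
  define X where "X n = inverse (real (Suc n))" for n
  have X: "X \<longlonglongrightarrow> 0" "\<And>n. X n > 0" unfolding X_def by (rule LIMSEQ_inverse_real_of_nat) auto
  let ?err = "\<lambda>n. L2_norm lborel (\<lambda>x. yukawa_pot_src \<tau> (X n) B x - indicator B x)"
  let ?diff = "\<lambda>n. \<sigma> * (LINT x:M|lborel. W x) - (\<sigma> * (LINT x:B|lborel. yukawa_pot \<tau> (X n) M x) + (LINT x:M|lborel. g x))"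
  have "filterlim X (at_right 0) sequentially"
    using X by (simp add: tendsto_imp_filterlim_at_right)
  then have "\<forall>\<^sub>F n in sequentially. \<forall>x\<in>closure D. 0 \<le> \<sigma> * yukawa_pot \<tau> (X n) B x + g x"
    using g unfolding barrier_def filterlim_iff by blast
  then have eventually_le: "\<forall>\<^sub>F n in sequentially. ?diff n \<le> 2 / \<tau>\<^sup>2 * sqrt (measure lborel M) * (L2_norm lborel F + ?err n)"
  proof eventually_elim
    case (elim n)
    have "supersolution (- closure D) \<tau> g g' (\<lambda>x. 0)" "(g \<longlongrightarrow> 0) at_infinity"
      using g by (auto simp: barrier_def)
    from dirichlet_solution_le_regularised_barrier[OF \<tau> \<sigma> X(2) W F this elim[rule_format] B M]
    show ?case unfolding set_integral_yukawa_pot_commute[OF X(2) \<tau>0 B M] .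
  qed
  have diff_tendsto: "?diff \<longlonglongrightarrow> \<sigma> * (LINT x:M|lborel. W x) - (\<sigma> * (LINT x:B|lborel. vsol (indicator M) x \<tau>) + (LINT x:M|lborel. g x))"
    by (intro tendsto_intros set_integral_yukawa_pot_tendsto[OF \<tau> M B X])
  have "(\<lambda>n. 2 / \<tau>\<^sup>2 * sqrt (measure lborel M) * (L2_norm lborel F + ?err n))
      \<longlonglongrightarrow> 2 / \<tau>\<^sup>2 * sqrt (measure lborel M) * (L2_norm lborel F + 0)"
    by (intro tendsto_intros yukawa_pot_src_tendsto[OF \<tau>0 B X])
  from tendsto_le[OF _ this diff_tendsto eventually_le] show ?thesis by simp
qed

lemma supersolution_sum_yukawa:
  assumes e: "e > 0" and k: "k \<ge> 0" and A: "\<And>i. i \<in> I \<Longrightarrow> 0 \<le> A i"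
  shows "supersolution U k (\<lambda>x. \<Sum>i\<in>I. A i * yukawa k e (x - i)) (\<lambda>x. \<Sum>i\<in>I. A i *\<^sub>R yukawa_grad k e (x - i)) (\<lambda>x. 0)"
  unfolding supersolution_def
proof (intro conjI allI impI)
  have C1: "C1_grad (\<lambda>x. A i * yukawa k e (x - i)) (\<lambda>x. A i *\<^sub>R yukawa_grad k e (x - i))" for i
    by (intro C1_grad_cmult C1_grad_shift C1_grad_yukawa e)
  then show "C1_grad (\<lambda>x. \<Sum>i\<in>I. A i * yukawa k e (x - i)) (\<lambda>x. \<Sum>i\<in>I. A i *\<^sub>R yukawa_grad k e (x - i))"
    by (rule C1_grad_sum)
  fix \<phi> \<phi>' assume \<phi>: "C1c U \<phi> \<phi>'" "\<forall>x. 0 \<le> \<phi> x"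
  have "energy_form k (\<lambda>x. \<Sum>i\<in>I. A i * yukawa k e (x - i)) (\<lambda>x. \<Sum>i\<in>I. A i *\<^sub>R yukawa_grad k e (x - i)) \<phi> \<phi>'
      = (\<Sum>i\<in>I. A i * (LBINT x. yukawa_src k e (x - i) * \<phi> x))"
    by (simp add: energy_form_sum[OF C1 \<phi>(1)] energy_form_cmult energy_form_yukawa[OF e \<phi>(1)])
  also have "\<dots> \<ge> 0"
    using A yukawa_src_nonneg[OF e k] \<phi>(2) by (intro sum_nonneg mult_nonneg_nonneg integral_nonneg_AE AE_I2) auto
  finally show "(LBINT x. 0 * \<phi> x) \<le> energy_form k (\<lambda>x. \<Sum>i\<in>I. A i * yukawa k e (x - i)) (\<lambda>x. \<Sum>i\<in>I. A i *\<^sub>R yukawa_grad k e (x - i)) \<phi> \<phi>'"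
    by simp
qed

lemma supersolution_uminus_yukawa:
  assumes e: "e > 0" and A: "A \<ge> 0"
    and src: "\<And>x. x \<in> U \<Longrightarrow> yukawa_src \<kappa> e (x - p) \<le> (\<kappa>\<^sup>2 - k\<^sup>2) * yukawa \<kappa> e (x - p)"
  shows "supersolution U k (\<lambda>x. - A * yukawa \<kappa> e (x - p)) (\<lambda>x. - A *\<^sub>R yukawa_grad \<kappa> e (x - p)) (\<lambda>x. 0)"
  unfolding supersolution_def
proof (intro conjI allI impI)
  note C1 = C1_grad_shift[OF C1_grad_yukawa[OF e, of \<kappa>], of p]
  show "C1_grad (\<lambda>x. - A * yukawa \<kappa> e (x - p)) (\<lambda>x. - A *\<^sub>R yukawa_grad \<kappa> e (x - p))"
    by (rule C1_grad_cmult[OF C1])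
  fix \<phi> \<phi>' assume \<phi>: "C1c U \<phi> \<phi>'" "\<forall>x. 0 \<le> \<phi> x"
  obtain S where S: "S \<subseteq> U" "\<And>x. x \<notin> S \<Longrightarrow> \<phi> x = 0" using C1c_support[OF \<phi>(1)] by metis
  have "continuous_on UNIV (\<lambda>x. yukawa_src \<kappa> e (x - p))"
    by (intro continuous_on_compose2[OF continuous_yukawa_src[OF e]] continuous_intros) auto
  note int = integrable_continuous_mult_C1c(1)[OF C1_grad_cont[OF C1] \<phi>(1)]
    integrable_continuous_mult_C1c(1)[OF this C1_grad_cont(2)[OF C1] \<phi>(1)]
  have "(LBINT x. yukawa_src \<kappa> e (x - p) * \<phi> x) \<le> (LBINT x. (\<kappa>\<^sup>2 - k\<^sup>2) * (yukawa \<kappa> e (x - p) * \<phi> x))"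
  proof (intro integral_mono int integrable_mult_right)
    show "yukawa_src \<kappa> e (x - p) * \<phi> x \<le> (\<kappa>\<^sup>2 - k\<^sup>2) * (yukawa \<kappa> e (x - p) * \<phi> x)" for x
      using S \<phi>(2) mult_right_mono[OF src, of x "\<phi> x"] by (cases "x \<in> S") (auto simp: mult.assoc)
  qed
  then have "0 \<le> A * ((\<kappa>\<^sup>2 - k\<^sup>2) * (LBINT x. yukawa \<kappa> e (x - p) * \<phi> x) - (LBINT x. yukawa_src \<kappa> e (x - p) * \<phi> x))"
    using A by simp
  also have "\<dots> = energy_form k (\<lambda>x. - A * yukawa \<kappa> e (x - p)) (\<lambda>x. - A *\<^sub>R yukawa_grad \<kappa> e (x - p)) \<phi> \<phi>'"
    unfolding energy_form_cmult energy_form_change_mass[OF C1 \<phi>(1), of k \<kappa>] energy_form_yukawa[OF e \<phi>(1)]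
    by (simp add: algebra_simps)
  finally show "(LBINT x. 0 * \<phi> x) \<le> energy_form k (\<lambda>x. - A * yukawa \<kappa> e (x - p)) (\<lambda>x. - A *\<^sub>R yukawa_grad \<kappa> e (x - p)) \<phi> \<phi>'"
    by simp
qed

lemma yukawa_src_le:
  assumes "1 \<le> k" "0 < r" "r \<le> norm x"
  shows "yukawa_src k e x \<le> e\<^sup>2 * (1 / r\<^sup>2 + 3 / r^3 + 3 / r^4) * k\<^sup>2 * yukawa k e x"
proof -
  define s where "s = reg_norm e x"
  have s: "r \<le> s" "0 < s" using assms norm_le_reg_norm[of x e] by (auto simp: s_def)
  have k: "k \<le> k\<^sup>2" "1 \<le> k\<^sup>2" using assms(1) self_le_power[of k 2] by (auto simp: one_le_power)
  have "k\<^sup>2 / s\<^sup>2 + 3 * k / s^3 + 3 / s^4 \<le> k\<^sup>2 / r\<^sup>2 + 3 * k\<^sup>2 / r^3 + 3 * k\<^sup>2 / r^4"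
    using s assms k by (intro add_mono frac_le power_mono) auto
  then have "e\<^sup>2 * (k\<^sup>2 / s\<^sup>2 + 3 * k / s^3 + 3 / s^4) * yukawa k e x \<le> e\<^sup>2 * (k\<^sup>2 / r\<^sup>2 + 3 * k\<^sup>2 / r^3 + 3 * k\<^sup>2 / r^4) * yukawa k e x"
    using s(2) by (intro mult_right_mono mult_left_mono) (auto simp: yukawa_def s_def)
  moreover have "yukawa_src k e x = e\<^sup>2 * (k\<^sup>2 / s\<^sup>2 + 3 * k / s^3 + 3 / s^4) * yukawa k e x"
    using s(2) by (simp add: yukawa_src_def yukawa_curv_def yukawa_def s_def[symmetric] field_simps eval_nat_numeral)
  ultimately show ?thesis by (simp add: algebra_simps)
qed

lemma yukawa_src_le_mass_gap:
  assumes \<delta>: "\<delta> > 0" and r: "r > 0"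
  obtains e where "0 < e" "e \<le> \<delta>"
    "\<And>\<tau> x. 1 \<le> \<tau> \<Longrightarrow> r \<le> norm x \<Longrightarrow> yukawa_src ((1 + \<delta>) * \<tau>) e x \<le> (((1 + \<delta>) * \<tau>)\<^sup>2 - \<tau>\<^sup>2) * yukawa ((1 + \<delta>) * \<tau>) e x"
proof -
  define Q where "Q = 1 / r\<^sup>2 + 3 / r^3 + 3 / r^4"
  have Q: "Q > 0" using r by (simp add: Q_def add_pos_pos)
  define w where "w = 1 - 1 / (1 + \<delta>)\<^sup>2"
  have w: "w > 0" using \<delta> by (simp add: w_def one_less_power)
  define e where "e = min \<delta> (sqrt (w / Q))"
  have e: "0 < e" "e \<le> \<delta>" "e \<le> sqrt (w / Q)" using \<delta> w Q by (auto simp: e_def)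
  then have "e\<^sup>2 \<le> w / Q" using power_mono[of e "sqrt (w / Q)" 2] w Q by simp
  then have eQ: "e\<^sup>2 * Q \<le> w" using Q by (simp add: pos_le_divide_eq)
  show ?thesis
  proof (rule that[OF e(1,2)])
    fix \<tau> :: real and x :: "real^3" assume \<tau>: "1 \<le> \<tau>" and x: "r \<le> norm x"
    let ?\<kappa> = "(1 + \<delta>) * \<tau>"
    have "1 \<le> ?\<kappa>" using mult_mono[of 1 "1 + \<delta>" 1 \<tau>] \<tau> \<delta> by simp
    from yukawa_src_le[OF this r x, of e] have "yukawa_src ?\<kappa> e x \<le> e\<^sup>2 * Q * (?\<kappa>\<^sup>2 * yukawa ?\<kappa> e x)"
      by (simp add: Q_def mult.assoc)
    also have "\<dots> \<le> w * (?\<kappa>\<^sup>2 * yukawa ?\<kappa> e x)"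
      using eQ yukawa_pos[OF e(1), of ?\<kappa> x] by (intro mult_right_mono) auto
    also have "w * (?\<kappa>\<^sup>2 * yukawa ?\<kappa> e x) = (w * ?\<kappa>\<^sup>2) * yukawa ?\<kappa> e x" by simp
    also have "w * ?\<kappa>\<^sup>2 = ?\<kappa>\<^sup>2 - \<tau>\<^sup>2"
      using \<delta> by (simp add: w_def left_diff_distrib power_mult_distrib)
    finally show "yukawa_src ?\<kappa> e x \<le> (?\<kappa>\<^sup>2 - \<tau>\<^sup>2) * yukawa ?\<kappa> e x" .
  qed
qed

lemma infdist_frontier_le_dist:
  fixes x :: "'a::euclidean_space"
  assumes "x \<notin> B" "z \<in> B"
  shows "infdist x (frontier B) \<le> dist x z"
proof -
  obtain w where w: "w \<in> closed_segment x z" "w \<in> frontier B"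
    using connected_Int_frontier[of "closed_segment x z" B] assms by auto
  have "infdist x (frontier B) \<le> dist x w" by (rule infdist_le[OF w(2)])
  also have "\<dots> \<le> dist x z" using segment_bound(1)[OF w(1)] by (simp add: dist_norm norm_minus_commute)
  finally show ?thesis .
qed

lemma measure_open_Int_ball_pos:
  fixes y :: "'a::euclidean_space"
  assumes "open B" "y \<in> closure B" "0 < \<delta>"
  shows "0 < measure lborel (B \<inter> ball y \<delta>)"
proof -
  have "B \<inter> ball y \<delta> \<noteq> {}"
    using assms open_Int_closure_eq_empty[of "ball y \<delta>" B] by (auto simp: Int_commute)
  moreover have "open (B \<inter> ball y \<delta>)" "bounded (B \<inter> ball y \<delta>)" "B \<inter> ball y \<delta> \<in> sets lborel"
    using assms(1) by (auto simp: bounded_Int)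
  ultimately have "measure lborel (B \<inter> ball y \<delta>) \<noteq> 0"
    using open_not_negligible[of "B \<inter> ball y \<delta>"] negligible_iff_measure0[OF lmeasurable_open]
    by (metis measure_completion)
  then show ?thesis by (simp add: less_le)
qed

section \<open>The indicator function\<close>

locale wave_obstacle =
  fixes D :: "(real^3) set" and T :: real and u :: "(real^3) \<times> real \<Rightarrow> real" and B B' :: "(real^3) set"
  assumes D: "D \<noteq> {}" "open D" "bounded D" "C2_boundary D"
    and T_pos: "T > 0"
    and u: "wave_weak_sol D T (indicator B) u"
    and B: "B \<noteq> {}" "open B" "bounded B" "closure B \<inter> closure D = {}"
    and B': "B' \<noteq> {}" "open B'" "bounded B'" "closure B' \<inter> closure D = {}"
begin

definition indicator_function :: "real \<Rightarrow> real" where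
  "indicator_function \<tau> = (LINT x:B|lborel. vsol (indicator B') x \<tau>) - (LINT x:B'|lborel. wlap T u x \<tau>)"

definition path_length :: real where
  "path_length = Inf {dist y x + dist x y' | x y y'. x \<in> frontier D \<and> y \<in> frontier B \<and> y' \<in> frontier B'}"

lemma borel_B: "B \<in> sets borel" "B' \<in> sets borel"
  using B(2) B'(2) by auto

lemma frontier_nonempty: "frontier D \<noteq> {}" "frontier B \<noteq> {}" "frontier B' \<noteq> {}"
  using D B B' not_bounded_UNIV by (auto simp: frontier_eq_empty)

lemma path_length_nonneg: "0 \<le> path_length"
  unfolding path_length_def using frontier_nonempty by (intro cInf_greatest) auto

lemma near_optimal_path:
  assumes "\<delta> > 0"
  obtains x y y' where "x \<in> frontier D" "y \<in> frontier B" "y' \<in> frontier B'" "dist y x + dist x y' < path_length + \<delta>"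
proof -
  have "\<exists>s\<in>{dist y x + dist x y' | x y y'. x \<in> frontier D \<and> y \<in> frontier B \<and> y' \<in> frontier B'}. s < path_length + \<delta>"
    using frontier_nonempty assms unfolding path_length_def by (intro cInf_lessD) auto
  then show ?thesis using that by blast
qed

lemma path_length_le:
  assumes x: "x \<in> closure D"
  shows "path_length \<le> infdist x (frontier B) + infdist x (frontier B')"
proof -
  obtain y y' where y: "y \<in> frontier B" "infdist x (frontier B) = dist x y"
    and y': "y' \<in> frontier B'" "infdist x (frontier B') = dist x y'"
    using infdist_attains_inf[OF frontier_closed frontier_nonempty(2)] infdist_attains_inf[OF frontier_closed frontier_nonempty(3)]
    by metis
  have "y \<notin> closure D" using y(1) B(4) by (auto simp: frontier_def)
  then obtain z where z: "z \<in> closed_segment x y" "z \<in> frontier (closure D)"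
    using connected_Int_frontier[of "closed_segment x y" "closure D"] x by auto
  then have zD: "z \<in> frontier D" using interior_mono[OF closure_subset[of D]] by (auto simp: frontier_def)
  have "bdd_below {dist y x + dist x y' | x y y'. x \<in> frontier D \<and> y \<in> frontier B \<and> y' \<in> frontier B'}"
    by (rule bdd_belowI[of _ 0]) auto
  then have "path_length \<le> dist y z + dist z y'"
    unfolding path_length_def using zD y(1) y'(1) by (intro cInf_lower) auto
  also have "\<dots> \<le> dist y z + (dist z x + dist x y')"
    using dist_triangle[of z y' x] by simp
  also have "\<dots> = dist x y + dist x y'"
    using z(1) between_mem_segment[of x y z] by (simp add: between dist_commute)
  finally show ?thesis using y(2) y'(2) by simp
qed

lemma indicator_function_le_barrier:
  assumes T1: "0 < T1" "T1 < T"
  obtains E where "E \<ge> 0" "\<And>\<tau> \<sigma> g g'. \<tau> \<ge> 1 \<Longrightarrow> \<bar>\<sigma>\<bar> = 1 \<Longrightarrow> barrier D B \<tau> \<sigma> g g' \<Longrightarrow>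
     - \<sigma> * indicator_function \<tau> \<le> (LINT x:B'|lborel. g x) + E * exp (- \<tau> * T1)"
proof -
  obtain G where G: "weak_wave D T (indicator B) u G"
    using wave_weak_sol_imp_weak_wave[OF u T_pos] .
  have "square_integrable lborel (indicat_real B)"
    using borel_B emeasure_bounded_finite[OF B(3)] by (intro square_integrable_indicator) auto
  from weak_wave.elliptic_approximation_exists[OF G D(2-4) this T1]
  obtain C where C: "\<And>\<tau>. \<tau> \<ge> 1 \<Longrightarrow> \<exists>W H F. elliptic_approximation D T (indicator B) u \<tau> (C * exp (- \<tau> * T1)) W H F"
    by blast
  define b where "b = sqrt (measure lborel B')"
  have b: "b \<ge> 0" by (simp add: b_def)
  show ?thesis
  proof (rule that[of "3 * \<bar>C\<bar> * b"])
    fix \<tau> \<sigma> :: real and g :: "real^3 \<Rightarrow> real" and g'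
    assume \<tau>: "\<tau> \<ge> 1" and \<sigma>: "\<bar>\<sigma>\<bar> = 1" and g: "barrier D B \<tau> \<sigma> g g'"
    then have \<tau>0: "\<tau> > 0" by simp
    obtain W H F where W: "dirichlet_solution (- closure D) \<tau> W H (\<lambda>x. indicator B x + F x)"
      and F: "square_integrable lborel F" "L2_norm lborel F \<le> C * exp (- \<tau> * T1) * \<tau>"
      and W_close: "\<bar>(LINT x:B'|lborel. wlap T u x \<tau>) - (LINT x:B'|lborel. W x)\<bar> \<le> C * exp (- \<tau> * T1) * b"
      using C[OF \<tau>] borel_B(2) B'(3) unfolding elliptic_approximation_def b_def by blast
    define \<epsilon> where "\<epsilon> = C * exp (- \<tau> * T1) * b"
    have \<epsilon>: "0 \<le> \<epsilon>" using W_close unfolding \<epsilon>_def by (rule order_trans[OF abs_ge_zero])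
    have "2 / \<tau>\<^sup>2 * b * L2_norm lborel F \<le> 2 * b / \<tau>\<^sup>2 * (C * exp (- \<tau> * T1) * \<tau>)"
      using mult_left_mono[OF F(2), of "2 * b / \<tau>\<^sup>2"] b by (simp add: mult.commute mult.left_commute)
    also have "\<dots> = 2 * \<epsilon> / \<tau>"
      using \<tau>0 by (simp add: \<epsilon>_def power2_eq_square)
    also have "\<dots> \<le> 2 * \<epsilon>"
      using \<tau> \<epsilon> divide_left_mono[of 1 \<tau> "2 * \<epsilon>"] by simp
    finally have F_small: "2 / \<tau>\<^sup>2 * b * L2_norm lborel F \<le> 2 * \<epsilon>" .
    have "\<sigma> * (LINT x:B'|lborel. wlap T u x \<tau>) - \<sigma> * (LINT x:B'|lborel. W x) \<le> \<epsilon>"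
      using W_close \<sigma> by (simp add: \<epsilon>_def abs_if split: if_splits)
    then have "- \<sigma> * indicator_function \<tau> \<le> (LINT x:B'|lborel. g x) + 3 * \<epsilon>"
      using dirichlet_solution_le_barrier[OF \<tau>0 \<sigma> g W F(1) borel_B(1) B(3) borel_B(2) B'(3)] F_small
      by (simp add: indicator_function_def b_def algebra_simps)
    also have "3 * \<epsilon> \<le> 3 * \<bar>C\<bar> * b * exp (- \<tau> * T1)"
      using mult_right_mono[OF abs_ge_self[of C], of "3 * b * exp (- \<tau> * T1)"] b by (simp add: \<epsilon>_def mult_ac)
    finally show "- \<sigma> * indicator_function \<tau> \<le> (LINT x:B'|lborel. g x) + 3 * \<bar>C\<bar> * b * exp (- \<tau> * T1)"
      by simp
  qed (simp add: b)
qed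

lemma obstacle_source_separation:
  obtains d where "d > 0" "\<And>x z. x \<in> closure D \<Longrightarrow> z \<in> B \<Longrightarrow> d \<le> dist x z"
proof -
  obtain d where "d > 0" "\<And>x z. x \<in> closure D \<Longrightarrow> z \<in> closure B \<Longrightarrow> d \<le> dist x z"
    using separate_compact_closed[of "closure D" "closure B"] D(3) B(4) by (auto simp: Int_commute)
  then show ?thesis using that closure_subset by blast
qed

lemma obstacle_source_distance_bounded:
  obtains M where "M > 0" "\<And>x z. x \<in> closure D \<Longrightarrow> z \<in> B \<Longrightarrow> dist x z + c \<le> M"
proof -
  have "bounded (closure D \<union> B)" using D(3) B(3) by (simp add: bounded_closure)
  then obtain R where "\<And>x z. x \<in> closure D \<Longrightarrow> z \<in> B \<Longrightarrow> dist x z \<le> R"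
    unfolding bounded_any_center by (meson Un_iff bounded_two_points)
  then show ?thesis using that[of "max 0 (R + c) + 1"] by fastforce
qed

lemma yukawa_pot_le_infdist:
  assumes d: "d > 0" "\<And>z. z \<in> B \<Longrightarrow> d \<le> dist x z" and x: "x \<in> closure D" and e: "e > 0" and k: "k \<ge> 0"
  shows "yukawa_pot k e B x \<le> measure lborel B / (4 * pi * d) * exp (- k * infdist x (frontier B))"
proof -
  have "x \<notin> B" using x B(4) closure_subset by blast
  then have "yukawa k e (x - z) \<le> exp (- k * infdist x (frontier B)) / d" if "z \<in> B" for z
    using infdist_frontier_le_dist[of x B z] d(2)[OF that] that norm_le_reg_norm[of "x - z" e]
    by (intro yukawa_le k d(1)) (auto simp: dist_norm)
  from yukawa_pot_le[OF e k borel_B(1) B(3) this] show ?thesis by (simp add: field_simps)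
qed

lemma net_barrier:
  assumes \<delta>: "\<delta> > 0" and I: "finite I" "closure D \<subseteq> (\<Union>i\<in>I. ball i \<delta>)"
    and d: "d > 0" "\<And>x z. x \<in> closure D \<Longrightarrow> z \<in> B \<Longrightarrow> d \<le> dist x z" and k: "k \<ge> 0"
  defines "A \<equiv> \<lambda>i. measure lborel B / (4 * pi * d) * (2 * \<delta>) * exp (- k * (infdist i (frontier B) - 3 * \<delta>))"
  shows "barrier D B k (- 1) (\<lambda>x. \<Sum>i\<in>I. A i * yukawa k \<delta> (x - i)) (\<lambda>x. \<Sum>i\<in>I. A i *\<^sub>R yukawa_grad k \<delta> (x - i))"
    (is "barrier D B k (- 1) ?g ?g'")
proof -
  have A: "0 \<le> A i" for i using \<delta> d(1) by (simp add: A_def)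
  have "(?g \<longlongrightarrow> (\<Sum>i\<in>I. A i * 0)) at_infinity"
    by (intro tendsto_sum tendsto_mult tendsto_const yukawa_at_infinity \<delta> k)
  then have "(?g \<longlongrightarrow> 0) at_infinity" by simp
  moreover have "yukawa_pot k e B x \<le> ?g x" if e: "e > 0" and x: "x \<in> closure D" for e x
  proof -
    obtain i where i: "i \<in> I" "dist x i < \<delta>" using I(2) x by (auto simp: dist_commute)
    have "infdist i (frontier B) - \<delta> \<le> infdist x (frontier B)"
      using infdist_triangle[of i "frontier B" x] i(2) by (simp add: dist_commute)
    then have "exp (- k * infdist x (frontier B)) \<le> exp (- k * (infdist i (frontier B) - \<delta>))"
      using k by (simp add: mult_left_mono)
    then have "yukawa_pot k e B x \<le> measure lborel B / (4 * pi * d) * exp (- k * (infdist i (frontier B) - \<delta>))"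
      using d(1) by (intro order_trans[OF yukawa_pot_le_infdist[OF d(1) d(2)[OF x] x e k]] mult_left_mono) auto
    also have "- k * (infdist i (frontier B) - \<delta>) = - k * (infdist i (frontier B) - 3 * \<delta>) + - k * (2 * \<delta>)"
      by (simp add: algebra_simps)
    also have "measure lborel B / (4 * pi * d) * exp \<dots> = A i * (exp (- k * (2 * \<delta>)) / (2 * \<delta>))"
      unfolding exp_add using \<delta> by (simp add: A_def)
    also have "\<dots> \<le> A i * yukawa k \<delta> (x - i)"
      using i(2) by (intro mult_left_mono A yukawa_ge \<delta> k) (auto simp: dist_norm)
    also have "\<dots> \<le> ?g x"
      using i(1) I(1) A yukawa_pos[OF \<delta>] by (intro member_le_sum) (auto simp: less_imp_le)
    finally show ?thesis .
  qed
  then have "\<forall>\<^sub>F e in at_right 0. \<forall>x\<in>closure D. 0 \<le> - 1 * yukawa_pot k e B x + ?g x"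
    by (auto simp: eventually_at_right_less intro: eventually_mono[OF eventually_at_right_less])
  ultimately show ?thesis
    unfolding barrier_def using supersolution_sum_yukawa[where A = A and I = I and U = "- closure D", OF \<delta> k A] by blast
qed

lemma set_integral_yukawa_le_infdist:
  assumes x: "x \<in> closure D" and e: "e > 0" and k: "k \<ge> 0"
  shows "(LINT z:B'|lborel. yukawa k e (z - x)) \<le> measure lborel B' * (exp (- k * infdist x (frontier B')) / e)"
proof (rule set_integral_le_measure_mult[OF borel_B(2) B'(3) set_integrable_yukawa(2)[OF e k borel_B(2) B'(3)]])
  fix z assume z: "z \<in> B'"
  have "x \<notin> B'" using x B'(4) closure_subset by blast
  then show "yukawa k e (z - x) \<le> exp (- k * infdist x (frontier B')) / e"
    using infdist_frontier_le_dist[of x B' z] z norm_le_reg_norm[of "z - x" e]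
    by (intro yukawa_le k e le_reg_norm) (auto simp: dist_norm norm_minus_commute)
qed

lemma indicator_function_le:
  assumes T1: "0 < T1" "T1 < T" and \<delta>: "\<delta> > 0"
  obtains C E where "\<And>\<tau>. \<tau> \<ge> 1 \<Longrightarrow> indicator_function \<tau> \<le> C * exp (- \<tau> * (path_length - 3 * \<delta>)) + E * exp (- \<tau> * T1)"
proof -
  obtain E where E: "\<And>\<tau> \<sigma> g g'. \<tau> \<ge> 1 \<Longrightarrow> \<bar>\<sigma>\<bar> = 1 \<Longrightarrow> barrier D B \<tau> \<sigma> g g' \<Longrightarrow>
     - \<sigma> * indicator_function \<tau> \<le> (LINT x:B'|lborel. g x) + E * exp (- \<tau> * T1)"
    using indicator_function_le_barrier[OF T1] by metis
  obtain d where d: "d > 0" "\<And>x z. x \<in> closure D \<Longrightarrow> z \<in> B \<Longrightarrow> d \<le> dist x z"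
    using obstacle_source_separation by metis
  have "compact (closure D)" "closure D \<subseteq> (\<Union>i\<in>closure D. ball i \<delta>)"
    using D(3) \<delta> by auto
  then obtain I where I: "I \<subseteq> closure D" "finite I" "closure D \<subseteq> (\<Union>i\<in>I. ball i \<delta>)"
    by (rule compactE_image[OF _ open_ball]) auto
  define c where "c = measure lborel B / (4 * pi * d) * (2 * \<delta>)"
  have c: "c \<ge> 0" using d(1) \<delta> by (simp add: c_def)
  show ?thesis
  proof (rule that)
    fix \<tau> :: real assume \<tau>: "\<tau> \<ge> 1"
    then have \<tau>0: "\<tau> \<ge> 0" by simp
    let ?A = "\<lambda>i. c * exp (- \<tau> * (infdist i (frontier B) - 3 * \<delta>))" and ?m = "measure lborel B'"
    have "indicator_function \<tau> \<le> (LINT x:B'|lborel. \<Sum>i\<in>I. ?A i * yukawa \<tau> \<delta> (x - i)) + E * exp (- \<tau> * T1)"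
      using E[OF \<tau> _ net_barrier[OF \<delta> I(2,3) d \<tau>0, folded c_def]] by simp
    also have "(LINT x:B'|lborel. \<Sum>i\<in>I. ?A i * yukawa \<tau> \<delta> (x - i)) = (\<Sum>i\<in>I. ?A i * (LINT x:B'|lborel. yukawa \<tau> \<delta> (x - i)))"
      using set_integrable_yukawa(2)[OF \<delta> \<tau>0 borel_B(2) B'(3)]
      by (simp add: set_lebesgue_integral_def set_integrable_def sum_distrib_left mult.left_commute[of "indicator _ _"])
    also have "\<dots> \<le> (\<Sum>i\<in>I. c * ?m / \<delta> * exp (- \<tau> * (path_length - 3 * \<delta>)))"
    proof (rule sum_mono)
      fix i assume "i \<in> I"
      then have i: "i \<in> closure D" using I(1) by blast
      have "?A i * (LINT x:B'|lborel. yukawa \<tau> \<delta> (x - i)) \<le> ?A i * (?m * (exp (- \<tau> * infdist i (frontier B')) / \<delta>))"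
        using c by (intro mult_left_mono set_integral_yukawa_le_infdist i \<delta> \<tau>0) auto
      also have "\<dots> = c * ?m / \<delta> * exp (- \<tau> * (infdist i (frontier B) + infdist i (frontier B') - 3 * \<delta>))"
        by (simp add: algebra_simps flip: exp_add)
      also have "\<dots> \<le> c * ?m / \<delta> * exp (- \<tau> * (path_length - 3 * \<delta>))"
        using path_length_le[OF i] \<tau>0 c \<delta> by (intro mult_left_mono) (auto simp: mult_left_mono)
      finally show "?A i * (LINT x:B'|lborel. yukawa \<tau> \<delta> (x - i)) \<le> c * ?m / \<delta> * exp (- \<tau> * (path_length - 3 * \<delta>))" .
    qed
    also have "\<dots> = real (card I) * c * ?m / \<delta> * exp (- \<tau> * (path_length - 3 * \<delta>))" by simp
    finally show "indicator_function \<tau> \<le> real (card I) * c * ?m / \<delta> * exp (- \<tau> * (path_length - 3 * \<delta>)) + E * exp (- \<tau> * T1)"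
      by simp
  qed
qed

lemma pole_barrier:
  fixes q y :: "real^3"
  assumes \<delta>: "\<delta> > 0" and M: "M > 0" "\<And>x z. x \<in> closure D \<Longrightarrow> z \<in> B \<Longrightarrow> dist x z + \<delta> \<le> M"
    and k: "0 \<le> k" "k \<le> \<kappa>" and e: "e > 0"
    and src: "\<And>x. x \<notin> closure D \<Longrightarrow> yukawa_src \<kappa> e (x - q) \<le> (\<kappa>\<^sup>2 - k\<^sup>2) * yukawa \<kappa> e (x - q)"
  defines "A \<equiv> e * measure lborel (B \<inter> ball y \<delta>) / (4 * pi * M) * exp (- k * (dist q y + 2 * \<delta>))"
  shows "barrier D B k 1 (\<lambda>x. - A * yukawa \<kappa> e (x - q)) (\<lambda>x. - A *\<^sub>R yukawa_grad \<kappa> e (x - q))"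
proof -
  have A: "A \<ge> 0" using e M(1) by (simp add: A_def)
  have \<kappa>: "\<kappa> \<ge> 0" using k by simp
  have "((\<lambda>x. - A * yukawa \<kappa> e (x - q)) \<longlongrightarrow> - A * 0) at_infinity"
    by (intro tendsto_intros yukawa_at_infinity e \<kappa>)
  moreover have "A * yukawa \<kappa> e (x - q) \<le> yukawa_pot k s B x" if s: "0 < s" "s < \<delta>" and x: "x \<in> closure D" for s x
  proof -
    have "yukawa \<kappa> e (x - q) \<le> exp (- \<kappa> * dist x q) / e"
      using norm_le_reg_norm[of "x - q" e] by (intro yukawa_le \<kappa> e le_reg_norm) (auto simp: dist_norm)
    also have "\<dots> \<le> exp (- k * dist x q) / e"
      using e k(2) by (intro divide_right_mono) (auto intro: mult_right_mono)
    finally have "A * yukawa \<kappa> e (x - q) \<le> A * (exp (- k * dist x q) / e)"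
      using A by (rule mult_left_mono)
    also have "\<dots> = measure lborel (B \<inter> ball y \<delta>) * (exp (- k * (dist x q + dist q y + 2 * \<delta>)) / M) / (4 * pi)"
      using e by (simp add: A_def algebra_simps flip: exp_add)
    also have "\<dots> \<le> yukawa_pot k s B x"
    proof (rule yukawa_pot_ge[OF s(1) k(1) borel_B(1) B(3)])
      fix z assume "z \<in> B \<inter> ball y \<delta>"
      then have z: "z \<in> B" "dist y z < \<delta>" by auto
      have "dist x z \<le> dist x q + dist q y + dist y z"
        using dist_triangle[of x z y] dist_triangle[of x y q] by linarith
      then show "exp (- k * (dist x q + dist q y + 2 * \<delta>)) / M \<le> yukawa k s (x - z)"
        using M(2)[OF x z(1)] z(2) s by (intro yukawa_ge s(1) k(1)) (auto simp: dist_norm)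
    qed (use borel_B in auto)
    finally show ?thesis .
  qed
  then have "\<forall>\<^sub>F s in at_right 0. \<forall>x\<in>closure D. 0 \<le> 1 * yukawa_pot k s B x + - A * yukawa \<kappa> e (x - q)"
    by (auto intro!: eventually_at_rightI[OF _ \<delta>])
  ultimately show ?thesis
    unfolding barrier_def using supersolution_uminus_yukawa[OF e A, of "- closure D" \<kappa> q k] src by simp
qed

lemma set_integral_yukawa_ge:
  assumes e: "0 < e" "e \<le> \<delta>" and k: "k \<ge> 0"
  shows "measure lborel (B' \<inter> ball y \<delta>) * (exp (- k * (dist q y + 2 * \<delta>)) / (dist q y + 2 * \<delta>)) \<le> (LINT x:B'|lborel. yukawa k e (x - q))"
proof (rule measure_mult_le_set_integral[OF borel_B(2) B'(3) set_integrable_yukawa(2)[OF e(1) k borel_B(2) B'(3)]])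
  show "0 \<le> yukawa k e (x - q)" for x using yukawa_pos[OF e(1)] by (simp add: less_imp_le)
  fix x assume "x \<in> B' \<inter> ball y \<delta>"
  then have "norm (x - q) + e \<le> dist q y + 2 * \<delta>"
    using dist_triangle[of x q y] e(2) by (simp add: dist_norm norm_minus_commute)
  then show "exp (- k * (dist q y + 2 * \<delta>)) / (dist q y + 2 * \<delta>) \<le> yukawa k e (x - q)"
    by (intro yukawa_ge e(1) k)
qed (use borel_B in auto)

lemma near_optimal_pole:
  assumes \<delta>: "\<delta> > 0"
  obtains q r y y' where "r > 0" "ball q r \<subseteq> D" "y \<in> closure B" "y' \<in> closure B'"
    "dist q y + dist q y' \<le> path_length + 3 * \<delta>"
proof -
  obtain x y y' where x: "x \<in> closure D" and y: "y \<in> closure B" "y' \<in> closure B'"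
    and path: "dist y x + dist x y' < path_length + \<delta>"
    using near_optimal_path[OF \<delta>] by (metis DiffD1 frontier_def)
  obtain q where q: "q \<in> D" "dist q x < \<delta>" using x \<delta> unfolding closure_approachable by blast
  obtain r where "r > 0" "ball q r \<subseteq> D" using D(2) q(1) openE by blast
  moreover have "dist q y + dist q y' \<le> path_length + 3 * \<delta>"
    using path q(2) dist_triangle[of q y x] dist_triangle[of q y' x] by (simp add: dist_commute)
  ultimately show ?thesis using y that by blast
qed

lemma pole_exponent_le:
  fixes L L' m \<delta> \<tau> :: real
  assumes "L + L' \<le> m" "0 \<le> L" "0 \<le> \<delta>" "0 \<le> \<tau>"
  shows "\<tau> * L + (1 + \<delta>) * \<tau> * L' \<le> \<tau> * ((1 + \<delta>) * m)"
proof -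
  have "L + (1 + \<delta>) * L' \<le> (1 + \<delta>) * (L + L')" using assms by (simp add: algebra_simps)
  also have "\<dots> \<le> (1 + \<delta>) * m" using assms by (intro mult_left_mono) auto
  finally have "\<tau> * (L + (1 + \<delta>) * L') \<le> \<tau> * ((1 + \<delta>) * m)" using assms(4) by (rule mult_left_mono)
  then show ?thesis by (simp add: algebra_simps)
qed

lemma indicator_function_ge:
  assumes T1: "0 < T1" "T1 < T" and \<delta>: "\<delta> > 0"
  obtains C E where "C > 0"
    "\<And>\<tau>. \<tau> \<ge> 1 \<Longrightarrow> C * exp (- \<tau> * ((1 + \<delta>) * (path_length + 7 * \<delta>))) - E * exp (- \<tau> * T1) \<le> indicator_function \<tau>"
proof -
  obtain E where E: "\<And>\<tau> \<sigma> g g'. \<tau> \<ge> 1 \<Longrightarrow> \<bar>\<sigma>\<bar> = 1 \<Longrightarrow> barrier D B \<tau> \<sigma> g g' \<Longrightarrow>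
     - \<sigma> * indicator_function \<tau> \<le> (LINT x:B'|lborel. g x) + E * exp (- \<tau> * T1)"
    using indicator_function_le_barrier[OF T1] by metis
  obtain q r y y' where r: "r > 0" "ball q r \<subseteq> D" and y: "y \<in> closure B" "y' \<in> closure B'"
    and path: "dist q y + dist q y' \<le> path_length + 3 * \<delta>"
    by (rule near_optimal_pole[OF \<delta>])
  obtain e where e: "0 < e" "e \<le> \<delta>" and src: "\<And>\<tau> x. 1 \<le> \<tau> \<Longrightarrow> r \<le> norm x \<Longrightarrow>
      yukawa_src ((1 + \<delta>) * \<tau>) e x \<le> (((1 + \<delta>) * \<tau>)\<^sup>2 - \<tau>\<^sup>2) * yukawa ((1 + \<delta>) * \<tau>) e x"
    using yukawa_src_le_mass_gap[OF \<delta> r(1)] by metis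
  obtain M where M: "M > 0" "\<And>x z. x \<in> closure D \<Longrightarrow> z \<in> B \<Longrightarrow> dist x z + \<delta> \<le> M"
    using obstacle_source_distance_bounded[of \<delta>] by metis
  define L L' where "L = dist q y + 2 * \<delta>" and "L' = dist q y' + 2 * \<delta>"
  have L: "L \<ge> 0" "L' > 0" using \<delta> by (simp_all add: L_def L'_def add_nonneg_pos)
  define \<beta> \<beta>' where "\<beta> = measure lborel (B \<inter> ball y \<delta>)" and "\<beta>' = measure lborel (B' \<inter> ball y' \<delta>)"
  have \<beta>: "\<beta> > 0" "\<beta>' > 0"
    unfolding \<beta>_def \<beta>'_def by (rule measure_open_Int_ball_pos[OF B(2) y(1) \<delta>] measure_open_Int_ball_pos[OF B'(2) y(2) \<delta>])+
  define C where "C = e * \<beta> / (4 * pi * M) * (\<beta>' / L')"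
  have C: "C > 0" using e(1) \<beta> M(1) L by (simp add: C_def)
  show ?thesis
  proof (rule that[OF C])
    fix \<tau> :: real assume \<tau>: "\<tau> \<ge> 1"
    let ?\<kappa> = "(1 + \<delta>) * \<tau>" and ?A = "e * \<beta> / (4 * pi * M) * exp (- \<tau> * L)"
    have \<kappa>: "0 \<le> \<tau>" "\<tau> \<le> ?\<kappa>" "0 \<le> ?\<kappa>" using \<tau> \<delta> by (auto simp: distrib_right)
    have A: "?A \<ge> 0" using e(1) \<beta> M(1) by simp
    have "r \<le> norm (x - q)" if "x \<notin> closure D" for x
      using that r(2) closure_subset[of D] by (force simp: dist_norm norm_minus_commute)
    then have "barrier D B \<tau> 1 (\<lambda>x. - ?A * yukawa ?\<kappa> e (x - q)) (\<lambda>x. - ?A *\<^sub>R yukawa_grad ?\<kappa> e (x - q))"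
      unfolding L_def \<beta>_def using src[OF \<tau>] by (intro pole_barrier[OF \<delta> M \<kappa>(1,2) e(1)]) auto
    from E[OF \<tau> _ this] have "- 1 * indicator_function \<tau> \<le> (LINT x:B'|lborel. - ?A * yukawa ?\<kappa> e (x - q)) + E * exp (- \<tau> * T1)"
      by simp
    then have "?A * (LINT x:B'|lborel. yukawa ?\<kappa> e (x - q)) - E * exp (- \<tau> * T1) \<le> indicator_function \<tau>"
      unfolding set_integral_mult_right by simp
    moreover have "?A * (\<beta>' * (exp (- ?\<kappa> * L') / L')) \<le> ?A * (LINT x:B'|lborel. yukawa ?\<kappa> e (x - q))"
      unfolding L'_def \<beta>'_def by (rule mult_left_mono[OF set_integral_yukawa_ge[OF e \<kappa>(3)] A])
    moreover have "?A * (\<beta>' * (exp (- ?\<kappa> * L') / L')) = C * exp (- (\<tau> * L + ?\<kappa> * L'))"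
      by (simp add: C_def algebra_simps flip: exp_add)
    moreover have "C * exp (- (\<tau> * ((1 + \<delta>) * (path_length + 7 * \<delta>)))) \<le> C * exp (- (\<tau> * L + ?\<kappa> * L'))"
      using path L \<delta> \<kappa>(1) C pole_exponent_le[of L L' "path_length + 7 * \<delta>" \<delta> \<tau>] by (simp add: L_def L'_def)
    ultimately show "C * exp (- \<tau> * ((1 + \<delta>) * (path_length + 7 * \<delta>))) - E * exp (- \<tau> * T1) \<le> indicator_function \<tau>"
      by simp
  qed
qed

lemma eventually_indicator_function_le:
  assumes "path_length < T" and e: "e > 0"
  shows "\<forall>\<^sub>F \<tau> in at_top. indicator_function \<tau> \<le> exp (- \<tau> * (path_length - e))"
proof -
  define T1 where "T1 = (path_length + T) / 2"
  have T1: "0 < T1" "T1 < T" "path_length < T1" using assms(1) path_length_nonneg by (auto simp: T1_def)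
  obtain C E where CE: "\<And>\<tau>. \<tau> \<ge> 1 \<Longrightarrow>
      indicator_function \<tau> \<le> C * exp (- \<tau> * (path_length - 3 * (e / 6))) + E * exp (- \<tau> * T1)"
    using indicator_function_le[OF T1(1,2), of "e / 6"] e by auto
  define b where "b = T1 - path_length + e"
  have "b > 0" using e T1(3) by (simp add: b_def)
  then have "((\<lambda>\<tau>. exp (- \<tau> * (e / 2))) \<longlongrightarrow> 0) at_top" "((\<lambda>\<tau>. exp (- \<tau> * b)) \<longlongrightarrow> 0) at_top"
    using e by real_asymp+
  then have "((\<lambda>\<tau>. C * exp (- \<tau> * (e / 2)) + E * exp (- \<tau> * b)) \<longlongrightarrow> C * 0 + E * 0) at_top"
    by (intro tendsto_intros)
  then have "\<forall>\<^sub>F \<tau> in at_top. C * exp (- \<tau> * (e / 2)) + E * exp (- \<tau> * b) < 1"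
    by (rule order_tendstoD(2)) simp
  then show ?thesis
    using eventually_ge_at_top[of 1]
  proof eventually_elim
    case (elim \<tau>)
    have "indicator_function \<tau> \<le> (C * exp (- \<tau> * (e / 2)) + E * exp (- \<tau> * b)) * exp (- \<tau> * (path_length - e))"
      using CE[OF elim(2)] by (simp add: b_def algebra_simps flip: exp_add)
    also have "\<dots> \<le> 1 * exp (- \<tau> * (path_length - e))"
      using elim(1) by (intro mult_right_mono) auto
    finally show ?case by simp
  qed
qed

lemma eventually_indicator_function_ge:
  assumes "path_length < T" and e: "e > 0"
  shows "\<forall>\<^sub>F \<tau> in at_top. exp (- \<tau> * (path_length + e)) \<le> indicator_function \<tau>"
proof -
  define T1 where "T1 = (path_length + T) / 2"
  have T1: "0 < T1" "T1 < T" "path_length < T1" using assms(1) path_length_nonneg by (auto simp: T1_def)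
  define \<epsilon> where "\<epsilon> = min e ((T1 - path_length) / 2)"
  have \<epsilon>: "0 < \<epsilon>" "\<epsilon> \<le> e" "path_length + \<epsilon> < T1" using e T1(3) by (auto simp: \<epsilon>_def min_def field_simps)
  have "((\<lambda>\<delta>. (1 + \<delta>) * (path_length + 7 * \<delta>)) \<longlongrightarrow> (1 + 0) * (path_length + 7 * 0)) (at_right 0)"
    by (intro tendsto_intros)
  then have "\<forall>\<^sub>F \<delta> in at_right 0. (1 + \<delta>) * (path_length + 7 * \<delta>) < path_length + \<epsilon> / 2"
    using \<epsilon>(1) by (intro order_tendstoD(2)) auto
  then have "\<forall>\<^sub>F \<delta> in at_right 0. 0 < \<delta> \<and> (1 + \<delta>) * (path_length + 7 * \<delta>) \<le> path_length + \<epsilon> / 2"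
    using eventually_at_right_less[of 0] by eventually_elim simp
  from eventually_happens'[OF trivial_limit_at_right_real this]
  obtain \<delta> where \<delta>: "\<delta> > 0" "(1 + \<delta>) * (path_length + 7 * \<delta>) \<le> path_length + \<epsilon> / 2"
    by blast
  obtain C E where C: "C > 0" and CE: "\<And>\<tau>. \<tau> \<ge> 1 \<Longrightarrow>
      C * exp (- \<tau> * ((1 + \<delta>) * (path_length + 7 * \<delta>))) - E * exp (- \<tau> * T1) \<le> indicator_function \<tau>"
    using indicator_function_ge[OF T1(1,2) \<delta>(1)] by metis
  define b where "b = T1 - (path_length + \<epsilon>)"
  have "b > 0" using \<epsilon>(3) by (simp add: b_def)
  then have "((\<lambda>\<tau>. exp (- \<tau> * b)) \<longlongrightarrow> 0) at_top" by real_asymp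
  then have "((\<lambda>\<tau>. E * exp (- \<tau> * b)) \<longlongrightarrow> E * 0) at_top" by (intro tendsto_intros)
  then have "\<forall>\<^sub>F \<tau> in at_top. E * exp (- \<tau> * b) < 1"
    by (rule order_tendstoD(2)) simp
  moreover have "\<forall>\<^sub>F \<tau> in at_top. 2 \<le> C * exp (\<tau> * (\<epsilon> / 2))"
    using C \<epsilon>(1) by real_asymp
  ultimately have "\<forall>\<^sub>F \<tau> in at_top. 1 \<le> C * exp (\<tau> * (\<epsilon> / 2)) - E * exp (- \<tau> * b)"
    by eventually_elim simp
  then show ?thesis
    using eventually_ge_at_top[of 1]
  proof eventually_elim
    case (elim \<tau>)
    have "exp (- \<tau> * (path_length + e)) \<le> 1 * exp (- \<tau> * (path_length + \<epsilon>))"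
      using \<epsilon>(2) elim(2) by simp
    also have "\<dots> \<le> (C * exp (\<tau> * (\<epsilon> / 2)) - E * exp (- \<tau> * b)) * exp (- \<tau> * (path_length + \<epsilon>))"
      using elim(1) by (intro mult_right_mono) auto
    also have "\<dots> = C * exp (- \<tau> * (path_length + \<epsilon> / 2)) - E * exp (- \<tau> * T1)"
      by (simp add: b_def algebra_simps flip: exp_add)
    also have "\<dots> \<le> C * exp (- \<tau> * ((1 + \<delta>) * (path_length + 7 * \<delta>))) - E * exp (- \<tau> * T1)"
      using C \<delta>(2) elim(2) by simp
    also note CE[OF elim(2)]
    finally show ?case .
  qed
qed

end

lemma ln_asymptotics_of_exp_bounds:
  fixes f :: "real \<Rightarrow> real"
  assumes le: "\<And>e. e > 0 \<Longrightarrow> \<forall>\<^sub>F x in at_top. f x \<le> exp (- x * (m - e))"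
    and ge: "\<And>e. e > 0 \<Longrightarrow> \<forall>\<^sub>F x in at_top. exp (- x * (m + e)) \<le> f x"
  shows "((\<lambda>x. ln (f x) / x) \<longlongrightarrow> - m) at_top"
proof (rule tendstoI)
  fix e :: real assume e: "e > 0"
  then have "e / 2 > 0" by simp
  from le[OF this] ge[OF this] eventually_gt_at_top[of 0]
  show "\<forall>\<^sub>F x in at_top. dist (ln (f x) / x) (- m) < e"
  proof eventually_elim
    case (elim x)
    have f: "f x > 0" using elim(2) exp_gt_zero by (rule less_le_trans[rotated])
    have "ln (f x) \<le> - x * (m - e / 2)"
      using ln_mono[OF elim(1) f] by simp
    moreover have "- x * (m + e / 2) \<le> ln (f x)"
      using elim(2) f by (simp add: ln_ge_iff)
    ultimately have "- (m + e / 2) \<le> ln (f x) / x" "ln (f x) / x \<le> - (m - e / 2)"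
      using elim(3) by (simp_all add: field_simps)
    then show ?case using e by (simp add: dist_real_def abs_less_iff)
  qed
qed

theorem theorem1p1:
  fixes D :: "(real^3) set" and T :: real
    and p p' :: "real^3" and \<eta> \<eta>' :: real
    and u :: "(real^3) \<times> real \<Rightarrow> real"
  assumes "D \<noteq> {}" and "open D" and "bounded D" and "C2_boundary D"
    and "connected (- closure D)"
    and "T > 0"
    and "\<eta> > 0" and "\<eta>' > 0"
    and "closure (ball p \<eta>) \<inter> closure D = {}"
    and "closure (ball p' \<eta>') \<inter> closure D = {}"
    and "wave_weak_sol D T (indicator (ball p \<eta>)) u"
    and "convex hull (closure (ball p \<eta>) \<union> closure (ball p' \<eta>')) \<inter> frontier D = {}"
    and "T > Inf {dist y x + dist x y' | x y y'.
                   x \<in> frontier D \<and> y \<in> sphere p \<eta> \<and> y' \<in> sphere p' \<eta>'}"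
  shows "(\<exists>\<tau>0>0. \<forall>\<tau>\<ge>\<tau>0. Ifun T u p \<eta> p' \<eta>' \<tau> > 0) \<and>
         ((\<lambda>\<tau>. ln (Ifun T u p \<eta> p' \<eta>' \<tau>) / \<tau>)
          \<longlongrightarrow> - Inf {dist y x + dist x y' | x y y'.
                   x \<in> frontier D \<and> y \<in> sphere p \<eta> \<and> y' \<in> sphere p' \<eta>'}) at_top"
proof -
  interpret wave_obstacle D T u "ball p \<eta>" "ball p' \<eta>'"
    using assms by unfold_locales auto
  have Ifun: "Ifun T u p \<eta> p' \<eta>' = indicator_function"
    by (simp add: Ifun_def indicator_function_def fun_eq_iff)
  have path: "Inf {dist y x + dist x y' | x y y'. x \<in> frontier D \<and> y \<in> sphere p \<eta> \<and> y' \<in> sphere p' \<eta>'} = path_length"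
    using assms(7,8) by (simp add: path_length_def)
  then have "path_length < T" using assms(13) by simp
  note le = eventually_indicator_function_le[OF this] and ge = eventually_indicator_function_ge[OF this]
  have "\<forall>\<^sub>F \<tau> in at_top. indicator_function \<tau> > 0"
    using ge[of 1] by (auto elim!: eventually_mono intro: less_le_trans[OF exp_gt_zero])
  then obtain N where "\<And>\<tau>. \<tau> \<ge> N \<Longrightarrow> indicator_function \<tau> > 0"
    by (auto simp: eventually_at_top_linorder)
  then have "\<exists>\<tau>0>0. \<forall>\<tau>\<ge>\<tau>0. indicator_function \<tau> > 0"
    by (intro exI[of _ "max 1 N"]) auto
  moreover have "((\<lambda>\<tau>. ln (indicator_function \<tau>) / \<tau>) \<longlongrightarrow> - path_length) at_top"
    by (rule ln_asymptotics_of_exp_bounds[OF le ge])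
  ultimately show ?thesis unfolding Ifun path ..
qed

end
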